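(* Let $A,\Delta,M$ be independent indeterminates and let $F(z)=F_{A,\Delta,M}(z)\in\mathbb{Q}(A,\Delta,M)[z]$ be the explicit degree 5 polynomial given in the context. Let $\delta,q$ be independent indeterminates and let $P(u)=P_{\delta,q}(u)\in\mathbb{Q}(\delta,q)[u]$ be the explicit degree 5 polynomial given in the context. Then $F$ (with parameters $(t_1,t_2,t_3)=(A,\Delta,M)$) and $P$ (with parameters $(t_1,t_2)=(\delta,q)$) are both generic polynomials outside $\{2,3,5\}$ with group $S_5$, in the sense defined in the context.
   Context: **The polynomial $F$.** $$F_{A,\Delta,M}(z)=288M^2z^5+c_4z^4+c_3z^3+c_2z^2+c_1z+c_0,$$ where $$c_4=279890625\,\Delta^2A^2+262154475\,\Delta A^4-3666000\,MA\Delta-2041200\,MA^3+59541075\,A^6+87890625\,\Delta^3+14880\,M^2,$$ $$c_3=3711849300\,\Delta A^4+6170437500\,\Delta^2A^2-83428000\,MA\Delta-23781600\,MA^3+538658100\,A^6-351562500\,\Delta^3+259520\,M^2,$$ $$c_2=15376579650\,\Delta A^4+22131843750\,\Delta^2A^2-372984000\,MA\Delta-130420800\,MA^3+2685964050\,A^6+527343750\,\Delta^3+1583040\,M^2,$$ $$c_1=9952607700\,\Delta A^4+15161437500\,\Delta^2A^2-243612000\,MA\Delta-79322400\,MA^3+1619910900\,A^6-351562500\,\Delta^3+971040\,M^2,$$ $$c_0=-42806000\,MA\Delta+1743266475\,\Delta A^4+2912390625\,\Delta^2A^2+157216\,M^2-12805200\,MA^3+260745075\,A^6+87890625\,\Delta^3.$$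 **The polynomial $P$.** $$P_{\delta,q}(u)=u^2(u+50)^3-20\,\bigl(611\delta u^3+8505u^3+39270\delta u^2+263250u^2+4050000u+438000\delta u+100000\delta\bigr)\,u\,q+2(25+3\delta)\,R(u)\,q^2,$$ where $$R(u)=625\delta^2u^4+44550\delta u^4+793881u^4+18370800u^3+3175200\delta u^3-10000\delta^2u^3+262440000u^2+60000\delta^2u^2+25336800\delta u^2-160000\delta^2u+12960000\delta u+160000\delta^2.$$ **Generic polynomial outside $S$ with group $G$.** Let $S$ be a finite set of primes and $G$ a finite group. A generic polynomial outside $S$ with group $G$ is a polynomial $Q$ in one variable with coefficients in $\mathbb{Q}(t_1,\dots,t_m)$ such that: 1. The Galois group of the splitting field of $Q$ over $\mathbb{Q}(t_1,\dots,t_m)$ is $G$. 2. For every prime $p\notin S$, the reduction of $Q$ modulo $p$ is defined, separable and irreducible, and the Galois group of its splitting field over $\mathbb{F}_p(t_1,\dots,t_m)$ is $G$. 3. If $K$ is a field of characteristic $0$ and $L/K$ is a Galois extension with group $G$, then $L$ is the splitting field over $K$ of a polynomial obtained from $Q$ by specializing $(t_1,\dots,t_m)$ to some values $(\tau_1,\dots,\tau_m)$ in $K$. 4. If $K$ is a field of finite characteristic $p\notin S$ and $L/K$ is a Galois extension with group $G$, then $L$ is the splitting field over $K$ of a polynomial obtained by reducing $Q$ modulo $p$ and then specializing $(t_1,\dots,t_m)$ to some values $(\tau_1,\dots,\tau_m)$ in $K$. *)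

theory Defs
  imports
    "HOL-Algebra.Algebraic_Closure_Type"
    "HOL-Algebra.Generated_Fields"
    "HOL-Algebra.Bij"
    "HOL-Algebra.Sym_Groups"
    "HOL-Library.Poly_Mapping"
    "HOL-Library.Numeral_Type"
    "HOL-Computational_Algebra.Fraction_Field"
    "Berlekamp_Zassenhaus.Finite_Field"
begin

abbreviation is_subfield :: "'a::field set \<Rightarrow> bool" where
  "is_subfield K \<equiv> subfield K (ring_of_type_algebra :: 'a ring)"

definition polys_over :: "'a::zero set \<Rightarrow> 'a poly set" where
  "polys_over K = {f. \<forall>i. coeff f i \<in> K}"

definition splits_over :: "'a::field set \<Rightarrow> 'a poly \<Rightarrow> bool" where
  "splits_over L f \<longleftrightarrow>
     (\<exists>c xs. c \<noteq> 0 \<and> set xs \<subseteq> L \<and> f = smult c (\<Prod>x\<leftarrow>xs. [:- x, 1:]))"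

definition splitting_field_over :: "'a::field set \<Rightarrow> 'a poly \<Rightarrow> 'a set \<Rightarrow> bool" where
  "splitting_field_over K f L \<longleftrightarrow>
     is_subfield K \<and> f \<in> polys_over K \<and> splits_over L f \<and>
     L = generate_field ring_of_type_algebra (K \<union> {x \<in> L. poly f x = 0})"

definition irreducible_over :: "'a::field set \<Rightarrow> 'a poly \<Rightarrow> bool" where
  "irreducible_over K f \<longleftrightarrow>
     f \<in> polys_over K \<and> degree f > 0 \<and>
     (\<forall>g\<in>polys_over K. \<forall>h\<in>polys_over K. f = g * h \<longrightarrow> degree g = 0 \<or> degree h = 0)"

definition separable_poly :: "'a::field poly \<Rightarrow> bool" where
  "separable_poly f \<longleftrightarrow> rsquarefree (map_poly to_ac f)"

definition algebraic_ext :: "'a::field set \<Rightarrow> 'a set \<Rightarrow> bool" where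
  "algebraic_ext K L \<longleftrightarrow> (\<forall>x\<in>L. \<exists>f\<in>polys_over K. f \<noteq> 0 \<and> poly f x = 0)"

definition normal_ext :: "'a::field set \<Rightarrow> 'a set \<Rightarrow> bool" where
  "normal_ext K L \<longleftrightarrow>
     algebraic_ext K L \<and>
     (\<forall>f. irreducible_over K f \<and> (\<exists>x\<in>L. poly f x = 0) \<longrightarrow> splits_over L f)"

definition separable_ext :: "'a::field set \<Rightarrow> 'a set \<Rightarrow> bool" where
  "separable_ext K L \<longleftrightarrow>
     algebraic_ext K L \<and>
     (\<forall>f. irreducible_over K f \<and> (\<exists>x\<in>L. poly f x = 0) \<longrightarrow> separable_poly f)"

definition galois_ext :: "'a::field set \<Rightarrow> 'a set \<Rightarrow> bool" where
  "galois_ext K L \<longleftrightarrow>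
     is_subfield K \<and> is_subfield L \<and> K \<subseteq> L \<and> normal_ext K L \<and> separable_ext K L"

text \<open>The group of field automorphisms of \<open>L\<close> fixing \<open>K\<close> pointwise, under composition.
  Automorphisms are extensional, i.e. \<open>undefined\<close> outside \<open>L\<close>, so that each is counted once.\<close>

definition galois_group :: "'a::field set \<Rightarrow> 'a set \<Rightarrow> ('a \<Rightarrow> 'a) monoid" where
  "galois_group K L = (BijGroup L) \<lparr>carrier := {\<sigma> \<in> Bij L.
      (\<forall>x\<in>L. \<forall>y\<in>L. \<sigma> (x + y) = \<sigma> x + \<sigma> y \<and> \<sigma> (x * y) = \<sigma> x * \<sigma> y) \<and>
      (\<forall>x\<in>K. \<sigma> x = x)}\<rparr>"

text \<open>For a polynomial over a field type \<open>'a\<close>, the splitting field is formed inside the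
  algebraic closure of \<open>'a\<close>; it is unique there.\<close>

definition has_galois_group :: "'a::field poly \<Rightarrow> 'g monoid \<Rightarrow> bool" where
  "has_galois_group f G \<longleftrightarrow>
     (\<exists>L. splitting_field_over (range to_ac) (map_poly to_ac f) L \<and>
          galois_group (range to_ac) L \<cong> G)"


text \<open>The indeterminates are indexed by a finite type \<open>'v\<close>, so their number is \<open>CARD('v)\<close>. The
  order on \<open>'v\<close> is used only to derive that the polynomial ring is an integral domain.\<close>

type_synonym ('k, 'v) multipoly = "('v \<Rightarrow>\<^sub>0 nat) \<Rightarrow>\<^sub>0 'k"
type_synonym ('k, 'v) ratfun = "('k, 'v) multipoly fract"

definition indet :: "'v \<Rightarrow> ('k::idom, 'v::{finite,linorder}) ratfun" where
  "indet v = Fract (Poly_Mapping.single (Poly_Mapping.single v 1) 1) 1"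

definition eval_multipoly ::
    "('k::zero \<Rightarrow> 'a::comm_ring_1) \<Rightarrow> ('v::finite \<Rightarrow> 'a) \<Rightarrow> ('k, 'v) multipoly \<Rightarrow> 'a" where
  "eval_multipoly \<iota> \<tau> c =
     (\<Sum>m\<in>Poly_Mapping.keys c.
        \<iota> (Poly_Mapping.lookup c m) * (\<Prod>v\<in>UNIV. \<tau> v ^ Poly_Mapping.lookup m v))"

text \<open>\<open>\<iota>\<close> is the embedding of the constants. The specialization at \<open>\<tau>\<close> is defined if the rational
  function can be written with a denominator that does not vanish at \<open>\<tau>\<close>.\<close>

definition ratfun_specializes ::
    "('k::idom \<Rightarrow> 'a::field) \<Rightarrow> ('v::{finite,linorder} \<Rightarrow> 'a) \<Rightarrow> ('k, 'v) ratfun \<Rightarrow> 'a \<Rightarrow> bool" where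
  "ratfun_specializes \<iota> \<tau> r x \<longleftrightarrow>
     (\<exists>c d. eval_multipoly \<iota> \<tau> d \<noteq> 0 \<and> r = Fract c d \<and>
            x = eval_multipoly \<iota> \<tau> c / eval_multipoly \<iota> \<tau> d)"

definition specializes_to ::
    "('k::idom \<Rightarrow> 'a::field) \<Rightarrow> ('v::{finite,linorder} \<Rightarrow> 'a) \<Rightarrow>
     ('k, 'v) ratfun poly \<Rightarrow> 'a poly \<Rightarrow> bool" where
  "specializes_to \<iota> \<tau> Q f \<longleftrightarrow> (\<forall>i. ratfun_specializes \<iota> \<tau> (coeff Q i) (coeff f i))"

text \<open>Reduction modulo \<open>p = CARD('p)\<close> is the residue map of the localization of the integral
  polynomial ring at the prime ideal generated by \<open>p\<close>.\<close>

definition ratfun_reduces ::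
    "(rat, 'v::{finite,linorder}) ratfun \<Rightarrow> ('p::prime_card mod_ring, 'v) ratfun \<Rightarrow> bool" where
  "ratfun_reduces r s \<longleftrightarrow>
     (\<exists>(a :: (int, 'v) multipoly) (b :: (int, 'v) multipoly).
        (Poly_Mapping.map of_int b :: ('p mod_ring, 'v) multipoly) \<noteq> 0 \<and>
        r = Fract (Poly_Mapping.map of_int a) (Poly_Mapping.map of_int b) \<and>
        s = Fract (Poly_Mapping.map of_int a) (Poly_Mapping.map of_int b))"

definition reduces_to ::
    "(rat, 'v::{finite,linorder}) ratfun poly \<Rightarrow> ('p::prime_card mod_ring, 'v) ratfun poly \<Rightarrow> bool"
    where
  "reduces_to Q R \<longleftrightarrow> (\<forall>i. ratfun_reduces (coeff Q i) (coeff R i))"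

text \<open>For \<open>'a\<close> of characteristic \<open>CARD('p)\<close> this is the embedding of the prime field.\<close>

definition of_mod_ring :: "'p::prime_card mod_ring \<Rightarrow> 'a::field" where
  "of_mod_ring x = of_int (to_int_mod_ring x)"


definition generic_char_zero ::
    "'l::field_char_0 itself \<Rightarrow> 'g monoid \<Rightarrow> (rat, 'v::{finite,linorder}) ratfun poly \<Rightarrow> bool" where
  "generic_char_zero _ G Q \<longleftrightarrow>
     has_galois_group Q G \<and>
     (\<forall>(K :: 'l set) L. galois_ext K L \<and> galois_group K L \<cong> G \<longrightarrow>
        (\<exists>\<tau> f. range \<tau> \<subseteq> K \<and> specializes_to of_rat \<tau> Q f \<and> splitting_field_over K f L))"

definition generic_char_p ::
    "'p::prime_card itself \<Rightarrow> 'l::field itself \<Rightarrow> 'g monoid \<Rightarrow>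
     (rat, 'v::{finite,linorder}) ratfun poly \<Rightarrow> bool" where
  "generic_char_p _ _ G Q \<longleftrightarrow>
     (\<exists>R :: ('p mod_ring, 'v) ratfun poly. reduces_to Q R \<and>
        separable_poly R \<and> irreducible R \<and> has_galois_group R G \<and>
        (CHAR('l) = CARD('p) \<longrightarrow>
          (\<forall>(K :: 'l set) L. galois_ext K L \<and> galois_group K L \<cong> G \<longrightarrow>
            (\<exists>\<tau> f. range \<tau> \<subseteq> K \<and> specializes_to of_mod_ring \<tau> R f \<and>
                   splitting_field_over K f L))))"

text \<open>HOL cannot quantify over types inside a formula, so the type arguments stand for the
  quantifiers of the mathematical definition: \<open>'p\<close> for the prime \<open>p = CARD('p)\<close>, with prime field
  \<open>'p mod_ring\<close>, and \<open>'l0\<close>, \<open>'lp\<close> for the ambient fields of the extensions \<open>L/K\<close> of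
  characteristic zero and \<open>p\<close>. A polynomial \<open>Q\<close> is generic outside \<open>S\<close> with group \<open>G\<close> if the
  predicate holds for all \<open>'p\<close>, \<open>'l0\<close> and \<open>'lp\<close>.\<close>

definition generic_polynomial_outside ::
    "'p::prime_card itself \<Rightarrow> 'l0::field_char_0 itself \<Rightarrow> 'lp::field itself \<Rightarrow>
     nat set \<Rightarrow> 'g monoid \<Rightarrow> (rat, 'v::{finite,linorder}) ratfun poly \<Rightarrow> bool" where
  "generic_polynomial_outside P0 L0 Lp S G Q \<longleftrightarrow>
     finite S \<and> (\<forall>p\<in>S. prime p) \<and> group G \<and> finite (carrier G) \<and>
     generic_char_zero L0 G Q \<and>
     (CARD('p) \<notin> S \<longrightarrow> generic_char_p P0 Lp G Q)"


definition F_poly :: "'a::comm_ring_1 \<Rightarrow> 'a \<Rightarrow> 'a \<Rightarrow> 'a poly" where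
  "F_poly A \<Delta> M =
    (let
       c4 = 279890625 * \<Delta>^2 * A^2 + 262154475 * \<Delta> * A^4 - 3666000 * M * A * \<Delta>
            - 2041200 * M * A^3 + 59541075 * A^6 + 87890625 * \<Delta>^3 + 14880 * M^2;
       c3 = 3711849300 * \<Delta> * A^4 + 6170437500 * \<Delta>^2 * A^2 - 83428000 * M * A * \<Delta>
            - 23781600 * M * A^3 + 538658100 * A^6 - 351562500 * \<Delta>^3 + 259520 * M^2;
       c2 = 15376579650 * \<Delta> * A^4 + 22131843750 * \<Delta>^2 * A^2 - 372984000 * M * A * \<Delta>
            - 130420800 * M * A^3 + 2685964050 * A^6 + 527343750 * \<Delta>^3 + 1583040 * M^2;
       c1 = 9952607700 * \<Delta> * A^4 + 15161437500 * \<Delta>^2 * A^2 - 243612000 * M * A * \<Delta>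
            - 79322400 * M * A^3 + 1619910900 * A^6 - 351562500 * \<Delta>^3 + 971040 * M^2;
       c0 = - 42806000 * M * A * \<Delta> + 1743266475 * \<Delta> * A^4 + 2912390625 * \<Delta>^2 * A^2
            + 157216 * M^2 - 12805200 * M * A^3 + 260745075 * A^6 + 87890625 * \<Delta>^3
     in [:c0, c1, c2, c3, c4, 288 * M^2:])"

definition P_poly :: "'a::comm_ring_1 \<Rightarrow> 'a \<Rightarrow> 'a poly" where
  "P_poly \<delta>' q' =
    (let
       u = [:0, 1:]; \<delta> = [:\<delta>':]; q = [:q':];
       R = 625 * \<delta>^2 * u^4 + 44550 * \<delta> * u^4 + 793881 * u^4 + 18370800 * u^3
           + 3175200 * \<delta> * u^3 - 10000 * \<delta>^2 * u^3 + 262440000 * u^2 + 60000 * \<delta>^2 * u^2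
           + 25336800 * \<delta> * u^2 - 160000 * \<delta>^2 * u + 12960000 * \<delta> * u + 160000 * \<delta>^2
     in u^2 * (u + 50)^3
        - 20 * (611 * \<delta> * u^3 + 8505 * u^3 + 39270 * \<delta> * u^2 + 263250 * u^2 + 4050000 * u
                + 438000 * \<delta> * u + 100000 * \<delta>) * u * q
        + 2 * (25 + 3 * \<delta>) * R * q^2)"

text \<open>In the three-element type \<open>3\<close> the elements are \<open>0\<close>, \<open>1\<close>, \<open>2\<close>; in the type \<open>2\<close> they are
  \<open>0\<close>, \<open>1\<close>.\<close>

definition F_generic :: "(rat, 3) ratfun poly" where
  "F_generic = F_poly (indet 0) (indet 1) (indet 2)"

definition P_generic :: "(rat, 2) ratfun poly" where
  "P_generic = P_poly (indet 0) (indet 1)"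

end

theory Submission
  imports Defs
begin

text \<open>
  Let \<open>y\<^sub>1, \<dots>, y\<^sub>5\<close> be distinct points of the projective line. Moving \<open>y\<^sub>j\<close> to infinity turns the other
  four points into the roots of a quartic, and a suitable quotient \<open>u\<^sub>j\<close> of invariants of that quartic
  depends only on the configuration. The \<open>u\<^sub>j\<close> are permuted like the \<open>y\<^sub>j\<close>, and they are the roots of
  \<open>P\<close> with \<open>\<delta>\<close> and \<open>q\<close> specialized to two absolute invariants of the binary quintic with roots \<open>y\<^sub>j\<close>;
  moreover \<open>27 F(z) = 32 M\<^sup>2 P(3 z + 1)\<close> for \<open>\<delta> = 25 \<Delta> / A\<^sup>2\<close> and \<open>q = A\<^sup>3 / (8 M)\<close>.

  Given an \<open>S\<^sub>5\<close>-extension \<open>L/K\<close>, choose \<open>y\<^sub>j \<in> L\<close> permuted by the Galois group. Then \<open>\<delta>\<close> and \<open>q\<close> lie in \<open>K\<close>,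
  and \<open>L\<close> is the splitting field of \<open>P\<close> as soon as the \<open>u\<^sub>j\<close> are distinct. This is a nonvanishing
  condition on the \<open>y\<^sub>j\<close>, which can be met because \<open>K\<close> is infinite (finite fields have only abelian extensions).

  For the Galois group over \<open>k(\<delta>, q)\<close>, take indeterminates \<open>y\<^sub>j\<close>: the group \<open>S\<^sub>5\<close> acts on \<open>k(y\<^sub>1, \<dots>, y\<^sub>5)\<close>, and
  \<open>\<delta>\<close> and \<open>q\<close> remain algebraically independent, since every generic pair \<open>(\<delta>, q)\<close> comes from a
  configuration over the algebraic closure.
\<close>

subsection \<open>Relations compatible with the ring operations\<close>

text \<open>The root of \<open>P\<close> attached to \<open>y j\<close> is
  \<open>-25 T / S^2\<close>, with \<open>S\<close> and \<open>T\<close> the values of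
  \<open>covS\<close> and \<open>covT\<close> at \<open>y j\<close>. Every point enters numerator
  and denominator to the same degree, so this quotient, like \<open>delta5\<close> and
  \<open>q5\<close>, is unchanged by projective maps. Hence \<open>y j\<close> may be moved to
  infinity, and being a root of \<open>P\<close> becomes one polynomial identity in the three
  coefficients of a depressed quartic. Projective invariance also means that five points carry only
  two independent parameters, while \<open>F\<close> has three. The third is the scale of the
  points: \<open>disc5\<close> picks up a power of \<open>c\<close> when all points are multiplied
  by \<open>c\<close>. The excluded primes are those dividing constants that must be invertible:
  \<open>4\<close> in the centring of the quartic, \<open>25\<close> in the roots of
  \<open>P\<close>, and coefficients such as \<open>288\<close>, \<open>320000\<close> and
  \<open>18\<close> that keep a polynomial from degenerating. As the field of constants may be
  finite, the polynomial \<open>good5\<close> is shown to be nonzero at indeterminate points by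
  testing it over an algebraic closure.\<close>

text \<open>
  Partial homomorphisms are modelled as relations, so that embeddings, automorphisms, specializations
  and reduction modulo a prime are all instances of one notion.
\<close>

abbreviation fun_graph :: "('a \<Rightarrow> 'b) \<Rightarrow> ('a \<times> 'b) set" where
  "fun_graph h \<equiv> range (\<lambda>x. (x, h x))"

abbreviation graph_on :: "'a set \<Rightarrow> ('a \<Rightarrow> 'b) \<Rightarrow> ('a \<times> 'b) set" where
  "graph_on L h \<equiv> {(x, h x) |x. x \<in> L}"

definition poly_rel :: "('a::zero \<times> 'b::zero) set \<Rightarrow> 'a poly \<Rightarrow> 'b poly \<Rightarrow> bool" where
  "poly_rel R f g \<longleftrightarrow> (\<forall>i. (coeff f i, coeff g i) \<in> R)"

text \<open>A subring of the product of the two rings. Specialization and reduction satisfy only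
  these axioms: a rational function whose value is zero has an inverse with a pole.\<close>

locale ring_relation =
  fixes R :: "('a::comm_ring_1 \<times> 'b::comm_ring_1) set"
  assumes ring_rel: "(0, 0) \<in> R \<and> (1, 1) \<in> R \<and>
     (\<forall>x y x' y'. (x, y) \<in> R \<longrightarrow> (x', y') \<in> R \<longrightarrow> (x + x', y + y') \<in> R \<and> (x * x', y * y') \<in> R) \<and>
     (\<forall>x y. (x, y) \<in> R \<longrightarrow> (- x, - y) \<in> R)"
begin

lemma zero: "(0, 0) \<in> R" and one: "(1, 1) \<in> R"
  and add: "(x, y) \<in> R \<Longrightarrow> (x', y') \<in> R \<Longrightarrow> (x + x', y + y') \<in> R"
  and mult: "(x, y) \<in> R \<Longrightarrow> (x', y') \<in> R \<Longrightarrow> (x * x', y * y') \<in> R"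
  and uminus: "(x, y) \<in> R \<Longrightarrow> (- x, - y) \<in> R"
  using ring_rel by blast+

lemma diff: "(x, y) \<in> R \<Longrightarrow> (x', y') \<in> R \<Longrightarrow> (x - x', y - y') \<in> R"
  using add[OF _ uminus] by fastforce

lemma power: "(x, y) \<in> R \<Longrightarrow> (x ^ n, y ^ n) \<in> R"
  by (induction n) (auto intro: one mult)

lemma numeral: "(numeral n, numeral n) \<in> R"
  by (induction n) (simp_all only: numeral.simps, (blast intro: one add)+)

lemma sum: "(\<And>i. i \<in> A \<Longrightarrow> (f i, g i) \<in> R) \<Longrightarrow> (sum f A, sum g A) \<in> R"
  by (induction A rule: infinite_finite_induct) (auto intro: zero add)

lemma prod: "(\<And>i. i \<in> A \<Longrightarrow> (f i, g i) \<in> R) \<Longrightarrow> (prod f A, prod g A) \<in> R"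
  by (induction A rule: infinite_finite_induct) (auto intro: one mult)

lemma poly_pCons: "(a, b) \<in> R \<Longrightarrow> poly_rel R f g \<Longrightarrow> poly_rel R (pCons a f) (pCons b g)"
  by (auto simp: poly_rel_def coeff_pCons split: nat.split)

lemma poly_0: "poly_rel R 0 0"
  by (simp add: poly_rel_def zero)

lemma poly_rel_ring_rel: "ring_relation {(f, g). poly_rel R f g}"
proof -
  have "poly_rel R (f * f') (g * g')" if "poly_rel R f g" "poly_rel R f' g'" for f g f' g'
    using that unfolding poly_rel_def coeff_mult by (auto intro!: sum mult)
  moreover have "poly_rel R 1 1" unfolding one_pCons by (intro poly_pCons one poly_0)
  ultimately show ?thesis unfolding ring_relation_def
    by (auto simp: poly_0) (auto simp: poly_rel_def intro: add uminus)
qed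

lemma poly_rel_diff: "poly_rel R f g \<Longrightarrow> poly_rel R f' g' \<Longrightarrow> poly_rel R (f - f') (g - g')"
  and poly_rel_add: "poly_rel R f g \<Longrightarrow> poly_rel R f' g' \<Longrightarrow> poly_rel R (f + f') (g + g')"
  and poly_rel_mult: "poly_rel R f g \<Longrightarrow> poly_rel R f' g' \<Longrightarrow> poly_rel R (f * f') (g * g')"
  and poly_rel_power: "poly_rel R f g \<Longrightarrow> poly_rel R (f ^ n) (g ^ n)"
  and poly_rel_numeral: "poly_rel R (numeral k) (numeral k)"
proof -
  interpret P: ring_relation "{(f, g). poly_rel R f g}" by (rule poly_rel_ring_rel)
  show "poly_rel R f g \<Longrightarrow> poly_rel R f' g' \<Longrightarrow> poly_rel R (f - f') (g - g')"
    using P.diff by auto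
  show "poly_rel R f g \<Longrightarrow> poly_rel R f' g' \<Longrightarrow> poly_rel R (f + f') (g + g')"
    using P.add by auto
  show "poly_rel R f g \<Longrightarrow> poly_rel R f' g' \<Longrightarrow> poly_rel R (f * f') (g * g')"
    using P.mult by auto
  show "poly_rel R f g \<Longrightarrow> poly_rel R (f ^ n) (g ^ n)"
    using P.power by auto
  show "poly_rel R (numeral k) (numeral k)"
    using P.numeral by auto
qed

lemma poly_eval:
  assumes "poly_rel R f g" "(x, y) \<in> R"
  shows "(poly f x, poly g y) \<in> R"
proof -
  define n where "n = max (degree f) (degree g)"
  have "poly f x = (\<Sum>i\<le>n. coeff f i * x ^ i)"
    unfolding n_def poly_altdef by (intro sum.mono_neutral_left) (auto simp: coeff_eq_0)
  moreover have "poly g y = (\<Sum>i\<le>n. coeff g i * y ^ i)"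
    unfolding n_def poly_altdef by (intro sum.mono_neutral_left) (auto simp: coeff_eq_0)
  ultimately show ?thesis using assms by (auto simp: poly_rel_def intro!: sum mult power)
qed

lemma poly_rel_linear_factors:
  assumes "list_all2 (\<lambda>a b. (a, b) \<in> R) as bs"
  shows "poly_rel R (\<Prod>a\<leftarrow>as. [:- a, 1:]) (\<Prod>b\<leftarrow>bs. [:- b, 1:])"
  using assms
proof (induction rule: list_all2_induct)
  case Nil
  show ?case unfolding list.map prod_list.Nil one_pCons by (intro poly_pCons one poly_0)
next
  case (Cons a as b bs)
  then show ?case unfolding list.map prod_list.Cons
    by (intro poly_rel_mult poly_pCons poly_0 one uminus)
qed

lemma P_poly_rel:
  assumes "(d, d') \<in> R" "(q, q') \<in> R"
  shows "poly_rel R (P_poly d q) (P_poly d' q')"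
proof -
  have "poly_rel R [:d:] [:d':]" "poly_rel R [:q:] [:q':]" "poly_rel R [:0, 1:] [:0, 1:]"
    using assms by (auto intro!: poly_pCons poly_0 zero one)
  then show ?thesis
    unfolding P_poly_def Let_def
    by (intro poly_rel_add poly_rel_diff poly_rel_mult poly_rel_power poly_rel_numeral)
qed

lemma F_poly_rel:
  assumes "(A, A') \<in> R" "(D, D') \<in> R" "(M, M') \<in> R"
  shows "poly_rel R (F_poly A D M) (F_poly A' D' M')"
  unfolding F_poly_def Let_def
  by (intro poly_pCons poly_0 add diff uminus mult power numeral assms)

end

text \<open>Such a relation is the graph of an embedding of a subfield of \<open>'a\<close> into
  \<open>'b\<close>: closure under \<open>inverse\<close> makes the domain a field, and the
  condition on \<open>0\<close> makes the relation single-valued. As \<open>inverse 0 = 0\<close>,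
  zero needs no exception.\<close>

locale field_relation =
  fixes R :: "('a::field \<times> 'b::field) set"
  assumes field_rel: "ring_relation R \<and> (\<forall>x y. (x, y) \<in> R \<longrightarrow> (inverse x, inverse y) \<in> R) \<and>
     (\<forall>y. (0, y) \<in> R \<longrightarrow> y = 0)"
begin

sublocale ring_relation R
  using field_rel by simp

lemma inverse: "(x, y) \<in> R \<Longrightarrow> (inverse x, inverse y) \<in> R"
  and zero_right: "(0, y) \<in> R \<Longrightarrow> y = 0"
  using field_rel by auto

lemma divide: "(x, y) \<in> R \<Longrightarrow> (x', y') \<in> R \<Longrightarrow> (x / x', y / y') \<in> R"
  unfolding divide_inverse by (intro mult inverse)

lemma unique: "(x, y) \<in> R \<Longrightarrow> (x, y') \<in> R \<Longrightarrow> y = y'"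
  using diff[of x y x y'] zero_right by fastforce

lemma zero_left: "(x, 0) \<in> R \<Longrightarrow> x = 0"
proof (rule ccontr)
  assume x: "(x, 0) \<in> R" "x \<noteq> 0"
  from mult[OF x(1) inverse[OF x(1)]] x(2) have "(1, 0) \<in> R" by simp
  from unique[OF this one] show False by simp
qed

lemma poly_rel_unique: "poly_rel R f g \<Longrightarrow> poly_rel R f g' \<Longrightarrow> g = g'"
  by (auto simp: poly_rel_def intro!: poly_eqI unique)

lemma poly_rel_0: "poly_rel R 0 g \<Longrightarrow> g = 0"
  using poly_rel_unique poly_0 by blast

lemma poly_rel_degree: "poly_rel R f g \<Longrightarrow> degree f = degree g"
proof -
  assume fg: "poly_rel R f g"
  have *: "coeff f i = 0 \<longleftrightarrow> coeff g i = 0" for i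
    using fg zero_left[of "coeff f i"] zero_right[of "coeff g i"] unfolding poly_rel_def by metis
  have "degree f \<le> degree g" by (rule degree_le) (simp add: * coeff_eq_0)
  moreover have "degree g \<le> degree f" by (rule degree_le) (simp add: coeff_eq_0 flip: *)
  ultimately show "degree f = degree g" by simp
qed

lemma poly_rel_exists:
  assumes "f \<in> polys_over (Domain R)"
  shows "\<exists>g. poly_rel R f g"
proof -
  have "\<forall>i. \<exists>y. (coeff f i, y) \<in> R" using assms by (auto simp: polys_over_def)
  then obtain c where c: "\<And>i. (coeff f i, c i) \<in> R" by metis
  have "c i = 0" if "i > degree f" for i using c[of i] that zero_right by (simp add: coeff_eq_0)
  then have "\<forall>\<^sub>\<infinity>i. c i = 0" unfolding MOST_nat by blast
  then have "coeff (Abs_poly c) = c" by (rule Abs_poly_inverse[unfolded mem_Collect_eq])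
  then show ?thesis using c by (intro exI[of _ "Abs_poly c"]) (simp add: poly_rel_def)
qed

text \<open>Long division runs in both fields at once, with related leading quotients at each step,
  so that quotient and remainder are related again. Divisibility over the domain is thereby carried
  to the image.\<close>

lemma poly_division:
  assumes "poly_rel R f f'" "poly_rel R g g'" "g \<noteq> 0"
  shows "\<exists>q q' r r'. poly_rel R q q' \<and> poly_rel R r r' \<and> f = q * g + r \<and> f' = q' * g' + r' \<and>
    (r = 0 \<or> degree r < degree g)"
  using assms(1)
proof (induction "degree f" arbitrary: f f' rule: less_induct)
  case less
  show ?case
  proof (cases "f = 0 \<or> degree f < degree g")
    case True
    then show ?thesis using less.prems poly_0
      by (intro exI[of _ 0] exI[of _ f] exI[of _ f']) auto
  next
    case False
    define n where "n = degree f - degree g"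
    define c where "c = lead_coeff f / lead_coeff g"
    define c' where "c' = coeff f' (degree f) / coeff g' (degree g)"
    define m where "m = monom c n"
    define m' where "m' = monom c' n"
    have "(c, c') \<in> R" unfolding c_def c'_def using less.prems assms(2)
      by (auto simp: poly_rel_def intro: divide)
    then have m: "poly_rel R m m'" by (auto simp: poly_rel_def m_def m'_def zero)
    define h where "h = f - m * g"
    define h' where "h' = f' - m' * g'"
    have h: "poly_rel R h h'" unfolding h_def h'_def
      by (intro poly_rel_diff poly_rel_mult less.prems assms(2) m)
    have c0: "c \<noteq> 0" using False assms(3) by (simp add: c_def)
    have m0: "m \<noteq> 0" "degree m = n" "lead_coeff m = c"
      using c0 by (auto simp: m_def degree_monom_eq monom_eq_0_iff)
    have dm: "degree (m * g) = degree f"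
      using False assms(3) m0 by (simp add: degree_mult_eq n_def)
    have lm: "lead_coeff (m * g) = lead_coeff f"
      unfolding lead_coeff_mult m0(3) using assms(3) by (simp add: c_def)
    show ?thesis
    proof (cases "h = 0")
      case True
      then show ?thesis using m h poly_rel_0[of h'] h_def h'_def poly_0
        by (intro exI[of _ m] exI[of _ m'] exI[of _ 0]) auto
    next
      case False
      have "degree h < degree f"
      proof (rule le_neq_implies_less)
        show "degree h \<le> degree f" unfolding h_def using dm by (intro degree_diff_le) auto
        show "degree h \<noteq> degree f"
        proof
          assume "degree h = degree f"
          then have "lead_coeff h = 0" using dm lm by (simp add: h_def)
          then show False using False by simp
        qed
      qed
      from less.hyps[OF this h] obtain q q' r r' where
        "poly_rel R q q'" "poly_rel R r r'" "h = q * g + r" "h' = q' * g' + r'" "r = 0 \<or> degree r < degree g"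
        by blast
      moreover have "f = (m + q) * g + r" "f' = (m' + q') * g' + r'"
        using calculation by (simp_all add: h_def h'_def algebra_simps)
      moreover have "poly_rel R (m + q) (m' + q')" by (intro poly_rel_add m calculation)
      ultimately show ?thesis by blast
    qed
  qed
qed

end

subsection \<open>Subfields\<close>

lemma inv_ring_of_type_algebra:
  fixes x :: "'a::field"
  assumes "x \<noteq> 0"
  shows "inv\<^bsub>ring_of_type_algebra\<^esub> x = inverse x"
proof -
  interpret F: field "ring_of_type_algebra :: 'a ring" by (rule field_from_type_algebra)
  show ?thesis
    using assms by (intro F.comm_inv_char) (auto simp: ring_of_type_algebra_def)
qed

lemma uminus_ring_of_type_algebra:
  fixes x :: "'a::field"
  shows "\<ominus>\<^bsub>ring_of_type_algebra\<^esub> x = - x"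
proof -
  interpret F: field "ring_of_type_algebra :: 'a ring" by (rule field_from_type_algebra)
  show ?thesis
    by (rule F.minus_equality) (auto simp: ring_of_type_algebra_def)
qed

text \<open>Translates the record-based notion into the type class operations. The convention
  \<open>inverse 0 = 0\<close> lets closure under inverses be stated for all elements.\<close>

lemma is_subfield_iff:
  fixes K :: "'a::field set"
  shows "is_subfield K \<longleftrightarrow> 0 \<in> K \<and> 1 \<in> K \<and> (\<forall>x\<in>K. \<forall>y\<in>K. x + y \<in> K \<and> x * y \<in> K) \<and>
     (\<forall>x\<in>K. - x \<in> K \<and> inverse x \<in> K)" (is "_ = ?R")
proof -
  interpret F: field "ring_of_type_algebra :: 'a ring" by (rule field_from_type_algebra)
  show ?thesis
  proof
    assume K: "is_subfield K"
    note s = subringE[OF subfieldE(1)[OF K], unfolded uminus_ring_of_type_algebra]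
    have "inverse x \<in> K" if "x \<in> K" for x
    proof (cases "x = 0")
      case False
      then have "inv\<^bsub>ring_of_type_algebra\<^esub> x \<in> K - {\<zero>\<^bsub>ring_of_type_algebra\<^esub>}"
        using that by (intro F.subfield_m_inv(1)[OF K]) (simp add: ring_of_type_algebra_def)
      then show ?thesis using False by (simp add: inv_ring_of_type_algebra)
    qed (use that in simp)
    then show ?R using s by (auto simp: ring_of_type_algebra_def)
  next
    assume R: ?R
    have "subring K (ring_of_type_algebra :: 'a ring)"
      using R by (intro F.subringI) (auto simp: uminus_ring_of_type_algebra, auto simp: ring_of_type_algebra_def)
    then show "is_subfield K"
      using R by (intro F.subfieldI') (auto simp: ring_of_type_algebra_def inv_ring_of_type_algebra[unfolded
          ring_of_type_algebra_def])
  qed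
qed

lemma generate_field_subfield: "is_subfield (generate_field (ring_of_type_algebra :: 'a::field ring) S)"
proof -
  interpret F: field "ring_of_type_algebra :: 'a ring" by (rule field_from_type_algebra)
  show ?thesis by (rule F.generate_field_is_subfield) (simp add: ring_of_type_algebra_def)
qed

lemma generate_field_least:
  "is_subfield (E :: 'a::field set) \<Longrightarrow> S \<subseteq> E \<Longrightarrow> generate_field ring_of_type_algebra S \<subseteq> E"
proof -
  interpret F: field "ring_of_type_algebra :: 'a ring" by (rule field_from_type_algebra)
  show "is_subfield (E :: 'a set) \<Longrightarrow> S \<subseteq> E \<Longrightarrow> generate_field ring_of_type_algebra S \<subseteq> E"
    by (rule F.generate_field_min_subfield1) (simp_all add: ring_of_type_algebra_def)
qed

lemma subfield_field_rel:
  assumes "is_subfield K"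
  shows "field_relation (Id_on K)"
  using assms unfolding is_subfield_iff field_relation_def ring_relation_def by auto

lemma field_rel_Domain: "field_relation R \<Longrightarrow> is_subfield (Domain R)"
  unfolding is_subfield_iff field_relation_def ring_relation_def by (auto simp: Domain_iff; blast)

lemma poly_in_subfield: "is_subfield K \<Longrightarrow> f \<in> polys_over K \<Longrightarrow> x \<in> K \<Longrightarrow> poly f x \<in> K"
proof -
  assume K: "is_subfield K" and f: "f \<in> polys_over K" and x: "x \<in> K"
  interpret field_relation "Id_on K" by (rule subfield_field_rel[OF K])
  have "poly_rel (Id_on K) f f" using f by (auto simp: poly_rel_def polys_over_def)
  from poly_eval[OF this] x show ?thesis by auto
qed

text \<open>Take the first linear factor: its root is a root of \<open>g\<close>, or else of the
  cofactor \<open>k\<close>, and then the factor can be cancelled from \<open>k\<close> and from the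
  product.\<close>

lemma root_of_factor_of_linears:
  fixes g k :: "'a::field poly"
  assumes "g * k = smult c (\<Prod>x\<leftarrow>xs. [:- x, 1:])" "c \<noteq> 0" "degree g > 0"
  shows "\<exists>x\<in>set xs. poly g x = 0"
  using assms
proof (induction xs arbitrary: k)
  case Nil
  then have "k \<noteq> 0" "g \<noteq> 0" by auto
  then have "degree g + degree k = degree (g * k)" by (simp add: degree_mult_eq)
  also have "\<dots> = 0" unfolding Nil by simp
  finally show ?case using Nil by simp
next
  case (Cons b xs)
  show ?case
  proof (cases "poly g b = 0")
    case False
    have "poly (g * k) b = 0" unfolding Cons.prems by simp
    then have "poly k b = 0" using False by simp
    then obtain k' where k': "k = [:- b, 1:] * k'" by (auto simp: poly_eq_0_iff_dvd elim: dvdE)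
    have "[:- b, 1:] * (g * k') = [:- b, 1:] * smult c (\<Prod>x\<leftarrow>xs. [:- x, 1:])"
      using Cons.prems(1) k' by (simp add: algebra_simps)
    then have "g * k' = smult c (\<Prod>x\<leftarrow>xs. [:- x, 1:])" by (subst (asm) mult_cancel_left) auto
    from Cons.IH[OF this Cons.prems(2,3)] show ?thesis by auto
  qed auto
qed

section \<open>Minimal polynomials and adjunction of one element\<close>

definition minimal_annihilator :: "'a::field set \<Rightarrow> 'a \<Rightarrow> 'a poly \<Rightarrow> bool" where
  "minimal_annihilator K x g \<longleftrightarrow> g \<in> polys_over K \<and> g \<noteq> 0 \<and> poly g x = 0 \<and>
     (\<forall>f\<in>polys_over K. f \<noteq> 0 \<longrightarrow> poly f x = 0 \<longrightarrow> degree g \<le> degree f)"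

lemma minimal_annihilator_exists:
  assumes "f \<in> polys_over K" "f \<noteq> 0" "poly f x = 0"
  shows "\<exists>g. minimal_annihilator K x g"
proof -
  have "\<exists>f. f \<in> polys_over K \<and> f \<noteq> 0 \<and> poly f x = 0" using assms by blast
  from ex_has_least_nat[of "\<lambda>f. f \<in> polys_over K \<and> f \<noteq> 0 \<and> poly f x = 0"
      _ degree, OF conjI[OF assms(1) conjI[OF assms(2,3)]]]
  show ?thesis unfolding minimal_annihilator_def by blast
qed

lemma poly_rel_polys_over: "poly_rel R f g \<Longrightarrow> f \<in> polys_over (Domain R)"
  by (auto simp: poly_rel_def polys_over_def)

context field_relation begin

text \<open>The remainder of \<open>f\<close> modulo \<open>g\<close> vanishes at \<open>x\<close>
  and has smaller degree than \<open>g\<close>, so it is zero; its image is then zero as well, and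
  the division becomes a factorization on both sides.\<close>

lemma minimal_annihilator_dvd:
  assumes g: "minimal_annihilator (Domain R) x g" "poly_rel R g g'"
    and f: "poly_rel R f f'" "poly f x = 0"
  shows "\<exists>q q'. poly_rel R q q' \<and> f = q * g \<and> f' = q' * g'"
proof -
  have g0: "g \<noteq> 0" using g by (simp add: minimal_annihilator_def)
  obtain q q' r r' where q: "poly_rel R q q'" "poly_rel R r r'" "f = q * g + r" "f' = q' * g' + r'"
    "r = 0 \<or> degree r < degree g"
    using poly_division[OF f(1) g(2) g0] by blast
  have "poly r x = 0" using q(3) f(2) g(1) by (simp add: minimal_annihilator_def)
  then have "r = 0" using q(2,5) g(1) poly_rel_polys_over[of R r r']
    by (auto simp: minimal_annihilator_def not_less[symmetric])
  then show ?thesis using q poly_rel_0[of r'] by auto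
qed

text \<open>Dividing \<open>g\<close> by \<open>h\<close> instead of \<open>h\<close> by
  \<open>g\<close> gives a remainder \<open>r\<close> with \<open>r(x) = - q(x) h(x)\<close>. It is
  nonzero at \<open>x\<close> because \<open>g\<close> has minimal degree, and it has smaller degree
  than \<open>h\<close>; an inverse of \<open>r(x)\<close> yields one of
  \<open>h(x)\<close>.\<close>

lemma adjoin_invertible_aux:
  assumes g: "minimal_annihilator (Domain R) x g"
    and h: "poly_rel R h h'" "poly h x \<noteq> 0" "degree h < degree g"
  shows "\<exists>k k'. poly_rel R k k' \<and> poly (k * h) x = 1"
  using h
proof (induction "degree h" arbitrary: h h' rule: less_induct)
  case less
  have g0: "g \<noteq> 0" and gx: "poly g x = 0" using g by (simp_all add: minimal_annihilator_def)
  obtain g' where g': "poly_rel R g g'" using g poly_rel_exists by (auto simp: minimal_annihilator_def)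
  have h0: "h \<noteq> 0" using less.prems by auto
  show ?case
  proof (cases "degree h = 0")
    case True
    then obtain c where c: "h = [:c:]" by (rule degree_eq_zeroE)
    then have "(c, coeff h' 0) \<in> R" using less.prems(1) by (auto simp: poly_rel_def dest: spec[of _ 0])
    then have "poly_rel R [:inverse c:] [:inverse (coeff h' 0):]" by (intro poly_pCons inverse poly_0)
    moreover have "poly ([:inverse c:] * h) x = 1" using c h0 by simp
    ultimately show ?thesis by blast
  next
    case False
    obtain q q' r r' where q: "poly_rel R q q'" "poly_rel R r r'" "g = q * h + r" "r = 0 \<or> degree r < degree h"
      using poly_division[OF g' less.prems(1) h0] by blast
    have "poly (q * h + r) x = 0" using q(3) gx by simp
    then have rx: "poly r x = - (poly q x * poly h x)"
      by (simp add: eq_neg_iff_add_eq_0 add.commute)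
    have r0: "r \<noteq> 0"
    proof
      assume r: "r = 0"
      then have "poly q x = 0" using rx less.prems(2) by simp
      moreover have "q \<noteq> 0" using q g0 r by auto
      ultimately have "degree g \<le> degree q" using g poly_rel_polys_over[OF q(1)]
        by (simp add: minimal_annihilator_def)
      moreover have "degree g = degree q + degree h" using q(3) r h0 \<open>q \<noteq> 0\<close> by (simp add: degree_mult_eq)
      ultimately show False using False by simp
    qed
    then have dr: "degree r < degree h" using q(4) by simp
    have "poly r x \<noteq> 0"
    proof
      assume "poly r x = 0"
      then have "degree g \<le> degree r" using g r0 poly_rel_polys_over[OF q(2)]
        by (simp add: minimal_annihilator_def)
      then show False using dr less.prems(3) by simp
    qed
    then obtain k k' where k: "poly_rel R k k'" "poly (k * r) x = 1"
      using less.hyps[OF dr q(2)] dr less.prems(3) by auto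
    have "poly_rel R (0 - k * q) (0 - k' * q')" by (intro poly_rel_diff poly_rel_mult k q poly_0)
    moreover have "poly ((0 - k * q) * h) x = 1" using k(2) rx by (simp add: mult.assoc)
    ultimately show ?thesis by blast
  qed
qed

lemma adjoin_invertible:
  assumes g: "minimal_annihilator (Domain R) x g"
    and h: "poly_rel R h h'" "poly h x \<noteq> 0"
  shows "\<exists>k k'. poly_rel R k k' \<and> poly (k * h) x = 1"
proof -
  have g0: "g \<noteq> 0" and gx: "poly g x = 0" using g by (simp_all add: minimal_annihilator_def)
  obtain g' where g': "poly_rel R g g'" using g poly_rel_exists by (auto simp: minimal_annihilator_def)
  obtain q q' r r' where q: "poly_rel R r r'" "h = q * g + r" "r = 0 \<or> degree r < degree g"
    using poly_division[OF h(1) g' g0] by blast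
  have rx: "poly r x = poly h x" using q(2) gx by simp
  then have "r \<noteq> 0" using h(2) by auto
  then show ?thesis using adjoin_invertible_aux[OF g q(1)] rx h(2) q(3) by auto
qed

text \<open>Single-valued only if \<open>y\<close> is a root of the \<open>R\<close>-image of a minimal polynomial of \<open>x\<close>.\<close>

definition adjoin :: "'a \<Rightarrow> 'b \<Rightarrow> ('a \<times> 'b) set" where
  "adjoin x y = {(poly h x, poly h' y) |h h'. poly_rel R h h'}"

lemma adjoin_subset: "R \<subseteq> adjoin x y"
proof safe
  fix a b assume "(a, b) \<in> R"
  then have "poly_rel R [:a:] [:b:]" by (intro poly_pCons poly_0)
  then show "(a, b) \<in> adjoin x y" unfolding adjoin_def by force
qed

lemma adjoin_mem: "(x, y) \<in> adjoin x y"
proof -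
  have "poly_rel R [:0, 1:] [:0, 1:]" by (intro poly_pCons poly_0 zero one)
  then show ?thesis unfolding adjoin_def by force
qed

lemma adjoin_Domain:
  assumes "is_subfield L" "Domain R \<subseteq> L" "x \<in> L"
  shows "Domain (adjoin x y) \<subseteq> L"
proof
  fix a assume "a \<in> Domain (adjoin x y)"
  then obtain h h' where "poly_rel R h h'" "a = poly h x" by (auto simp: adjoin_def)
  moreover then have "h \<in> polys_over L" using poly_rel_polys_over[of R h h'] assms(2) by (auto simp: polys_over_def)
  ultimately show "a \<in> L" using poly_in_subfield assms by blast
qed

text \<open>Single-valuedness is the crux: a polynomial vanishing at \<open>x\<close> is a multiple
  of \<open>g\<close>, so its image is a multiple of \<open>g'\<close> and vanishes at
  \<open>y\<close>. Inverses in \<open>x\<close> are themselves polynomials in \<open>x\<close>, so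
  their images are the inverses in \<open>y\<close>.\<close>

lemma adjoin_field_rel:
  assumes g: "minimal_annihilator (Domain R) x g" and g': "poly_rel R g g'" "poly g' y = 0"
  shows "field_relation (adjoin x y)"
proof -
  have ring: "ring_relation (adjoin x y)"
    unfolding ring_relation_def
  proof (intro conjI allI impI)
    show "(0, 0) \<in> adjoin x y" "(1, 1) \<in> adjoin x y"
      using adjoin_subset zero one by blast+
  next
    fix a b c d assume "(a, b) \<in> adjoin x y" "(c, d) \<in> adjoin x y"
    then obtain h h' k k' where *: "poly_rel R h h'" "poly_rel R k k'" "a = poly h x" "b = poly h' y"
      "c = poly k x" "d = poly k' y" by (auto simp: adjoin_def)
    show "(a + c, b + d) \<in> adjoin x y" unfolding adjoin_def mem_Collect_eq
      by (rule exI[of _ "h + k"], rule exI[of _ "h' + k'"]) (simp add: * poly_rel_add)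
    show "(a * c, b * d) \<in> adjoin x y" unfolding adjoin_def mem_Collect_eq
      by (rule exI[of _ "h * k"], rule exI[of _ "h' * k'"]) (simp add: * poly_rel_mult)
  next
    fix a b assume "(a, b) \<in> adjoin x y"
    then obtain h h' where *: "poly_rel R h h'" "a = poly h x" "b = poly h' y" by (auto simp: adjoin_def)
    show "(- a, - b) \<in> adjoin x y" unfolding adjoin_def mem_Collect_eq
      by (rule exI[of _ "0 - h"], rule exI[of _ "0 - h'"]) (simp add: * poly_rel_diff poly_0 del: diff_0)
  qed
  interpret A: ring_relation "adjoin x y" by (rule ring)
  have zero: "b = 0" if "(0, b) \<in> adjoin x y" for b
  proof -
    from that obtain h h' where h: "poly_rel R h h'" "poly h x = 0" "b = poly h' y" by (auto simp: adjoin_def)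
    from minimal_annihilator_dvd[OF g g'(1) h(1,2)] g'(2) h(3) show ?thesis by auto
  qed
  have inv: "(inverse a, inverse b) \<in> adjoin x y" if ab: "(a, b) \<in> adjoin x y" for a b
  proof (cases "a = 0")
    case True
    then have "b = 0" using zero ab by blast
    then show ?thesis using True A.zero by simp
  next
    case False
    from ab obtain h h' where h: "poly_rel R h h'" "a = poly h x" "b = poly h' y" by (auto simp: adjoin_def)
    from adjoin_invertible[OF g h(1)] False h(2) obtain k k' where k: "poly_rel R k k'" "poly (k * h) x = 1"
      by auto
    have kx: "(poly k x, poly k' y) \<in> adjoin x y" using k(1) by (auto simp: adjoin_def)
    have "(poly k x * a, poly k' y * b) \<in> adjoin x y" by (rule A.mult[OF kx ab])
    then have "(1, poly k' y * b) \<in> adjoin x y" using k(2) h(2) by simp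
    from A.diff[OF this A.one] have "poly k' y * b = 1" using zero by fastforce
    moreover have "poly k x * a = 1" using k(2) h(2) by simp
    ultimately have "inverse a = poly k x" "inverse b = poly k' y"
      by (metis inverse_unique mult.commute)+
    then show ?thesis using kx by simp
  qed
  show ?thesis unfolding field_relation_def using ring inv zero by blast
qed

text \<open>The image of the minimal polynomial of \<open>x\<close> divides \<open>f'\<close>, which
  is a product of linear factors; so it has a root, and that root serves as the image of
  \<open>x\<close>.\<close>

lemma extend_one:
  assumes f: "poly_rel R f f'" "f \<noteq> 0" "poly f x = 0"
    and split: "f' = smult c (\<Prod>b\<leftarrow>bs. [:- b, 1:])" "c \<noteq> 0"
  shows "\<exists>y. field_relation (adjoin x y)"
proof -
  obtain g where g: "minimal_annihilator (Domain R) x g"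
    using minimal_annihilator_exists[OF poly_rel_polys_over[OF f(1)] f(2,3)] by blast
  obtain g' where g': "poly_rel R g g'" using g poly_rel_exists by (auto simp: minimal_annihilator_def)
  obtain q' where "f' = q' * g'" using minimal_annihilator_dvd[OF g g' f(1,3)] by blast
  then have "g' * q' = smult c (\<Prod>b\<leftarrow>bs. [:- b, 1:])" using split by (simp add: mult.commute)
  moreover have "degree g' > 0"
  proof -
    have "degree g \<noteq> 0"
    proof
      assume "degree g = 0"
      then obtain a where "g = [:a:]" by (rule degree_eq_zeroE)
      then show False using g by (auto simp: minimal_annihilator_def)
    qed
    then show ?thesis using poly_rel_degree[OF g'] by simp
  qed
  ultimately obtain y where "poly g' y = 0" using root_of_factor_of_linears split(2) by blast
  then show ?thesis using adjoin_field_rel[OF g g'] by blast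
qed

end

section \<open>Extension of embeddings by Zorn's lemma\<close>

lemma poly_rel_mono: "poly_rel R f g \<Longrightarrow> R \<subseteq> S \<Longrightarrow> poly_rel S f g"
  by (auto simp: poly_rel_def)

text \<open>A maximal relation with domain inside \<open>L\<close> already contains every
  \<open>x\<close> of \<open>S\<close>: the polynomial given for \<open>x\<close> splits on the
  target side, so \<open>x\<close> can be adjoined, and by maximality nothing new arises.\<close>

theorem extend_field_rel:
  fixes R :: "('a::field \<times> 'b::field) set"
  assumes R: "field_relation R" and L: "is_subfield L" "Domain R \<subseteq> L" "S \<subseteq> L"
    and S: "\<And>x. x \<in> S \<Longrightarrow> \<exists>f f' c bs. poly_rel R f f' \<and> f \<noteq> 0 \<and> poly f x = 0 \<and>
        f' = smult c (\<Prod>b\<leftarrow>bs. [:- b, 1:]) \<and> c \<noteq> 0"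
  shows "\<exists>M. field_relation M \<and> R \<subseteq> M \<and> S \<subseteq> Domain M \<and> Domain M \<subseteq> L"
proof -
  define F where "F = {M. field_relation M \<and> R \<subseteq> M \<and> Domain M \<subseteq> L}"
  have "\<exists>M\<in>F. \<forall>T\<in>F. M \<subseteq> T \<longrightarrow> T = M"
  proof (rule subset_Zorn_nonempty)
    show "F \<noteq> {}" using R L by (auto simp: F_def)
  next
    fix C assume C: "C \<noteq> {}" "subset.chain F C"
    have CA: "M \<in> F" if "M \<in> C" for M using C that by (auto simp: subset.chain_def)
    have two: "\<exists>M\<in>C. p \<in> M \<and> p' \<in> M" if pp: "p \<in> \<Union>C" "p' \<in> \<Union>C" for p p'
    proof -
      from pp obtain T Y where XY: "T \<in> C" "Y \<in> C" "p \<in> T" "p' \<in> Y" by blast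
      then have "T \<subseteq> Y \<or> Y \<subseteq> T" using C(2) by (auto simp: subset.chain_def)
      then show ?thesis using XY by blast
    qed
    obtain T where T: "T \<in> C" using C by blast
    have "field_relation (\<Union>C)"
      unfolding field_relation_def ring_relation_def
    proof (intro conjI allI impI)
      show "(0, 0) \<in> \<Union>C" "(1, 1) \<in> \<Union>C"
        using T CA[OF T] by (auto simp: F_def field_relation_def ring_relation_def)
    next
      fix x y x' y' assume "(x, y) \<in> \<Union>C" "(x', y') \<in> \<Union>C"
      from two[OF this] obtain M where M: "M \<in> C" "(x, y) \<in> M" "(x', y') \<in> M" by blast
      interpret N: field_relation M using CA[OF M(1)] by (simp add: F_def)
      have "(x + x', y + y') \<in> M" "(x * x', y * y') \<in> M"
        using M N.add N.mult by blast+
      then show "(x + x', y + y') \<in> \<Union>C" "(x * x', y * y') \<in> \<Union>C" using M(1) by blast+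
    next
      fix x y assume "(x, y) \<in> \<Union>C"
      then obtain M where M: "M \<in> C" "(x, y) \<in> M" by blast
      interpret N: field_relation M using CA[OF M(1)] by (simp add: F_def)
      have "(- x, - y) \<in> M" "(inverse x, inverse y) \<in> M"
        using M N.uminus N.inverse by blast+
      then show "(- x, - y) \<in> \<Union>C" "(inverse x, inverse y) \<in> \<Union>C" using M(1) by blast+
    next
      fix y assume "(0, y) \<in> \<Union>C"
      then obtain M where M: "M \<in> C" "(0, y) \<in> M" by blast
      interpret N: field_relation M using CA[OF M(1)] by (simp add: F_def)
      show "y = 0" using M N.zero_right by blast
    qed
    moreover have "R \<subseteq> \<Union>C" using T CA[OF T] by (auto simp: F_def)
    moreover have "Domain (\<Union>C) \<subseteq> L" using CA by (fastforce simp: F_def)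
    ultimately show "\<Union>C \<in> F" by (simp add: F_def)
  qed
  then obtain M where M: "M \<in> F" and max: "\<And>T. T \<in> F \<Longrightarrow> M \<subseteq> T \<Longrightarrow> T = M" by blast
  have fM: "field_relation M" "R \<subseteq> M" "Domain M \<subseteq> L" using M by (simp_all add: F_def)
  interpret M: field_relation M by (rule fM(1))
  have "x \<in> Domain M" if xS: "x \<in> S" for x
  proof -
    obtain f f' c bs where f: "poly_rel R f f'" "f \<noteq> 0" "poly f x = 0"
        "f' = smult c (\<Prod>b\<leftarrow>bs. [:- b, 1:])" "c \<noteq> 0" using S[OF xS] by blast
    obtain y where "field_relation (M.adjoin x y)"
      using M.extend_one[OF poly_rel_mono[OF f(1) fM(2)] f(2-5)] by blast
    moreover have "R \<subseteq> M.adjoin x y" using fM(2) M.adjoin_subset by blast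
    moreover have "Domain (M.adjoin x y) \<subseteq> L" using M.adjoin_Domain[OF L(1) fM(3)] L(3) xS by blast
    ultimately have "M.adjoin x y \<in> F" by (simp add: F_def)
    from max[OF this M.adjoin_subset] M.adjoin_mem[of x y] show ?thesis by auto
  qed
  then show ?thesis using fM by blast
qed

subsection \<open>Galois groups\<close>

lemma galois_group_carrier:
  "\<sigma> \<in> carrier (galois_group K L) \<longleftrightarrow> \<sigma> \<in> Bij L \<and>
     (\<forall>x\<in>L. \<forall>y\<in>L. \<sigma> (x + y) = \<sigma> x + \<sigma> y \<and> \<sigma> (x * y) = \<sigma> x * \<sigma> y) \<and> (\<forall>x\<in>K. \<sigma> x = x)"
  by (simp add: galois_group_def)

lemma galois_group_mult:
  "\<sigma> \<in> carrier (galois_group K L) \<Longrightarrow> \<tau> \<in> carrier (galois_group K L) \<Longrightarrow>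
     \<sigma> \<otimes>\<^bsub>galois_group K L\<^esub> \<tau> = compose L \<sigma> \<tau>"
  by (simp add: galois_group_def BijGroup_def)

lemma galois_group_bij: "\<sigma> \<in> carrier (galois_group K L) \<Longrightarrow> bij_betw \<sigma> L L"
  by (simp add: galois_group_carrier Bij_def)

lemma galois_group_closed: "\<sigma> \<in> carrier (galois_group K L) \<Longrightarrow> x \<in> L \<Longrightarrow> \<sigma> x \<in> L"
  using galois_group_bij bij_betwE by blast

lemma galois_group_compose:
  assumes L: "is_subfield L" and KL: "K \<subseteq> L"
    and s: "\<sigma> \<in> carrier (galois_group K L)" "\<tau> \<in> carrier (galois_group K L)"
  shows "compose L \<sigma> \<tau> \<in> carrier (galois_group K L)"
proof -
  have c: "compose L \<sigma> \<tau> x = \<sigma> (\<tau> x)" if "x \<in> L" for x using that by (simp add: compose_def)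
  have "compose L \<sigma> \<tau> \<in> Bij L" using s by (intro compose_Bij) (auto simp: galois_group_carrier)
  then show ?thesis
    using s L galois_group_closed[OF s(2)] KL unfolding galois_group_carrier is_subfield_iff
    by (auto simp: c subset_iff)
qed

lemma galois_group_ext:
  assumes "\<sigma> \<in> carrier (galois_group K L)" "\<tau> \<in> carrier (galois_group K L)" "\<And>x. x \<in> L \<Longrightarrow> \<sigma> x = \<tau> x"
  shows "\<sigma> = \<tau>"
  using assms by (auto simp: galois_group_carrier Bij_def intro: extensionalityI)

lemma galois_graph_field_rel:
  assumes s: "\<sigma> \<in> carrier (galois_group K L)" and L: "is_subfield L"
  shows "field_relation (graph_on L \<sigma>)"
proof -
  note L = L[unfolded is_subfield_iff]
  have add: "\<sigma> (x + y) = \<sigma> x + \<sigma> y" and mult: "\<sigma> (x * y) = \<sigma> x * \<sigma> y" if "x \<in> L" "y \<in> L" for x y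
    using s that by (auto simp: galois_group_carrier)
  have inj: "inj_on \<sigma> L" using galois_group_bij[OF s] by (simp add: bij_betw_def)
  have "\<sigma> (0 + 0) = \<sigma> 0 + \<sigma> 0" using L by (intro add) auto
  then have z: "\<sigma> 0 = 0" by (metis add.right_neutral add_left_cancel)
  have nz: "\<sigma> x = 0 \<Longrightarrow> x = 0" if "x \<in> L" for x using inj_onD[OF inj, of x 0] z that L by auto
  have o: "\<sigma> 1 = 1" using mult[of 1 1] nz[of 1] L by auto
  have m: "\<sigma> (- x) = - \<sigma> x" if "x \<in> L" for x using add[of x "-x"] z that L
      by (simp add: eq_neg_iff_add_eq_0 add.commute)
  have i: "\<sigma> (inverse x) = inverse (\<sigma> x)" if "x \<in> L" for x
  proof (cases "x = 0")
    case False
    then have "\<sigma> x * \<sigma> (inverse x) = 1" using mult[of x "inverse x"] o that L by simp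
    then show ?thesis by (metis inverse_unique)
  qed (simp add: z)
  show ?thesis unfolding field_relation_def ring_relation_def
  proof (intro conjI allI impI)
    show "(0, 0) \<in> graph_on L \<sigma>" "(1, 1) \<in> graph_on L \<sigma>" using z o L by force+
  next
    fix a b c d assume "(a, b) \<in> graph_on L \<sigma>" "(c, d) \<in> graph_on L \<sigma>"
    then show "(a + c, b + d) \<in> graph_on L \<sigma>" "(a * c, b * d) \<in> graph_on L \<sigma>"
      using add mult L by auto
  next
    fix a b assume "(a, b) \<in> graph_on L \<sigma>"
    then show "(- a, - b) \<in> graph_on L \<sigma>" "(inverse a, inverse b) \<in> graph_on L \<sigma>"
      using m i L by auto
  next
    fix y assume "(0, y) \<in> graph_on L \<sigma>"
    then show "y = 0" using z by auto
  qed
qed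

lemma field_rel_Int: "field_relation R \<Longrightarrow> field_relation S \<Longrightarrow> field_relation (R \<inter> S)"
proof -
  assume R: "field_relation R" and S: "field_relation S"
  interpret R: field_relation R by (rule R)
  interpret S: field_relation S by (rule S)
  show ?thesis unfolding field_relation_def ring_relation_def Int_iff
    by (intro conjI allI impI R.zero S.zero R.one S.one R.add S.add R.mult S.mult R.uminus S.uminus
      R.inverse S.inverse R.zero_right; blast)
qed

lemma field_rel_converse: "field_relation R \<Longrightarrow> field_relation (R\<inverse>)"
proof -
  assume R: "field_relation R"
  interpret field_relation R by (rule R)
  show ?thesis unfolding field_relation_def ring_relation_def converse_iff
    by (intro conjI allI impI zero one add mult uminus inverse zero_left)
qed

lemma field_rel_comp: "field_relation R \<Longrightarrow> field_relation S \<Longrightarrow> field_relation (R O S)"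
proof -
  assume R: "field_relation R" and S: "field_relation S"
  interpret R: field_relation R by (rule R)
  interpret S: field_relation S by (rule S)
  show ?thesis unfolding field_relation_def ring_relation_def
  proof (intro conjI allI impI)
    show "(0, 0) \<in> R O S" by (rule relcompI[OF R.zero S.zero])
    show "(1, 1) \<in> R O S" by (rule relcompI[OF R.one S.one])
  next
    fix a b c d assume "(a, b) \<in> R O S" "(c, d) \<in> R O S"
    then obtain u v where *: "(a, u) \<in> R" "(u, b) \<in> S" "(c, v) \<in> R" "(v, d) \<in> S" by auto
    show "(a + c, b + d) \<in> R O S" by (rule relcompI[OF R.add[OF *(1,3)] S.add[OF *(2,4)]])
    show "(a * c, b * d) \<in> R O S" by (rule relcompI[OF R.mult[OF *(1,3)] S.mult[OF *(2,4)]])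
  next
    fix a b assume "(a, b) \<in> R O S"
    then obtain u where *: "(a, u) \<in> R" "(u, b) \<in> S" by auto
    show "(- a, - b) \<in> R O S" by (rule relcompI[OF R.uminus[OF *(1)] S.uminus[OF *(2)]])
    show "(inverse a, inverse b) \<in> R O S" by (rule relcompI[OF R.inverse[OF *(1)] S.inverse[OF *(2)]])
  next
    fix y assume "(0, y) \<in> R O S"
    then obtain u where "(0, u) \<in> R" "(u, y) \<in> S" by auto
    then show "y = 0" using R.zero_right[of u] S.zero_right[of y] by simp
  qed
qed

lemma generate_field_eq_Domain:
  assumes "field_relation R" "Domain R \<subseteq> generate_field ring_of_type_algebra S" "S \<subseteq> Domain R"
  shows "Domain R = generate_field ring_of_type_algebra S"
  using generate_field_least[OF field_rel_Domain[OF assms(1)] assms(3)] assms(2) by blast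

text \<open>The hypothesis on the range gives surjectivity, \<open>zero_left\<close> gives
  injectivity. Restricting the chosen values to \<open>L\<close> makes the map extensional, as
  membership in \<open>Bij\<close> demands.\<close>

lemma field_rel_automorphism:
  assumes N: "field_relation N" "Domain N = L" "Range N = L" and K: "Id_on K \<subseteq> N"
  shows "\<exists>\<sigma>\<in>carrier (galois_group K L). \<forall>x\<in>L. (x, \<sigma> x) \<in> N"
proof -
  interpret N: field_relation N by (rule N)
  define \<sigma> where "\<sigma> = (\<lambda>x\<in>L. SOME y. (x, y) \<in> N)"
  have s: "(x, \<sigma> x) \<in> N" if "x \<in> L" for x
  proof -
    have "\<exists>y. (x, y) \<in> N" using N(2) that by blast
    then have "(x, SOME y. (x, y) \<in> N) \<in> N" by (rule someI_ex)
    then show ?thesis using that by (simp add: \<sigma>_def)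
  qed
  have u: "\<sigma> x = y" if "(x, y) \<in> N" for x y
    using N.unique[OF s that] N(2) that by blast
  have "inj_on \<sigma> L"
  proof (rule inj_onI)
    fix x y assume "x \<in> L" "y \<in> L" "\<sigma> x = \<sigma> y"
    then have "(x - y, 0) \<in> N" using N.diff[OF s s, of x y] by simp
    then show "x = y" using N.zero_left by fastforce
  qed
  moreover have "\<sigma> ` L = L"
  proof
    show "\<sigma> ` L \<subseteq> L" using s N(3) by blast
    show "L \<subseteq> \<sigma> ` L"
    proof
      fix y assume "y \<in> L"
      then obtain x where "(x, y) \<in> N" using N(3) by blast
      then show "y \<in> \<sigma> ` L" using u N(2) by blast
    qed
  qed
  ultimately have "\<sigma> \<in> Bij L" by (simp add: Bij_def bij_betw_def \<sigma>_def)
  moreover have "\<sigma> (x + y) = \<sigma> x + \<sigma> y \<and> \<sigma> (x * y) = \<sigma> x * \<sigma> y" if "x \<in> L" "y \<in> L" for x y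
    using u[OF N.add[OF s[OF that(1)] s[OF that(2)]]] u[OF N.mult[OF s[OF that(1)] s[OF that(2)]]] by blast
  moreover have "\<sigma> x = x" if "x \<in> K" for x using K u that by blast
  ultimately have "\<sigma> \<in> carrier (galois_group K L)" by (simp add: galois_group_carrier)
  then show ?thesis using s by blast
qed

text \<open>Normality and separability in one condition that speaks of some polynomial rather than
  of irreducible ones. In this form it passes from \<open>K\<close> to every intermediate field at
  once.\<close>

definition split_sep :: "'a::field set \<Rightarrow> 'a set \<Rightarrow> bool" where
  "split_sep K L \<longleftrightarrow> (\<forall>x\<in>L. \<exists>f\<in>polys_over K. poly f x = 0 \<and>
     (\<exists>c xs. c \<noteq> 0 \<and> set xs \<subseteq> L \<and> distinct xs \<and> f = smult c (\<Prod>x\<leftarrow>xs. [:- x, 1:])))"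

lemma split_sep_mono: "split_sep K L \<Longrightarrow> K \<subseteq> M \<Longrightarrow> split_sep M L"
  unfolding split_sep_def polys_over_def by blast

lemma linear_factors_nonzero: "(\<Prod>x\<leftarrow>xs. [:- x, 1:]) \<noteq> (0 :: 'a::idom poly)"
  by (auto simp: prod_list_zero_iff)

lemma poly_linear_factors_eq_0_iff:
  "poly (\<Prod>x\<leftarrow>xs. [:- x, 1:]) y = 0 \<longleftrightarrow> (y :: 'a::idom) \<in> set xs"
  by (induction xs) auto

lemma hom_field_rel:
  fixes h :: "'a::field \<Rightarrow> 'b::field"
  assumes one: "h 1 = 1" and add: "\<And>x y. h (x + y) = h x + h y" and mult: "\<And>x y. h (x * y) = h x * h y"
  shows "field_relation (fun_graph h)"
proof -
  have z: "h 0 = 0" using add[of 0 0] by (metis add.right_neutral add_left_cancel)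
  have m: "h (- x) = - h x" for x using add[of x "-x"] z by (simp add: eq_neg_iff_add_eq_0 add.commute)
  have i: "h (inverse x) = inverse (h x)" for x
  proof (cases "x = 0")
    case False
    then have "h x * h (inverse x) = 1" using mult[of x "inverse x"] one by simp
    then show ?thesis by (metis inverse_unique)
  qed (simp add: z)
  have mem: "(x, y) \<in> fun_graph h \<longleftrightarrow> y = h x" for x y by auto
  show ?thesis unfolding field_relation_def ring_relation_def mem by (simp add: z one add mult m i)
qed

lemma poly_rel_map_poly: "h 0 = 0 \<Longrightarrow> poly_rel (fun_graph h) f (map_poly h f)"
  by (auto simp: poly_rel_def coeff_map_poly)

text \<open>A minimal polynomial is irreducible, so normality splits it over \<open>L\<close>; a
  repeated linear factor would contradict separability.\<close>

lemma galois_ext_split_sep: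
  assumes "galois_ext K L"
  shows "split_sep K L"
  unfolding split_sep_def
proof
  fix x assume x: "x \<in> L"
  have K: "is_subfield K" and alg: "algebraic_ext K L" and normal: "normal_ext K L" and sep: "separable_ext K L"
    using assms by (auto simp: galois_ext_def normal_ext_def)
  interpret field_relation "Id_on K" by (rule subfield_field_rel[OF K])
  obtain f where f: "minimal_annihilator K x f"
    using alg x minimal_annihilator_exists unfolding algebraic_ext_def by metis
  then have f': "f \<in> polys_over K" "f \<noteq> 0" "poly f x = 0" by (auto simp: minimal_annihilator_def)
  have "irreducible_over K f"
    unfolding irreducible_over_def
  proof (intro conjI ballI impI)
    show "f \<in> polys_over K" by (rule f')
    show "degree f > 0"
    proof (rule ccontr)
      assume "\<not> degree f > 0"
      then obtain a where "f = [:a:]" using degree_eq_zeroE by blast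
      then show False using f' by simp
    qed
    fix g h assume gh: "g \<in> polys_over K" "h \<in> polys_over K" "f = g * h"
    have deg: "degree f = degree g + degree h" using f'(2) gh(3) by (auto simp: degree_mult_eq)
    have "poly g x = 0 \<or> poly h x = 0" using f'(3) gh(3) by simp
    then have "degree f \<le> degree g \<or> degree f \<le> degree h"
      using f gh f'(2) by (auto simp: minimal_annihilator_def)
    then show "degree g = 0 \<or> degree h = 0" using deg by auto
  qed
  then have "splits_over L f" "separable_poly f"
    using normal sep x f'(3) unfolding normal_ext_def separable_ext_def by blast+
  then obtain c xs where c: "c \<noteq> 0" "set xs \<subseteq> L" "f = smult c (\<Prod>x\<leftarrow>xs. [:- x, 1:])"
    and rs: "rsquarefree (map_poly to_ac f)" by (auto simp: splits_over_def separable_poly_def)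
  have "distinct xs"
  proof (rule ccontr)
    assume "\<not> distinct xs"
    then obtain us vs ws a where xs: "xs = us @ [a] @ vs @ [a] @ ws" using not_distinct_decomp by blast
    define g where "g = smult c (\<Prod>x\<leftarrow>us @ vs @ ws. [:- x, 1:])"
    \<comment> \<open>A square factor over \<open>L\<close> remains one over the algebraic closure,
      which is where \<open>separable_poly\<close> is tested.\<close>
    have fg: "f = [:- a, 1:] ^ 2 * g" unfolding c(3) xs g_def
      by (simp only: map_append prod_list.append list.map prod_list.Cons prod_list.Nil power2_eq_square
          mult_smult_right mult_1_right mult_1_left mult_ac)
    let ?R = "fun_graph to_ac"
    interpret A: field_relation ?R by (rule hom_field_rel; simp)
    have "poly_rel ?R [:- a, 1:] [:- to_ac a, 1:]" by (intro A.poly_pCons A.poly_0 A.one A.uminus) auto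
    then have "poly_rel ?R f ([:- to_ac a, 1:] ^ 2 * map_poly to_ac g)"
      unfolding fg by (intro A.poly_rel_mult A.poly_rel_power poly_rel_map_poly) auto
    then have eq: "map_poly to_ac f = [:- to_ac a, 1:] ^ 2 * map_poly to_ac g"
      using A.poly_rel_unique poly_rel_map_poly[of to_ac f] by auto
    then have "[:- to_ac a, 1:] ^ 2 dvd map_poly to_ac f" by simp
    then have "2 \<le> order (to_ac a) (map_poly to_ac f)"
      using rs by (simp add: order_divides rsquarefree_def)
    moreover have "order (to_ac a) (map_poly to_ac f) = 0 \<or> order (to_ac a) (map_poly to_ac f) = 1"
      using rs by (simp add: rsquarefree_def)
    ultimately show False by auto
  qed
  then show "\<exists>f\<in>polys_over K. poly f x = 0 \<and>
     (\<exists>c xs. c \<noteq> 0 \<and> set xs \<subseteq> L \<and> distinct xs \<and> f = smult c (\<Prod>x\<leftarrow>xs. [:- x, 1:]))"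
    using c f' by blast
qed

lemma prod_list_remove1:
  fixes f :: "'a \<Rightarrow> 'b::comm_monoid_mult"
  shows "x \<in> set xs \<Longrightarrow> (\<Prod>y\<leftarrow>xs. f y) = f x * (\<Prod>y\<leftarrow>remove1 x xs. f y)"
  by (induction xs) (auto simp: mult.left_commute)

text \<open>The fixed field of the automorphism group is the base field. The minimal polynomial of
  \<open>y\<close> over \<open>M\<close> is not linear and has distinct roots in \<open>L\<close>;
  sending \<open>y\<close> to another root \<open>y'\<close> gives an embedding, which is extended
  to all of \<open>L\<close>.\<close>

theorem exists_moving_automorphism:
  assumes M: "is_subfield M" and L: "is_subfield L" and MsubL: "M \<subseteq> L" and spl: "split_sep M L"
    and y: "y \<in> L" "y \<notin> M"
  shows "\<exists>\<sigma>\<in>carrier (galois_group M L). \<sigma> y \<noteq> y"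
proof -
  interpret I: field_relation "Id_on M" by (rule subfield_field_rel[OF M])
  have rel: "poly_rel (Id_on M) f f" if "f \<in> polys_over M" for f
    using that by (auto simp: poly_rel_def polys_over_def)
  obtain f c xs where f: "f \<in> polys_over M" "poly f y = 0" "c \<noteq> 0" "distinct xs"
    "f = smult c (\<Prod>x\<leftarrow>xs. [:- x, 1:])" using spl y(1) unfolding split_sep_def by blast
  have f0: "f \<noteq> 0" using f linear_factors_nonzero by simp
  obtain g where g: "minimal_annihilator M y g" using minimal_annihilator_exists[OF f(1) f0 f(2)] by blast
  then have g': "g \<in> polys_over M" "g \<noteq> 0" "poly g y = 0" by (auto simp: minimal_annihilator_def)
  obtain k where k: "f = k * g"
    using I.minimal_annihilator_dvd[of y g g f f] g rel[OF g'(1)] rel[OF f(1)] f(2) by auto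
  obtain g1 where g1: "g = [:- y, 1:] * g1" using g'(3) by (auto simp: poly_eq_0_iff_dvd elim: dvdE)
  have "degree g1 > 0"
  proof (rule ccontr)
    assume "\<not> degree g1 > 0"
    then obtain a where a: "g1 = [:a:]" using degree_eq_zeroE by blast
    then have ga: "g = [:- (y * a), a:]" and a0: "a \<noteq> 0" using g1 g'(2) by (auto simp: mult.commute)
    have "coeff g 1 \<in> M" "coeff g 0 \<in> M" using g'(1) by (auto simp: polys_over_def)
    then have "a \<in> M" "- (y * a) \<in> M" by (simp_all add: ga)
    then have "- (- (y * a)) * inverse a \<in> M" using M unfolding is_subfield_iff by blast
    then show False using a0 y(2) by (simp add: mult.assoc)
  qed
  have yxs: "y \<in> set xs" using f(2,3,5) by (simp add: poly_linear_factors_eq_0_iff)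
  have "[:- y, 1:] * (g1 * k) = [:- y, 1:] * smult c (\<Prod>x\<leftarrow>remove1 y xs. [:- x, 1:])"
    using k unfolding g1 f(5) prod_list_remove1[OF yxs] by (simp only: mult_smult_right mult_smult_left mult_ac)
  then have "g1 * k = smult c (\<Prod>x\<leftarrow>remove1 y xs. [:- x, 1:])" by (subst (asm) mult_cancel_left) auto
  then obtain y' where y': "y' \<in> set (remove1 y xs)" "poly g1 y' = 0"
    using root_of_factor_of_linears f(3) \<open>degree g1 > 0\<close> by blast
  have "y' \<noteq> y" using y'(1) f(4) by auto
  have "poly g y' = 0" using y'(2) g1 by simp
  then have R: "field_relation (I.adjoin y y')" using I.adjoin_field_rel[of y g g] g rel[OF g'(1)] by simp
  have IR: "Id_on M \<subseteq> I.adjoin y y'" by (rule I.adjoin_subset)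
  have DR: "Domain (I.adjoin y y') \<subseteq> L" using I.adjoin_Domain[OF L] MsubL y by simp
  have "\<exists>N. field_relation N \<and> I.adjoin y y' \<subseteq> N \<and> L \<subseteq> Domain N \<and> Domain N \<subseteq> L"
  proof (rule extend_field_rel[OF R L DR order_refl])
    fix x assume "x \<in> L"
    then obtain f c xs where "f \<in> polys_over M" "poly f x = 0" "c \<noteq> 0"
      "f = smult c (\<Prod>x\<leftarrow>xs. [:- x, 1:])" using spl unfolding split_sep_def by blast
    moreover then have "f \<noteq> 0" using linear_factors_nonzero by simp
    ultimately show "\<exists>f f' c bs. poly_rel (I.adjoin y y') f f' \<and> f \<noteq> 0 \<and> poly f x = 0 \<and>
        f' = smult c (\<Prod>b\<leftarrow>bs. [:- b, 1:]) \<and> c \<noteq> 0" using poly_rel_mono[OF rel IR] by blast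
  qed
  then obtain N where N: "field_relation N" "I.adjoin y y' \<subseteq> N" "Domain N = L" by blast
  interpret N: field_relation N by (rule N)
  have IN: "Id_on M \<subseteq> N" using IR N(2) by blast
  \<comment> \<open>Each element lies in a finite set of roots in \<open>L\<close> that the
    embedding \<open>N\<close> maps into itself. An injective self-map of a finite set is onto, so
    \<open>N\<close> has range \<open>L\<close> without any dimension count.\<close>
  have *: "\<exists>Z. finite Z \<and> Z \<subseteq> L \<and> x \<in> Z \<and> (\<forall>a b. (a, b) \<in> N \<longrightarrow> a \<in> Z \<longrightarrow> b \<in> Z)" if x: "x \<in> L" for x
  proof -
    obtain f c xs where f: "f \<in> polys_over M" "poly f x = 0" "c \<noteq> 0" "set xs \<subseteq> L"
      "f = smult c (\<Prod>x\<leftarrow>xs. [:- x, 1:])" using spl x unfolding split_sep_def by blast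
    have z: "poly f a = 0 \<longleftrightarrow> a \<in> set xs" for a
      using f(3,5) by (simp add: poly_linear_factors_eq_0_iff)
    have "b \<in> set xs" if "(a, b) \<in> N" "a \<in> set xs" for a b
    proof -
      have "(poly f a, poly f b) \<in> N" by (rule N.poly_eval[OF poly_rel_mono[OF rel[OF f(1)] IN] that(1)])
      then show ?thesis using N.zero_right z that(2) by metis
    qed
    then show ?thesis using f z by (intro exI[of _ "set xs"]) auto
  qed
  have "Range N = L"
  proof
    show "Range N \<subseteq> L"
    proof
      fix b assume "b \<in> Range N"
      then obtain a where ab: "(a, b) \<in> N" by blast
      then have "a \<in> L" using N(3) by blast
      from *[OF this] ab show "b \<in> L" by blast
    qed
    show "L \<subseteq> Range N"
    proof
      fix x assume x: "x \<in> L"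
      obtain Z where Z: "finite Z" "Z \<subseteq> L" "x \<in> Z" "\<And>a b. (a, b) \<in> N \<Longrightarrow> a \<in> Z \<Longrightarrow> b \<in> Z" using *[OF x] by blast
      have "\<forall>a\<in>Z. \<exists>b. (a, b) \<in> N" using Z(2) N(3) by blast
      then obtain h where h: "\<And>a. a \<in> Z \<Longrightarrow> (a, h a) \<in> N" by metis
      have "inj_on h Z"
      proof (rule inj_onI)
        fix a b assume "a \<in> Z" "b \<in> Z" "h a = h b"
        then have "(a - b, 0) \<in> N" using N.diff[OF h h, of a b] by simp
        then show "a = b" using N.zero_left by fastforce
      qed
      moreover have "h ` Z \<subseteq> Z" using h Z(4) by blast
      ultimately have "h ` Z = Z" using Z(1) by (simp add: endo_inj_surj)
      then obtain a where "a \<in> Z" "x = h a" using Z(3) by blast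
      then show "x \<in> Range N" using h by blast
    qed
  qed
  from field_rel_automorphism[OF N(1,3) this IN] obtain \<sigma> where s: "\<sigma> \<in> carrier (galois_group M L)"
    "\<forall>x\<in>L. (x, \<sigma> x) \<in> N" by blast
  have "(y, y') \<in> N" using I.adjoin_mem N(2) by blast
  then have "\<sigma> y = y'" using s(2) y(1) N.unique by blast
  then show ?thesis using s(1) \<open>y' \<noteq> y\<close> by blast
qed

lemma poly_eq_linear_factors:
  fixes f :: "'a::idom poly"
  assumes inj: "inj_on w {1..n}" and root: "\<And>j. j \<in> {1..n} \<Longrightarrow> poly f (w j) = 0" and deg: "degree f = n"
  shows "f = smult (lead_coeff f) (\<Prod>x\<leftarrow>map w [1..<Suc n]. [:- x, 1:])"
proof (rule poly_eqI_degree_lead_coeff[where n = n and A = "w ` {1..n}"])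
  let ?p = "\<Prod>x\<leftarrow>map w [1..<Suc n]. [:- x, 1:]"
  have dp: "degree ?p = n" unfolding degree_linear_factors by simp
  have "lead_coeff ?p = 1" by (rule monic_prod_list) auto
  then show "coeff f n = coeff (smult (lead_coeff f) ?p) n"
    unfolding dp coeff_smult deg by (simp only: mult_1_right)
  show "degree (smult (lead_coeff f) ?p) \<le> n" using dp degree_smult_le by metis
  show "card (w ` {1..n}) \<ge> n" using inj by (simp add: card_image)
  show "degree f \<le> n" by (simp add: deg)
  show "poly f z = poly (smult (lead_coeff f) ?p) z" if z: "z \<in> w ` {1..n}" for z
  proof -
    have "z \<in> set (map w [1..<Suc n])" using z by (auto simp del: upt_Suc)
    then have "poly ?p z = 0" by (simp only: poly_linear_factors_eq_0_iff)
    moreover have "poly f z = 0" using z root by blast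
    ultimately show ?thesis unfolding poly_smult by (simp only: mult_zero_right)
  qed
qed

text \<open>
  The splitting field is identified with the subfield generated by the roots \<open>w j\<close> over \<open>\<phi>\<close>; this
  transports the given automorphisms to the algebraic closure used in \<open>has_galois_group\<close>.
\<close>

theorem symmetric_galois_group:
  fixes f :: "'c::field poly" and \<phi> :: "'c \<Rightarrow> 'e::field"
  assumes \<phi>: "\<phi> 1 = 1" "\<And>x y. \<phi> (x + y) = \<phi> x + \<phi> y" "\<And>x y. \<phi> (x * y) = \<phi> x * \<phi> y"
    and deg: "degree f = n" and n: "n > 0"
    and inj: "inj_on w {1..n}" and root: "\<And>j. j \<in> {1..n} \<Longrightarrow> poly (map_poly \<phi> f) (w j) = 0"
    and sym: "\<And>\<pi>. \<pi> permutes {1..n} \<Longrightarrow> \<exists>s. s 1 = 1 \<and> (\<forall>x y. s (x + y) = s x + s y \<and> s (x * y) = s x * s y) \<and>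
        (\<forall>a. s (\<phi> a) = \<phi> a) \<and> (\<forall>j\<in>{1..n}. s (w j) = w (\<pi> j))"
  shows "has_galois_group f (sym_group n)" "separable_poly f" "irreducible f"
proof -
  have f0: "f \<noteq> 0" using deg n by auto
  let ?A = "range (\<lambda>x. (x, to_ac x :: 'c alg_closure))"
  let ?F = "fun_graph \<phi>"
  interpret A: field_relation ?A by (rule hom_field_rel; simp)
  interpret F: field_relation ?F by (rule hom_field_rel; simp add: \<phi>)
  have phi0: "\<phi> 0 = 0" using F.zero by auto
  define fa where "fa = map_poly to_ac f"
  define fe where "fe = map_poly \<phi> f"
  have Afa: "poly_rel ?A f fa" unfolding fa_def by (rule poly_rel_map_poly) simp
  have Ffe: "poly_rel ?F f fe" unfolding fe_def by (rule poly_rel_map_poly) (rule phi0)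
  have dfa: "degree fa = n" using A.poly_rel_degree[OF Afa] deg by simp
  have dfe: "degree fe = n" using F.poly_rel_degree[OF Ffe] deg by simp
  have fa0: "fa \<noteq> 0" and fe0: "fe \<noteq> 0" using dfa dfe n by auto
  \<comment> \<open>The partial isomorphism from the copy of \<open>'c\<close> in its algebraic
    closure to the copy of \<open>'c\<close> in \<open>'e\<close>.\<close>
  define R0 where "R0 = ?A\<inverse> O ?F"
  have R0: "field_relation R0" unfolding R0_def
    by (intro field_rel_comp field_rel_converse A.field_relation_axioms F.field_relation_axioms)
  have R0_mem: "(to_ac a, \<phi> a) \<in> R0" for a unfolding R0_def by blast
  have R0_dom: "Domain R0 = range to_ac" unfolding R0_def by auto
  have R0_rel: "poly_rel R0 fa fe" using R0_mem by (simp add: poly_rel_def fa_def fe_def coeff_map_poly phi0)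
  obtain B where B: "size B = n" "fa = smult (lead_coeff fa) (\<Prod>x\<in>#B. [:- x, 1:])"
    using alg_closed_imp_factorization[OF fa0] dfa by auto
  obtain zs where zs: "mset zs = B" using ex_mset by blast
  have lzs: "length zs = n" using zs B(1) by (metis size_mset)
  have fa_split: "fa = smult (lead_coeff fa) (\<Prod>x\<leftarrow>zs. [:- x, 1:])"
    using B(2) unfolding zs[symmetric] mset_map[symmetric] prod_mset_prod_list .
  have lfa: "lead_coeff fa \<noteq> 0" and lfe: "lead_coeff fe \<noteq> 0" using fa0 fe0 by auto
  have root_fa: "poly fa x = 0 \<longleftrightarrow> x \<in> set zs" for x
    by (subst fa_split) (simp add: fa0 poly_linear_factors_eq_0_iff)
  have fe_split: "fe = smult (lead_coeff fe) (\<Prod>x\<leftarrow>map w [1..<Suc n]. [:- x, 1:])"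
    using poly_eq_linear_factors[OF inj root[folded fe_def] dfe] .
  define K where "K = range (to_ac :: 'c \<Rightarrow> 'c alg_closure)"
  define L where "L = generate_field ring_of_type_algebra (K \<union> set zs)"
  have K: "is_subfield K" using field_rel_Domain[OF R0] R0_dom by (simp add: K_def)
  have L: "is_subfield L" unfolding L_def by (rule generate_field_subfield)
  have KL: "K \<subseteq> L" and zL: "set zs \<subseteq> L" unfolding L_def by (auto intro: generate_field.incl)
  have L_least: "Domain N = L" if "field_relation N" "Domain N \<subseteq> L" "K \<subseteq> Domain N" "set zs \<subseteq> Domain N"
      for N :: "('c alg_closure \<times> 'x::field) set"
    using generate_field_eq_Domain[of N "K \<union> set zs"] that by (simp add: L_def)
  \<comment> \<open>\<open>M\<close> embeds the splitting field \<open>L\<close> into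
    \<open>'e\<close>. Images for the roots of \<open>fa\<close> exist because \<open>fe\<close> is
    a product of the linear factors at the \<open>w j\<close>.\<close>
  have "\<exists>M. field_relation M \<and> R0 \<subseteq> M \<and> set zs \<subseteq> Domain M \<and> Domain M \<subseteq> L"
  proof (rule extend_field_rel[OF R0 L])
    show "Domain R0 \<subseteq> L" using KL R0_dom by (simp add: K_def)
    show "set zs \<subseteq> L" by (rule zL)
    show "\<exists>f f' c bs. poly_rel R0 f f' \<and> f \<noteq> 0 \<and> poly f x = 0 \<and>
        f' = smult c (\<Prod>b\<leftarrow>bs. [:- b, 1:]) \<and> c \<noteq> 0" if "x \<in> set zs" for x
      using R0_rel fa0 root_fa that fe_split lfe by blast
  qed
  then obtain M where M: "field_relation M" "R0 \<subseteq> M" "set zs \<subseteq> Domain M" "Domain M \<subseteq> L" by blast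
  interpret M: field_relation M by (rule M(1))
  have "\<forall>x\<in>set zs. \<exists>y. (x, y) \<in> M" using M(3) by blast
  then obtain \<psi> where \<psi>: "\<And>x. x \<in> set zs \<Longrightarrow> (x, \<psi> x) \<in> M" by metis
  have M_rel: "poly_rel M fa fe" by (rule poly_rel_mono[OF R0_rel M(2)])
  have "list_all2 (\<lambda>a b. (a, b) \<in> M) zs (map \<psi> zs)"
    using \<psi> by (simp add: list_all2_conv_all_nth)
  then have "poly_rel M (\<Prod>x\<leftarrow>zs. [:- x, 1:]) (\<Prod>x\<leftarrow>map \<psi> zs. [:- x, 1:])"
    by (rule M.poly_rel_linear_factors)
  moreover have "(lead_coeff fa, lead_coeff fe) \<in> M" using M_rel dfa dfe by (simp add: poly_rel_def)
  then have "poly_rel M [:lead_coeff fa:] [:lead_coeff fe:]" by (intro M.poly_pCons M.poly_0)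
  ultimately have "poly_rel M ([:lead_coeff fa:] * (\<Prod>x\<leftarrow>zs. [:- x, 1:]))
      ([:lead_coeff fe:] * (\<Prod>x\<leftarrow>map \<psi> zs. [:- x, 1:]))" by (intro M.poly_rel_mult)
  then have "poly_rel M fa (smult (lead_coeff fe) (\<Prod>x\<leftarrow>map \<psi> zs. [:- x, 1:]))"
    using fa_split by simp
  then have fe_psi: "fe = smult (lead_coeff fe) (\<Prod>x\<leftarrow>map \<psi> zs. [:- x, 1:])"
    using M.poly_rel_unique M_rel by blast
  \<comment> \<open>\<open>fe\<close> is also the product of the linear factors at the images of
    \<open>zs\<close>, so every \<open>w j\<close> is such an image. As there are \<open>n\<close>
    distinct \<open>w j\<close>, this matches the two sets of roots one to one.\<close>
  have "w j \<in> \<psi> ` set zs" if "j \<in> {1..n}" for j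
  proof -
    have "poly fe (w j) = 0" using root that by (simp add: fe_def)
    then show ?thesis using lfe by (subst (asm) fe_psi) (simp add: poly_linear_factors_eq_0_iff del: map_map)
  qed
  then have "\<forall>j\<in>{1..n}. \<exists>x\<in>set zs. w j = \<psi> x" by blast
  then obtain z where z: "\<And>j. j \<in> {1..n} \<Longrightarrow> z j \<in> set zs \<and> w j = \<psi> (z j)" by metis
  have zM: "(z j, w j) \<in> M" if "j \<in> {1..n}" for j using z[OF that] \<psi> by metis
  have injz: "inj_on z {1..n}" by (rule inj_onI) (metis inj_onD[OF inj] z)
  have "z ` {1..n} \<subseteq> set zs" using z by blast
  moreover have "card (z ` {1..n}) = n" using injz by (simp add: card_image)
  moreover have "card (set zs) \<le> n" using card_length[of zs] lzs by simp
  ultimately have setz: "set zs = z ` {1..n}" by (metis List.finite_set card_seteq)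
  have dist: "card (set zs) = length zs" using setz \<open>card (z ` {1..n}) = n\<close> lzs by simp
  then have dist: "distinct zs" by (rule card_distinct)

  let ?G = "galois_group K L"
  have agree: "\<sigma> = \<tau>" if s: "\<sigma> \<in> carrier ?G" "\<tau> \<in> carrier ?G" and eq: "\<And>j. j \<in> {1..n} \<Longrightarrow> \<sigma> (z j) = \<tau> (z j)" for \<sigma> \<tau>
  proof (rule galois_group_ext[OF s])
    fix x assume x: "x \<in> L"
    \<comment> \<open>The equalizer of two automorphisms is a field relation; its domain contains
      the generators of \<open>L\<close> as soon as they agree on the roots.\<close>
    let ?N = "(graph_on L \<sigma>) \<inter> (graph_on L \<tau>)"
    have "K \<subseteq> Domain ?N"
    proof
      fix k assume k: "k \<in> K"
      then have "\<sigma> k = k" "\<tau> k = k" using s by (auto simp: galois_group_carrier)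
      then show "k \<in> Domain ?N" using k KL by force
    qed
    moreover have "set zs \<subseteq> Domain ?N" using eq zL unfolding setz by fastforce
    moreover have "field_relation ?N"
        by (rule field_rel_Int[OF galois_graph_field_rel[OF s(1) L] galois_graph_field_rel[OF s(2) L]])
    ultimately have "Domain ?N = L" by (intro L_least) auto
    then show "\<sigma> x = \<tau> x" using x by auto
  qed
  have permute: "\<exists>\<sigma>\<in>carrier ?G. \<forall>j\<in>{1..n}. \<sigma> (z j) = z (\<pi> j)" if p: "\<pi> permutes {1..n}" for \<pi>
  proof -
    obtain s where s: "s 1 = 1" "\<And>x y. s (x + y) = s x + s y" "\<And>x y. s (x * y) = s x * s y"
      "\<And>a. s (\<phi> a) = \<phi> a" "\<And>j. j \<in> {1..n} \<Longrightarrow> s (w j) = w (\<pi> j)" using sym[OF p] by blast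
    \<comment> \<open>Conjugation by the embedding \<open>M\<close> turns the given automorphism
      \<open>s\<close> of \<open>'e\<close> into one of the splitting field.\<close>
    define N where "N = M O fun_graph s O M\<inverse>"
    have N: "field_relation N" unfolding N_def
      by (intro field_rel_comp field_rel_converse M(1) hom_field_rel s)
    have IN: "Id_on K \<subseteq> N"
    proof
      fix p assume "p \<in> Id_on K"
      then obtain a where a: "p = (to_ac a, to_ac a)" by (auto simp: K_def)
      have "(to_ac a, \<phi> a) \<in> M" using R0_mem M(2) by blast
      moreover have "(\<phi> a, \<phi> a) \<in> fun_graph s" using s(4)[of a] by force
      ultimately show "p \<in> N" unfolding N_def a by blast
    qed
    have zN: "(z j, z (\<pi> j)) \<in> N" if j: "j \<in> {1..n}" for j
    proof -
      have "\<pi> j \<in> {1..n}" using permutes_in_image[OF p] j by blast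
      then have "(z (\<pi> j), w (\<pi> j)) \<in> M" by (rule zM)
      moreover have "(w j, w (\<pi> j)) \<in> fun_graph s" using s(5)[OF j] by force
      ultimately show ?thesis unfolding N_def using zM[OF j] by blast
    qed
    have "Domain N = L"
    proof (rule L_least[OF N])
      show "Domain N \<subseteq> L" using M(4) by (auto simp: N_def)
      show "K \<subseteq> Domain N" using IN by blast
      show "set zs \<subseteq> Domain N" unfolding setz using zN by blast
    qed
    moreover have "Domain (N\<inverse>) = L"
    proof (rule L_least[OF field_rel_converse[OF N]])
      show "Domain (N\<inverse>) \<subseteq> L" using M(4) by (auto simp: N_def)
      show "K \<subseteq> Domain (N\<inverse>)" using IN by blast
      have "z j \<in> Range N" if "j \<in> {1..n}" for j
      proof -
        have "j \<in> \<pi> ` {1..n}" using permutes_image[OF p] that by simp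
        then show ?thesis using zN by blast
      qed
      then show "set zs \<subseteq> Domain (N\<inverse>)" unfolding setz by auto
    qed
    ultimately obtain \<sigma> where s': "\<sigma> \<in> carrier ?G" "\<forall>x\<in>L. (x, \<sigma> x) \<in> N"
      using field_rel_automorphism[OF N _ _ IN] by auto
    interpret N: field_relation N by (rule N)
    have "\<sigma> (z j) = z (\<pi> j)" if j: "j \<in> {1..n}" for j
    proof -
      have "z j \<in> L" using z[OF j] zL by blast
      then show ?thesis using s'(2) zN[OF j] N.unique by blast
    qed
    then show ?thesis using s'(1) by blast
  qed
  have fix_poly: "poly g (\<sigma> x) = 0" if s: "\<sigma> \<in> carrier ?G" and g: "g \<in> polys_over K" "poly g x = 0" and x: "x \<in> L"
      for \<sigma> g x
  proof -
    interpret S: field_relation "graph_on L \<sigma>"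
      by (rule galois_graph_field_rel[OF s L])
    have "poly_rel (graph_on L \<sigma>) g g"
      using g(1) KL s unfolding poly_rel_def polys_over_def galois_group_carrier by force
    from S.poly_eval[OF this, of x "\<sigma> x"] x g(2) show ?thesis using S.zero_right by auto
  qed
  have faK: "fa \<in> polys_over K" by (auto simp: polys_over_def fa_def K_def coeff_map_poly)
  define idx where "idx x = (THE i. i \<in> {1..n} \<and> z i = x)" for x
  have idx: "idx x \<in> {1..n} \<and> z (idx x) = x" if "x \<in> set zs" for x
  proof -
    have "\<exists>!i. i \<in> {1..n} \<and> z i = x" using that injz unfolding setz by (metis (no_types, lifting) image_iff inj_onD)
    then show ?thesis unfolding idx_def by (rule theI')
  qed
  have idx_z: "idx (z j) = j" if "j \<in> {1..n}" for j
    using idx[of "z j"] that z injz by (metis inj_onD)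
  define P where "P \<sigma> j = (if j \<in> {1..n} then idx (\<sigma> (z j)) else j)" for \<sigma> j
  have sz: "\<sigma> (z j) \<in> set zs" if "\<sigma> \<in> carrier ?G" "j \<in> {1..n}" for \<sigma> j
    using fix_poly[OF that(1) faK, of "z j"] root_fa z[OF that(2)] zL by blast
  have zP: "z (P \<sigma> j) = \<sigma> (z j)" and Pin: "P \<sigma> j \<in> {1..n}" if "\<sigma> \<in> carrier ?G" "j \<in> {1..n}" for \<sigma> j
    using idx[OF sz[OF that]] that by (auto simp: P_def)
  have P_perm: "P \<sigma> permutes {1..n}" if s: "\<sigma> \<in> carrier ?G" for \<sigma>
  proof (rule bij_imp_permutes)
    have "inj_on (P \<sigma>) {1..n}"
    proof (rule inj_onI)
      fix i j assume ij: "i \<in> {1..n}" "j \<in> {1..n}" "P \<sigma> i = P \<sigma> j"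
      then have "\<sigma> (z i) = \<sigma> (z j)" using zP[OF s] by metis
      then have "z i = z j" using galois_group_bij[OF s] z zL ij by (metis bij_betw_def inj_onD subsetD)
      then show "i = j" using injz ij by (auto dest: inj_onD)
    qed
    moreover have "P \<sigma> ` {1..n} \<subseteq> {1..n}" using Pin[OF s] by blast
    ultimately show "bij_betw (P \<sigma>) {1..n} {1..n}" by (simp add: bij_betw_def endo_inj_surj)
  next
    show "P \<sigma> x = x" if "x \<notin> {1..n}" for x unfolding P_def using that by (rule if_not_P)
  qed
  have P_eq: "P \<sigma> = \<pi>" if s: "\<sigma> \<in> carrier ?G" and p: "\<pi> permutes {1..n}" and eq: "\<And>j. j \<in> {1..n} \<Longrightarrow> \<sigma> (z j) = z (\<pi> j)"
      for \<sigma> \<pi>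
  proof
    fix j show "P \<sigma> j = \<pi> j"
    proof (cases "j \<in> {1..n}")
      case True
      then have "\<pi> j \<in> {1..n}" using permutes_in_image[OF p] by blast
      then show ?thesis using True eq idx_z by (simp add: P_def)
    next
      case False
      then show ?thesis using permutes_not_in[OF p False] by (simp only: P_def if_False)
    qed
  qed
  have "P \<in> iso ?G (sym_group n)"
  proof (rule isoI)
    show "P \<in> hom ?G (sym_group n)"
    proof (rule homI)
      show "P \<sigma> \<in> carrier (sym_group n)" if "\<sigma> \<in> carrier ?G" for \<sigma>
        using P_perm[OF that] by (simp add: sym_group_carrier)
      show "P (\<sigma> \<otimes>\<^bsub>?G\<^esub> \<tau>) = P \<sigma> \<otimes>\<^bsub>sym_group n\<^esub> P \<tau>" if s: "\<sigma> \<in> carrier ?G" "\<tau> \<in> carrier ?G" for \<sigma> \<tau>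
        unfolding galois_group_mult[OF s] sym_group_mult
      proof (rule P_eq[OF galois_group_compose[OF L KL s]])
        show "P \<sigma> \<circ> P \<tau> permutes {1..n}" by (intro permutes_compose P_perm s)
        fix j assume j: "j \<in> {1..n}"
        have "z j \<in> L" using z[OF j] zL by blast
        then have "compose L \<sigma> \<tau> (z j) = \<sigma> (\<tau> (z j))" by (simp add: compose_def)
        also have "\<tau> (z j) = z (P \<tau> j)" using zP[OF s(2) j] by simp
        also have "\<sigma> \<dots> = z (P \<sigma> (P \<tau> j))" using zP[OF s(1) Pin[OF s(2) j]] by simp
        finally show "compose L \<sigma> \<tau> (z j) = z ((P \<sigma> \<circ> P \<tau>) j)" by simp
      qed
    qed
    show "bij_betw P (carrier ?G) (carrier (sym_group n))"
      unfolding bij_betw_def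
    proof
      show "inj_on P (carrier ?G)"
      proof (rule inj_onI)
        fix \<sigma> \<tau> assume s: "\<sigma> \<in> carrier ?G" "\<tau> \<in> carrier ?G" "P \<sigma> = P \<tau>"
        show "\<sigma> = \<tau>" using zP s by (intro agree[OF s(1,2)]) metis
      qed
      show "P ` carrier ?G = carrier (sym_group n)"
      proof
        show "P ` carrier ?G \<subseteq> carrier (sym_group n)" using P_perm by (auto simp: sym_group_carrier)
        show "carrier (sym_group n) \<subseteq> P ` carrier ?G"
        proof
          fix \<pi> assume "\<pi> \<in> carrier (sym_group n)"
          then have p: "\<pi> permutes {1..n}" by (simp add: sym_group_carrier)
          from permute[OF p] obtain \<sigma> where "\<sigma> \<in> carrier ?G" "\<forall>j\<in>{1..n}. \<sigma> (z j) = z (\<pi> j)" by blast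
          then show "\<pi> \<in> P ` carrier ?G" using P_eq[OF _ p] by blast
        qed
      qed
    qed
  qed
  then have iso: "?G \<cong> sym_group n" by (auto simp: is_iso_def)
  have "splitting_field_over K fa L"
    unfolding splitting_field_over_def
  proof (intro conjI K faK)
    show "splits_over L fa" unfolding splits_over_def using fa_split lfa zL by blast
    have "{x \<in> L. poly fa x = 0} = set zs" using root_fa zL by blast
    then show "L = generate_field ring_of_type_algebra (K \<union> {x \<in> L. poly fa x = 0})" by (simp add: L_def)
  qed
  then show "has_galois_group f (sym_group n)"
    unfolding has_galois_group_def using iso unfolding fa_def K_def by blast
  have rsq: "rsquarefree fa"
    unfolding rsquarefree_def
  proof (intro conjI allI fa0)
    fix a
    show "order a fa = 0 \<or> order a fa = 1"
    proof (cases "a \<in> set zs")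
      case False
      then show ?thesis using root_fa by (simp add: order_0I)
    next
      case True
      have "\<not> [:- a, 1:] ^ 2 dvd fa"
      proof
        assume "[:- a, 1:] ^ 2 dvd fa"
        then obtain k where "fa = [:- a, 1:] ^ 2 * k" by (auto elim: dvdE)
        moreover have "fa = [:- a, 1:] * smult (lead_coeff fa) (\<Prod>x\<leftarrow>remove1 a zs. [:- x, 1:])"
          by (subst fa_split) (simp only: prod_list_remove1[OF True] mult_smult_right)
        ultimately have "[:- a, 1:] * ([:- a, 1:] * k) = [:- a, 1:] * smult (lead_coeff fa)
            (\<Prod>x\<leftarrow>remove1 a zs. [:- x, 1:])"
          by (simp only: power2_eq_square mult.assoc)
        then have "[:- a, 1:] * k = smult (lead_coeff fa) (\<Prod>x\<leftarrow>remove1 a zs. [:- x, 1:])"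
          by (subst (asm) mult_cancel_left) auto
        then have "poly (smult (lead_coeff fa) (\<Prod>x\<leftarrow>remove1 a zs. [:- x, 1:])) a = 0"
          by (metis dvd_triv_left poly_eq_0_iff_dvd)
        then have "a \<in> set (remove1 a zs)" using lfa by (simp add: poly_linear_factors_eq_0_iff)
        then show False using dist by simp
      qed
      then have "\<not> 2 \<le> order a fa" using fa0 by (simp add: order_divides)
      then show ?thesis by auto
    qed
  qed
  then show "separable_poly f" by (simp add: separable_poly_def fa_def)
  show "irreducible f"
  proof (rule irreducibleI)
    show "f \<noteq> 0" by (rule f0)
    show "\<not> f dvd 1" using deg n by (simp add: poly_dvd_1)
    fix a b assume ab: "f = a * b"
    define a' where "a' = map_poly to_ac a"
    define b' where "b' = map_poly to_ac b"
    have ra: "poly_rel ?A a a'" "poly_rel ?A b b'" unfolding a'_def b'_def by (rule poly_rel_map_poly; simp)+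
    have "poly_rel ?A f (a' * b')" unfolding ab by (intro A.poly_rel_mult ra)
    then have fab: "fa = a' * b'" using A.poly_rel_unique Afa by blast
    have abK: "a' \<in> polys_over K" "b' \<in> polys_over K"
      by (auto simp: polys_over_def a'_def b'_def K_def coeff_map_poly)
    \<comment> \<open>The automorphism realizing the transposition of \<open>1\<close> and
      \<open>j\<close> carries the root \<open>z 1\<close> to \<open>z j\<close>. A factor of
      \<open>fa\<close> over \<open>K\<close> vanishing at \<open>z 1\<close> therefore has all
      \<open>n\<close> roots, which forces the other factor to be constant.\<close>
    have all: "degree c' \<ge> n" if c: "c' \<in> polys_over K" "c' \<noteq> 0" "poly c' (z 1) = 0" for c'
    proof -
      have "poly c' (z j) = 0" if j: "j \<in> {1..n}" for j
      proof -
        have "transpose 1 j permutes {1..n}" using j by (intro permutes_swap_id) auto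
        from permute[OF this] obtain \<sigma> where s: "\<sigma> \<in> carrier ?G" "\<forall>i\<in>{1..n}. \<sigma> (z i) = z (transpose 1 j i)" by blast
        have "1 \<in> {1..n}" using n by simp
        then have "\<sigma> (z 1) = z j" "z 1 \<in> L" using s(2) z zL by auto
        then show ?thesis using fix_poly[OF s(1) c(1,3)] by simp
      qed
      then have "z ` {1..n} \<subseteq> {x. poly c' x = 0}" by blast
      then have "card (z ` {1..n}) \<le> card {x. poly c' x = 0}"
        using c by (intro card_mono poly_roots_finite)
      also have "\<dots> \<le> degree c'" using c by (intro card_poly_roots_bound)
      finally show ?thesis using injz by (simp add: card_image)
    qed
    have "poly fa (z 1) = 0" using root_fa z[of 1] n by simp
    then have "poly a' (z 1) = 0 \<or> poly b' (z 1) = 0" using fab by simp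
    moreover have nz: "a' \<noteq> 0" "b' \<noteq> 0" using fab fa0 by auto
    ultimately have "degree a' \<ge> n \<or> degree b' \<ge> n" using all abK by blast
    moreover have "degree a' + degree b' = n" using fab nz dfa by (simp add: degree_mult_eq)
    ultimately have "degree a' = 0 \<or> degree b' = 0" by auto
    then have "degree a = 0 \<or> degree b = 0" using A.poly_rel_degree[OF ra(1)] A.poly_rel_degree[OF ra(2)] by simp
    moreover have "a \<noteq> 0" "b \<noteq> 0" using ab f0 by auto
    ultimately show "a dvd 1 \<or> b dvd 1" by (metis is_unit_iff_degree)
  qed
qed

subsection \<open>Covariants of the binary quintic\<close>

declare One_nat_def [simp del]

text \<open>
  Moving \<open>y 1\<close> to infinity by \<open>x \<mapsto> 1 / (x - y 1)\<close> and centring the images of the other four points makes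
  them the roots of a depressed quartic \<open>x\<^sup>4 + p x\<^sup>2 + q x + r\<close>. Up to constants and powers of
  \<open>\<Prod>k\<ge>2. (y k - y 1)\<close>, the invariants \<open>inv4\<close>, \<open>disc5\<close>, \<open>inv12\<close> of the five points become \<open>quartic_inv\<close>,
  \<open>quartic_disc\<close>, \<open>p * quartic_res\<close>, and the covariants \<open>covS\<close>, \<open>covT\<close> at \<open>y 1\<close> become \<open>p\<close>, \<open>p\<^sup>2 + 12 r\<close>.
\<close>

abbreviation quartic_inv :: "'a::comm_ring_1 \<Rightarrow> 'a \<Rightarrow> 'a \<Rightarrow> 'a" where
  "quartic_inv p q r \<equiv> 6*p^3+40*p*r+9*q^2"

abbreviation quartic_disc :: "'a::comm_ring_1 \<Rightarrow> 'a \<Rightarrow> 'a \<Rightarrow> 'a" where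
  "quartic_disc p q r \<equiv> 16*p^4*r-4*p^3*q^2-128*p^2*r^2+144*p*q^2*r-27*q^4+256*r^3"

abbreviation quartic_res :: "'a::comm_ring_1 \<Rightarrow> 'a \<Rightarrow> 'a \<Rightarrow> 'a" where
  "quartic_res p q r \<equiv> 1089*p^8+22704*p^6*r+4656*p^5*q^2+144736*p^4*r^2+73856*p^3*q^2*r+5184*p^2*q^4
     +275200*p^2*r^3+264960*p*q^2*r^2+55296*q^4*r+160000*r^4"

text \<open>Divided by \<open>V^5 * Y^2\<close>, the left side is \<open>P\<close> at
  \<open>u = U / V\<close> with parameters \<open>D / a^2\<close> and \<open>a^3 / Y\<close>. Here
  \<open>q\<close> is the linear coefficient of the quartic, not the parameter of
  \<open>P\<close>.\<close>

lemma normal_form_root: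
  fixes p q r :: "'a::field"
  defines "a \<equiv> quartic_inv p q r"
    and "D \<equiv> 25 * (quartic_disc p q r)"
    and "Y \<equiv> 64 * p * (quartic_res p q r)"
    and "U \<equiv> - 25 * (p^2 + 12 * r)" and "V \<equiv> 32 * p^2"
  shows "U^2 * (U + 50*V)^3 * Y^2 - 20 * (611*D*a*U^3 + 8505*a^3*U^3 + 39270*D*a*U^2*V + 263250*a^3*U^2*V
     + 4050000*a^3*U*V^2 + 438000*D*a*U*V^2 + 100000*D*a*V^3) * U * V * Y
     + 2 * (25*a^2 + 3*D) * V * (625*D^2*U^4 + 44550*D*a^2*U^4 + 793881*a^4*U^4 + 18370800*a^4*U^3*V
           + 3175200*D*a^2*U^3*V - 10000*D^2*U^3*V + 262440000*a^4*U^2*V^2 + 60000*D^2*U^2*V^2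
           + 25336800*D*a^2*U^2*V^2 - 160000*D^2*U*V^3 + 12960000*D*a^2*U*V^3 + 160000*D^2*V^4) = 0"
  unfolding a_def D_def Y_def U_def V_def by Groebner_Basis.algebra

lemma poly_P_poly:
  fixes d q u :: "'a::comm_ring_1"
  shows   "poly (P_poly d q) u = u^2 * (u + 50)^3
        - 20 * (611 * d * u^3 + 8505 * u^3 + 39270 * d * u^2 + 263250 * u^2 + 4050000 * u
                + 438000 * d * u + 100000 * d) * u * q
        + 2 * (25 + 3 * d) * (625 * d^2 * u^4 + 44550 * d * u^4 + 793881 * u^4 + 18370800 * u^3
           + 3175200 * d * u^3 - 10000 * d^2 * u^3 + 262440000 * u^2 + 60000 * d^2 * u^2
           + 25336800 * d * u^2 - 160000 * d^2 * u + 12960000 * d * u + 160000 * d^2) * q^2"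
  unfolding P_poly_def Let_def poly_add poly_diff poly_mult poly_power poly_numeral poly_pCons poly_0
  by (simp only: mult_1_right mult_zero_right add_0_right add_0_left mult_zero_left)

lemma P_poly_homogenized:
  fixes a D Y U V :: "'a::field"
  assumes "a \<noteq> 0" "Y \<noteq> 0" "V \<noteq> 0"
  shows "poly (P_poly (D / a^2) (a^3 / Y)) (U / V) * (V^5 * Y^2) =
    U^2 * (U + 50*V)^3 * Y^2 - 20 * (611*D*a*U^3 + 8505*a^3*U^3 + 39270*D*a*U^2*V + 263250*a^3*U^2*V
     + 4050000*a^3*U*V^2 + 438000*D*a*U*V^2 + 100000*D*a*V^3) * U * V * Y
     + 2 * (25*a^2 + 3*D) * V * (625*D^2*U^4 + 44550*D*a^2*U^4 + 793881*a^4*U^4 + 18370800*a^4*U^3*V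
           + 3175200*D*a^2*U^3*V - 10000*D^2*U^3*V + 262440000*a^4*U^2*V^2 + 60000*D^2*U^2*V^2
           + 25336800*D*a^2*U^2*V^2 - 160000*D^2*U*V^3 + 12960000*D*a^2*U*V^3 + 160000*D^2*V^4)"
proof -
  define d where "d = D / a^2"
  define k where "k = 1 / Y"
  define u where "u = U / V"
  have D: "D = d * a^2" and U: "U = u * V" and Y: "Y * k = 1"
    and e: "D / a^2 = d" "a^3 / Y = a^3 * k" "U / V = u"
    using assms by (auto simp: d_def k_def u_def)
  show ?thesis unfolding e poly_P_poly unfolding D U using Y
    by Groebner_Basis.algebra
qed

definition sqd :: "(nat \<Rightarrow> 'a::comm_ring_1) \<Rightarrow> nat \<Rightarrow> nat \<Rightarrow> 'a" where
  "sqd y i j = (y i - y j)^2"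

text \<open>Up to a constant the invariant of degree 4 of the binary quintic: ten terms, one for
  each pair, and every point has degree 4 in each term.\<close>

definition inv4 :: "(nat \<Rightarrow> 'a::comm_ring_1) \<Rightarrow> 'a" where
  "inv4 y = sqd y 1 2 ^ 2 * (sqd y 3 4 * sqd y 4 5 * sqd y 3 5)
     + sqd y 1 3 ^ 2 * (sqd y 2 4 * sqd y 4 5 * sqd y 2 5)
     + sqd y 1 4 ^ 2 * (sqd y 2 3 * sqd y 3 5 * sqd y 2 5)
     + sqd y 1 5 ^ 2 * (sqd y 2 3 * sqd y 3 4 * sqd y 2 4)
     + sqd y 2 3 ^ 2 * (sqd y 1 4 * sqd y 4 5 * sqd y 1 5)
     + sqd y 2 4 ^ 2 * (sqd y 1 3 * sqd y 3 5 * sqd y 1 5)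
     + sqd y 2 5 ^ 2 * (sqd y 1 3 * sqd y 3 4 * sqd y 1 4)
     + sqd y 3 4 ^ 2 * (sqd y 1 2 * sqd y 2 5 * sqd y 1 5)
     + sqd y 3 5 ^ 2 * (sqd y 1 2 * sqd y 2 4 * sqd y 1 4)
     + sqd y 4 5 ^ 2 * (sqd y 1 2 * sqd y 2 3 * sqd y 1 3)"

definition disc5 :: "(nat \<Rightarrow> 'a::comm_ring_1) \<Rightarrow> 'a" where
  "disc5 y = sqd y 1 2 * sqd y 1 3 * sqd y 1 4 * sqd y 1 5 * sqd y 2 3 * sqd y 2 4 * sqd y 2 5
     * sqd y 3 4 * sqd y 3 5 * sqd y 4 5"

text \<open>Half the value at \<open>x = y 1\<close> of the quadratic covariant of degree 2 of the
  quintic, which is the sum of \<open>(a - b)^2 (c - d)^2 (x - e)^2\<close> over the 15 splittings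
  of the points into pairs \<open>{a, b}\<close>, \<open>{c, d}\<close> and a single point
  \<open>e\<close>.\<close>

definition covS :: "(nat \<Rightarrow> 'a::comm_ring_1) \<Rightarrow> 'a" where
  "covS y = sqd y 2 3 * sqd y 1 4 * sqd y 1 5 + sqd y 2 4 * sqd y 1 3 * sqd y 1 5
     + sqd y 2 5 * sqd y 1 3 * sqd y 1 4 + sqd y 3 4 * sqd y 1 2 * sqd y 1 5
     + sqd y 3 5 * sqd y 1 2 * sqd y 1 4 + sqd y 4 5 * sqd y 1 2 * sqd y 1 3"

text \<open>The bracketed sum is, up to a constant, the invariant of degree 2 of the quartic with
  roots \<open>y 2\<close>, ..., \<open>y 5\<close>. The first factor brings the degrees to 8 in
  \<open>y 1\<close> and 4 in the other points, as in \<open>covS y ^ 2\<close>.\<close>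

definition covT :: "(nat \<Rightarrow> 'a::comm_ring_1) \<Rightarrow> 'a" where
  "covT y = (sqd y 1 2 * sqd y 1 3 * sqd y 1 4 * sqd y 1 5)
     * (sqd y 2 3 * sqd y 4 5 + sqd y 2 4 * sqd y 3 5 + sqd y 2 5 * sqd y 3 4)"

definition covU :: "(nat \<Rightarrow> 'a::field) \<Rightarrow> 'a" where
  "covU y = - 25 * covT y / covS y ^ 2"

definition at_point :: "nat \<Rightarrow> (nat \<Rightarrow> 'a) \<Rightarrow> (nat \<Rightarrow> 'a)" where
  "at_point j y = y \<circ> transpose 1 j"

text \<open>Up to a constant the resultant of the monic quintic with its quadratic covariant, an
  invariant of degree 12.\<close>

definition inv12 :: "(nat \<Rightarrow> 'a::comm_ring_1) \<Rightarrow> 'a" where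
  "inv12 y = (\<Prod>j\<in>{1..5}. covS (at_point j y))"

lemma atLeastAtMost_1_5: "{1..5::nat} = {1, 2, 3, 4, 5}"
  by auto

lemma atLeastAtMost_2_5: "{2..5::nat} = {2, 3, 4, 5}"
  by auto

lemma inv12_expand: "inv12 y = covS (at_point 1 y) * covS (at_point 2 y) * covS (at_point 3 y)
     * covS (at_point 4 y) * covS (at_point 5 y)"
  by (simp add: inv12_def atLeastAtMost_1_5 mult.assoc)

definition delta5 :: "(nat \<Rightarrow> 'a::field) \<Rightarrow> 'a" where
  "delta5 y = 100 * disc5 y / inv4 y ^ 2"

definition q5 :: "(nat \<Rightarrow> 'a::field) \<Rightarrow> 'a" where
  "q5 y = inv4 y ^ 3 / (64 * inv12 y)"

text \<open>The roots of the depressed quartic are the \<open>w k\<close>, and \<open>t\<close>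
  undoes the centring. Each invariant becomes a polynomial in the \<open>w k\<close> times the power
  of \<open>V\<close> dictated by its degree in the points.\<close>

lemma normal_form:
  fixes y v w :: "nat \<Rightarrow> 'a::field" and t :: 'a
  assumes y': "\<forall>k\<in>{2,3,4,5}. y k = y 1 + v k"
    and vw': "\<forall>k\<in>{2,3,4,5}. v k * (w k + t) = 1"
    and o5: "w 5 = - (w 2 + w 3 + w 4)"
  defines "V \<equiv> v 2 * v 3 * v 4 * v 5"
    and "p \<equiv> w 2 * w 3 + w 2 * w 4 + w 3 * w 4 + (w 2 + w 3 + w 4) * w 5"
    and "q \<equiv> - (w 2 * w 3 * w 4 + (w 2 * w 3 + w 2 * w 4 + w 3 * w 4) * w 5)"
    and "r \<equiv> w 2 * w 3 * w 4 * w 5"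
  shows "inv4 y = - 2 * (quartic_inv p q r) * V^4"
    and "disc5 y = (quartic_disc p q r) * V^8"
    and "covS y = - 8 * p * V^2"
    and "covT y = 2 * (p^2 + 12 * r) * V^4"
    and "inv12 y = - 8 * p * (quartic_res p q r) * V^12"
proof -
  note y = bspec[OF y'] and vw = bspec[OF vw']
  have s1: "sqd y 1 k = (v k)^2" "sqd y k 1 = (v k)^2" if "k \<in> {2,3,4,5}" for k
    using y[OF that] by (auto simp: sqd_def)
  have skl: "sqd y k l = (v k)^2 * (v l)^2 * (w k - w l)^2"
    if k: "k \<in> {2,3,4,5}" and l: "l \<in> {2,3,4,5}" for k l
  proof -
    \<comment> \<open>Differences of reciprocals: inversion changes a difference only by the factor
      \<open>v k * v l\<close>, which is why everything splits into a part in \<open>w\<close> and a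
      power of \<open>V\<close>.\<close>
    have "v k - v l = v k * v l * (w l - w k)"
      using vw[OF k] vw[OF l] by Groebner_Basis.algebra
    then show ?thesis unfolding sqd_def y[OF k] y[OF l] by (simp add: power2_commute[of "w l"] power_mult_distrib)
  qed
  note s = s1(1)[of 2, simplified] s1(1)[of 3, simplified] s1(1)[of 4, simplified] s1(1)[of 5, simplified]
    s1(2)[of 2, simplified] s1(2)[of 3, simplified] s1(2)[of 4, simplified] s1(2)[of 5, simplified]
    skl[of 2 3, simplified] skl[of 2 4, simplified] skl[of 2 5, simplified] skl[of 3 4, simplified]
        skl[of 3 5, simplified] skl[of 4 5, simplified]
    skl[of 3 2, simplified] skl[of 4 2, simplified] skl[of 5 2, simplified] skl[of 4 3, simplified]
        skl[of 5 3, simplified] skl[of 5 4, simplified]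
  show "inv4 y = - 2 * (quartic_inv p q r) * V^4"
    unfolding inv4_def s p_def q_def r_def V_def o5 by Groebner_Basis.algebra
  show "disc5 y = (quartic_disc p q r) * V^8"
    unfolding disc5_def s p_def q_def r_def V_def o5 by Groebner_Basis.algebra
  show S1: "covS y = - 8 * p * V^2"
    unfolding covS_def s p_def V_def o5 by Groebner_Basis.algebra
  show "covT y = 2 * (p^2 + 12 * r) * V^4"
    unfolding covT_def s p_def q_def r_def V_def o5 by Groebner_Basis.algebra
  \<comment> \<open>The quadratic covariant in the new coordinate; its leading coefficient
    \<open>- 8 * p\<close> is its value at the point moved to infinity.\<close>
  let ?B = "\<lambda>k. - 8 * p * w k^2 - 12 * q * w k + 3 * p^2 + 20 * r"
  have "sqd (at_point j y) a b = sqd y (transpose 1 j a) (transpose 1 j b)" for j a b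
    by (simp add: sqd_def at_point_def)
  note sa = this
  have S2: "covS (at_point 2 y) = v 2^2 * V^2 * ?B 2"
    unfolding covS_def sa by (simp add: transpose_def s) (unfold p_def q_def r_def V_def o5, Groebner_Basis.algebra)
  have S3: "covS (at_point 3 y) = v 3^2 * V^2 * ?B 3"
    unfolding covS_def sa by (simp add: transpose_def s) (unfold p_def q_def r_def V_def o5, Groebner_Basis.algebra)
  have S4: "covS (at_point 4 y) = v 4^2 * V^2 * ?B 4"
    unfolding covS_def sa by (simp add: transpose_def s) (unfold p_def q_def r_def V_def o5, Groebner_Basis.algebra)
  have S5: "covS (at_point 5 y) = v 5^2 * V^2 * ?B 5"
    unfolding covS_def sa by (simp add: transpose_def s) (unfold p_def q_def r_def V_def o5, Groebner_Basis.algebra)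
  \<comment> \<open>The product over the roots of the monic quartic, so \<open>quartic_res\<close>
    is the resultant of the quartic with this quadratic.\<close>
  have N: "?B 2 * ?B 3 * ?B 4 * ?B 5 = quartic_res p q r"
    unfolding p_def q_def r_def o5 by Groebner_Basis.algebra
  have "at_point 1 y = y" by (simp add: at_point_def)
  then have "inv12 y = (- 8 * p * V^2) * (v 2^2 * V^2 * ?B 2) * (v 3^2 * V^2 * ?B 3) * (v 4^2 * V^2 * ?B 4)
      * (v 5^2 * V^2 * ?B 5)"
    unfolding inv12_expand S2 S3 S4 S5 by (simp only: S1)
  also have "\<dots> = - 8 * p * (?B 2 * ?B 3 * ?B 4 * ?B 5) * V^12"
  proof -
    \<comment> \<open>Stated for arbitrary \<open>b1\<close>, ..., \<open>b4\<close>, so that the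
      brackets stay atoms and only the powers of \<open>v\<close> are collected.\<close>
    have "(- 8 * p * Z^2) * (a^2 * Z^2 * b1) * (b^2 * Z^2 * b2) * (c^2 * Z^2 * b3) * (d^2 * Z^2 * b4)
        = - 8 * p * (b1 * b2 * b3 * b4) * Z^12" if "Z = a * b * c * d" for Z a b c d b1 b2 b3 b4 :: 'a
      using that by Groebner_Basis.algebra
    then show ?thesis using V_def by blast
  qed
  finally show "inv12 y = - 8 * p * (quartic_res p q r) * V^12"
    unfolding N .
qed

lemma two_powers_nonzero:
  assumes "(2::'a::field) \<noteq> 0"
  shows "(4::'a) \<noteq> 0" "(8::'a) \<noteq> 0" "(64::'a) \<noteq> 0" "(32::'a) \<noteq> 0" "(16::'a) \<noteq> 0"
  using power_not_zero[OF assms, of 2] power_not_zero[OF assms, of 3] power_not_zero[OF assms, of 6]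
    power_not_zero[OF assms, of 5] power_not_zero[OF assms, of 4]
  by simp_all

lemma normal_form_quotients:
  fixes y v w :: "nat \<Rightarrow> 'a::field" and t :: 'a
  assumes two: "(2::'a) \<noteq> 0"
    and y: "\<forall>k\<in>{2,3,4,5}. y k = y 1 + v k"
    and vw: "\<forall>k\<in>{2,3,4,5}. v k * (w k + t) = 1"
    and w5: "w 5 = - (w 2 + w 3 + w 4)"
  defines "p \<equiv> w 2 * w 3 + w 2 * w 4 + w 3 * w 4 + (w 2 + w 3 + w 4) * w 5"
    and "q \<equiv> - (w 2 * w 3 * w 4 + (w 2 * w 3 + w 2 * w 4 + w 3 * w 4) * w 5)"
    and "r \<equiv> w 2 * w 3 * w 4 * w 5"
  defines "a \<equiv> quartic_inv p q r"
    and "D \<equiv> quartic_disc p q r"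
    and "N \<equiv> quartic_res p q r"
  shows "delta5 y = 25 * D / a^2"
    and "q5 y = a^3 / (64 * p * N)"
    and "covU y = (- 25 * (p^2 + 12 * r)) / (32 * p^2)"
    and "inv4 y = 0 \<longleftrightarrow> a = 0" and "inv12 y = 0 \<longleftrightarrow> p * N = 0" and "disc5 y = 0 \<longleftrightarrow> D = 0"
proof -
  define V where "V = v 2 * v 3 * v 4 * v 5"
  note nf = normal_form[of y v w t, OF y vw w5, folded V_def p_def q_def r_def, folded a_def D_def N_def]
  note two' = two_powers_nonzero[OF two]
  have "v k \<noteq> 0" if "k \<in> {2,3,4,5}" for k using bspec[OF vw that] by auto
  then have V0: "V \<noteq> 0" by (simp add: V_def)
  show "delta5 y = 25 * D / a^2"
  proof -
    have "delta5 y = 100 * (D * V^8) / (- 2 * a * V^4)^2" by (simp only: delta5_def nf)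
    also have "\<dots> = (25 * D) * (4 * V^8) / (a^2 * (4 * V^8))"
      by (simp add: power_mult_distrib mult_ac flip: power_mult)
    also have "\<dots> = 25 * D / a^2" using V0 two' by (intro mult_divide_mult_cancel_right) auto
    finally show ?thesis .
  qed
  show "q5 y = a^3 / (64 * p * N)"
  proof -
    have "q5 y = (- 2 * a * V^4)^3 / (64 * (- 8 * p * N * V^12))" by (simp only: q5_def nf)
    also have "\<dots> = (a^3 * (- 8 * V^12)) / ((64 * p * N) * (- 8 * V^12))"
      by (simp add: power_mult_distrib mult_ac flip: power_mult)
    also have "\<dots> = a^3 / (64 * p * N)" using V0 two' by (intro mult_divide_mult_cancel_right) auto
    finally show ?thesis .
  qed
  show "covU y = (- 25 * (p^2 + 12 * r)) / (32 * p^2)"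
  proof -
    have "covU y = - 25 * (2 * (p^2 + 12 * r) * V^4) / (- 8 * p * V^2)^2" by (simp only: covU_def nf)
    also have "\<dots> = (- 25 * (p^2 + 12 * r)) * (2 * V^4) / ((32 * p^2) * (2 * V^4))"
      by (simp add: power_mult_distrib mult_ac flip: power_mult)
    also have "\<dots> = (- 25 * (p^2 + 12 * r)) / (32 * p^2)" using V0 two by (intro mult_divide_mult_cancel_right) auto
    finally show ?thesis .
  qed
  show "inv4 y = 0 \<longleftrightarrow> a = 0" "inv12 y = 0 \<longleftrightarrow> p * N = 0" "disc5 y = 0 \<longleftrightarrow> D = 0"
    unfolding nf using V0 two two' by auto
qed

lemma covU_root:
  fixes y :: "nat \<Rightarrow> 'a::field"
  assumes two: "(2::'a) \<noteq> 0" and dist: "disc5 y \<noteq> 0" and A: "inv4 y \<noteq> 0" and M: "inv12 y \<noteq> 0"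
  shows "poly (P_poly (delta5 y) (q5 y)) (covU y) = 0"
proof -
  note two' = two_powers_nonzero[OF two]
  define v where "v k = y k - y 1" for k
  \<comment> \<open>The mean of the four reciprocals; subtracting it makes the \<open>w k\<close>
    sum to zero. This division by 4 needs characteristic other than 2.\<close>
  define t where "t = (1/v 2 + 1/v 3 + 1/v 4 + 1/v 5) / 4"
  define w where "w k = 1 / v k - t" for k
  have v0: "v k \<noteq> 0" if "k \<in> {2,3,4,5}" for k
    using dist that by (auto simp: disc5_def sqd_def v_def)
  have w5: "w 5 = - (w 2 + w 3 + w 4)"
  proof -
    have "4 * t = 1/v 2 + 1/v 3 + 1/v 4 + 1/v 5" using two' by (simp add: t_def)
    then show ?thesis unfolding w_def by Groebner_Basis.algebra
  qed
  have 1: "\<forall>k\<in>{2,3,4,5}. y k = y 1 + v k" by (simp add: v_def)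
  have 2: "\<forall>k\<in>{2,3,4,5}. v k * (w k + t) = 1" using v0 by (simp add: w_def)
  define p where "p = w 2 * w 3 + w 2 * w 4 + w 3 * w 4 + (w 2 + w 3 + w 4) * w 5"
  define q where "q = - (w 2 * w 3 * w 4 + (w 2 * w 3 + w 2 * w 4 + w 3 * w 4) * w 5)"
  define r where "r = w 2 * w 3 * w 4 * w 5"
  define a where "a = quartic_inv p q r"
  define D where "D = quartic_disc p q r"
  define N where "N = quartic_res p q r"
  note nq = normal_form_quotients[OF two 1 2 w5, folded p_def q_def r_def, folded a_def D_def N_def]
  have a0: "a \<noteq> 0" and Y0: "64 * p * N \<noteq> 0" and W0: "32 * p^2 \<noteq> 0"
    using A M nq(4,5) two' by auto
  have "poly (P_poly (delta5 y) (q5 y)) (covU y) * ((32 * p^2)^5 * (64 * p * N)^2) = 0"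
    unfolding nq(1-3) P_poly_homogenized[OF a0 Y0 W0] unfolding a_def D_def N_def
    by (rule normal_form_root)
  then show ?thesis using power_not_zero[OF W0, of 5] power_not_zero[OF Y0, of 2]
    by (simp only: mult_eq_0_iff) blast
qed

section \<open>Behaviour under permutations of the points\<close>

lemma sqd_comp_transpose: "sqd (y \<circ> f) i j = sqd y (f i) (f j)"
  by (simp add: sqd_def)

lemma sqd_commute: "sqd y i j = sqd y j i"
  by (simp add: sqd_def power2_commute)

text \<open>Only the instances that move the smaller index to the front, so the simplifier reaches a
  normal form without looping.\<close>

lemmas sqd_swap = sqd_commute[of _ 2 1] sqd_commute[of _ 3 1] sqd_commute[of _ 4 1] sqd_commute[of _ 5 1]
  sqd_commute[of _ 3 2] sqd_commute[of _ 4 2] sqd_commute[of _ 5 2] sqd_commute[of _ 4 3]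
  sqd_commute[of _ 5 3] sqd_commute[of _ 5 4]

lemma inv4_transpose:
  fixes y :: "nat \<Rightarrow> 'a::field"
  assumes "a \<in> {1..5}" "b \<in> {1..5}" "a \<noteq> b"
  shows "inv4 (y \<circ> transpose a b) = inv4 y"
  using assms unfolding atLeastAtMost_1_5
  by (elim insertE emptyE; simp add: inv4_def sqd_comp_transpose transpose_def sqd_swap;
    (Groebner_Basis.algebra)?)

lemma disc5_transpose:
  fixes y :: "nat \<Rightarrow> 'a::field"
  assumes "a \<in> {1..5}" "b \<in> {1..5}" "a \<noteq> b"
  shows "disc5 (y \<circ> transpose a b) = disc5 y"
  using assms unfolding atLeastAtMost_1_5
  by (elim insertE emptyE; simp add: disc5_def sqd_comp_transpose transpose_def sqd_swap;
    (Groebner_Basis.algebra)?)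

lemma covS_transpose:
  fixes y :: "nat \<Rightarrow> 'a::field"
  assumes "a \<in> {2..5}" "b \<in> {2..5}" "a \<noteq> b"
  shows "covS (y \<circ> transpose a b) = covS y"
  using assms unfolding atLeastAtMost_2_5
  by (elim insertE emptyE; simp add: covS_def sqd_comp_transpose transpose_def sqd_swap;
    (Groebner_Basis.algebra)?)

lemma covT_transpose:
  fixes y :: "nat \<Rightarrow> 'a::field"
  assumes "a \<in> {2..5}" "b \<in> {2..5}" "a \<noteq> b"
  shows "covT (y \<circ> transpose a b) = covT y"
  using assms unfolding atLeastAtMost_2_5
  by (elim insertE emptyE; simp add: covT_def sqd_comp_transpose transpose_def sqd_swap;
    (Groebner_Basis.algebra)?)

lemma invariant_permutes:
  assumes "\<And>y a b. a \<in> S \<Longrightarrow> b \<in> S \<Longrightarrow> a \<noteq> b \<Longrightarrow> f (y \<circ> transpose a b) = f y"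
    and "p permutes S" "finite S"
  shows "f (y \<circ> p) = f y"
  using assms(2,3)
proof (induction p arbitrary: y rule: permutes_induct)
  case id then show ?case by simp
next
  case (swap a b p)
  have "f (y \<circ> (transpose a b \<circ> p)) = f ((y \<circ> transpose a b) \<circ> p)" by (simp add: comp_assoc)
  also have "\<dots> = f (y \<circ> transpose a b)" by (rule swap)
  also have "\<dots> = f y" using assms(1) swap by blast
  finally show ?case .
qed

lemma inv4_permutes: "p permutes {1..5} \<Longrightarrow> inv4 (y \<circ> p) = inv4 (y :: nat \<Rightarrow> 'a::field)"
  using invariant_permutes[of "{1..5}" inv4, OF inv4_transpose] by blast

lemma disc5_permutes: "p permutes {1..5} \<Longrightarrow> disc5 (y \<circ> p) = disc5 (y :: nat \<Rightarrow> 'a::field)"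
  using invariant_permutes[of "{1..5}" disc5, OF disc5_transpose] by blast

text \<open>Composing \<open>p\<close> with the transpositions that move \<open>j\<close> and
  \<open>p j\<close> to the first place gives a permutation fixing 1. It permutes the remaining four
  points only, and there \<open>f\<close> is symmetric.\<close>

lemma at_point_permutes:
  assumes p: "p permutes {1..5}" and j: "j \<in> {1..5::nat}"
    and f: "\<And>y a b. a \<in> {2..5} \<Longrightarrow> b \<in> {2..5} \<Longrightarrow> a \<noteq> b \<Longrightarrow> f (y \<circ> transpose a b) = f y"
  shows "f (at_point j (y \<circ> p)) = f (at_point (p j) y)"
proof -
  have pj: "p j \<in> {1..5}" using permutes_in_image[OF p] j by blast
  define s where "s = transpose 1 (p j) \<circ> p \<circ> transpose 1 j"
  have s: "s permutes {1..5}" unfolding s_def using p pj j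
    by (intro permutes_compose permutes_swap_id) auto
  have s1: "s 1 = 1" by (simp add: s_def)
  have "s permutes {2..5}"
  proof (rule permutes_superset[OF s])
    fix x assume "x \<in> {1..5} - {2..5::nat}"
    then have "x = 1" by auto
    then show "s x = x" using s1 by simp
  qed
  then have "f ((y \<circ> transpose 1 (p j)) \<circ> s) = f (y \<circ> transpose 1 (p j))"
    using invariant_permutes[of "{2..5}" f, OF f] by blast
  moreover have "(y \<circ> transpose 1 (p j)) \<circ> s = y \<circ> p \<circ> transpose 1 j"
    by (simp add: s_def fun_eq_iff)
  ultimately show ?thesis by (simp add: at_point_def)
qed

lemma inv12_permutes:
  fixes y :: "nat \<Rightarrow> 'a::field"
  assumes "p permutes {1..5}"
  shows "inv12 (y \<circ> p) = inv12 y"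
proof -
  have "inv12 (y \<circ> p) = (\<Prod>j\<in>{1..5}. covS (at_point (p j) y))"
    unfolding inv12_def by (intro prod.cong refl at_point_permutes[OF assms, of _ covS, OF _ covS_transpose])
  also have "\<dots> = inv12 y"
    unfolding inv12_def using assms by (subst prod.permute[OF assms]) (simp add: o_def)
  finally show ?thesis .
qed

lemma delta5_permutes: "p permutes {1..5} \<Longrightarrow> delta5 (y \<circ> p) = delta5 y"
  by (simp add: delta5_def inv4_permutes disc5_permutes)

lemma q5_permutes: "p permutes {1..5} \<Longrightarrow> q5 (y \<circ> p) = q5 y"
  by (simp add: q5_def inv4_permutes inv12_permutes)

lemma covU_transpose:
  assumes "a \<in> {2..5}" "b \<in> {2..5}" "a \<noteq> b"
  shows "covU (y \<circ> transpose a b) = covU y"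
  using assms by (simp add: covU_def covS_transpose covT_transpose)

definition rootU :: "(nat \<Rightarrow> 'a::field) \<Rightarrow> nat \<Rightarrow> 'a" where
  "rootU y j = covU (at_point j y)"

lemma rootU_permutes:
  "p permutes {1..5} \<Longrightarrow> j \<in> {1..5} \<Longrightarrow> rootU (y \<circ> p) j = rootU y (p j)"
  unfolding rootU_def by (rule at_point_permutes[of _ _ covU, OF _ _ covU_transpose])

lemma rootU_root:
  fixes y :: "nat \<Rightarrow> 'a::field"
  assumes two: "(2::'a) \<noteq> 0" and dist: "disc5 y \<noteq> 0" and A: "inv4 y \<noteq> 0" and M: "inv12 y \<noteq> 0"
    and j: "j \<in> {1..5}"
  shows "poly (P_poly (delta5 y) (q5 y)) (rootU y j) = 0"
proof -
  have p: "transpose 1 j permutes {1..5}" using j by (intro permutes_swap_id) auto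
  have "poly (P_poly (delta5 (y \<circ> transpose 1 j)) (q5 (y \<circ> transpose 1 j))) (covU (y \<circ> transpose 1 j)) = 0"
    using assms by (intro covU_root) (auto simp: inv4_permutes disc5_permutes inv12_permutes p)
  then show ?thesis by (simp add: delta5_permutes q5_permutes p rootU_def at_point_def)
qed

section \<open>Configurations with prescribed invariants\<close>

lemma P_poly_coeffs:
  fixes d q :: "'a::comm_ring_1"
  shows "P_poly d q = [:320000 * d^2 * (25 + 3*d) * q^2,
    - 2000000 * d * q + 2 * (25 + 3*d) * (12960000 * d - 160000 * d^2) * q^2,
    125000 - 20 * (4050000 + 438000 * d) * q + 2 * (25 + 3*d) * (262440000 + 60000 * d^2 + 25336800 * d) * q^2,
    7500 - 20 * (39270 * d + 263250) * q + 2 * (25 + 3*d) * (18370800 + 3175200 * d - 10000 * d^2) * q^2,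
    150 - 20 * (611 * d + 8505) * q + 2 * (25 + 3*d) * (625 * d^2 + 44550 * d + 793881) * q^2, 1:]"
  by (simp add: P_poly_def Let_def power_numeral_reduce numeral_poly algebra_simps)

lemma degree_P_poly [simp]: "degree (P_poly d q :: 'a::comm_ring_1 poly) = 5"
  by (simp add: P_poly_coeffs numeral_eq_Suc)

lemma infinite_UNIV_alg_closed: "infinite (UNIV :: 'a::alg_closed_field set)"
proof
  assume fin: "finite (UNIV :: 'a set)"
  define f where "f = (\<Prod>a\<in>(UNIV::'a set). [:-a, 1:]) + 1"
  have d: "degree (\<Prod>a\<in>(UNIV::'a set). [:-a, 1:]) = card (UNIV::'a set)"
    by (subst degree_prod_sum_eq) auto
  have "card (UNIV::'a set) > 0" using fin by (simp add: card_gt_0_iff)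
  then have "degree f > 0" unfolding f_def
    by (subst degree_add_eq_left) (auto simp: d)
  then obtain x where "poly f x = 0" using alg_closed_imp_poly_has_root by blast
  moreover have "poly (\<Prod>a\<in>(UNIV::'a set). [:-a, 1:]) x = 0"
    using fin by (auto simp: poly_prod)
  ultimately show False by (simp add: f_def)
qed

text \<open>
  For a root \<open>u = - 25 e\<close> of \<open>P_poly d q\<close>, the quartic with \<open>p = 6\<close> and \<open>r = 96 e - 3\<close> has \<open>covU = u\<close>.
  Writing \<open>x\<close> for its rescaled \<open>quartic_inv\<close> and \<open>w = 1 / x\<close>, prescribing \<open>delta5\<close> is a quadratic equation
  for \<open>w\<close> and prescribing \<open>q5\<close> a cubic one; their resultant is a multiple of \<open>poly (P_poly d q) u\<close>, hence
  zero. The degenerate case \<open>e = 2\<close> of the quadratic is \<open>u = - 50\<close>.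
\<close>

lemma exists_config:
  fixes d q :: "'a::alg_closed_field"
  assumes two: "(2::'a) \<noteq> 0" and three: "(3::'a) \<noteq> 0" and five: "(5::'a) \<noteq> 0"
    and d: "d \<noteq> 0" and d': "25 + 3 * d \<noteq> 0" and q: "q \<noteq> 0" and P50: "poly (P_poly d q) (- 50) \<noteq> 0"
  obtains y where "disc5 y \<noteq> 0" "inv4 y \<noteq> 0" "inv12 y \<noteq> 0" "delta5 y = d" "q5 y = q"
proof -
  have "degree (P_poly d q) > 0" by simp
  then obtain u where u: "poly (P_poly d q) u = 0" using alg_closed_imp_poly_has_root by blast
  define e where "e = - u / 25"
  have n25: "(25::'a) \<noteq> 0" using power_not_zero[OF five, of 2] by simp
  have n625: "(625::'a) \<noteq> 0" using power_not_zero[OF five, of 4] by simp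
  have ue: "u = - 25 * e" using n25 by (simp add: e_def)
  have e0: "e \<noteq> 0"
  proof
    assume "e = 0"
    then have "poly (P_poly d q) 0 = 0" using u ue by simp
    \<comment> \<open>The constant coefficient of \<open>P\<close>; it vanishes only in
      characteristic 2 or 5 or at the excluded parameters.\<close>
    then have "320000 * d^2 * (25 + 3*d) * q^2 = 0" by (simp add: P_poly_coeffs)
    moreover have "(320000::'a) = 2^9 * 5^4" by simp
    ultimately show False using two five d d' q by (simp del: power_numeral)
  qed
  have e2: "e - 2 \<noteq> 0"
  proof
    assume "e - 2 = 0"
    then have "u = - 50" using ue by simp
    then show False using u P50 by simp
  qed
  define E where "E = 25 * e^2 * (e - 2)"
  have E0: "E \<noteq> 0" using n25 e0 e2 by (simp add: E_def)
  \<comment> \<open>The condition on \<open>q5\<close> is \<open>q * N' = 6 * x^3\<close> with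
    \<open>N'\<close> as introduced below; \<open>c w\<close> is the difference of its sides times
    \<open>w^3\<close>, where \<open>x * w = 1\<close>.\<close>
  define c where "c w = q * (e^2*(25*e+4)^2*w^3 - 8*e*(295*e+4)*w^2 + 16*(1+256*e)*w) - 6" for w
  have "degree [:- 50 - 6 * d, 100 * e, E:] > 0" using E0 by simp
  then obtain w1 where "poly [:- 50 - 6 * d, 100 * e, E:] w1 = 0" using alg_closed_imp_poly_has_root by blast
  then have w1: "E * w1^2 + 100 * e * w1 = 50 + 6 * d" by (simp add: algebra_simps power2_eq_square)
  \<comment> \<open>The second root of the quadratic by Vieta; either root meets the condition on
    \<open>delta5\<close>, but only one of them need meet the one on \<open>q5\<close>.\<close>
  define w2 where "w2 = - 100 * e / E - w1"
  have S: "E * (w1 + w2) = - 100 * e" using E0 by (simp add: w2_def)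
  have w2: "E * w2^2 + 100 * e * w2 = 50 + 6 * d" using w1 S by Groebner_Basis.algebra
  have T: "E * (w1 * w2) = - (50 + 6 * d)" using w1 S by Groebner_Basis.algebra
  \<comment> \<open>Being symmetric in the two roots, the product is a polynomial in
    \<open>w1 + w2\<close> and \<open>w1 * w2\<close>. The factor \<open>E^3\<close> absorbs the
    denominators when \<open>S\<close> and \<open>T\<close> replace these by coefficients.\<close>
  have "625 * E^3 * (c w1 * c w2) = 0"
  proof -
    define al where "al = q * (e^2*(25*e+4)^2)"
    define be where "be = - q * (8*e*(295*e+4))"
    define ga where "ga = q * (16*(1+256*e))"
    have "E^3 * (c w1 * c w2) = al^2*(E*(w1*w2))^3 + al*be*(E*(w1*w2))^2*(E*(w1+w2))
       + al*ga*(E*(w1*w2))*((E*(w1+w2))^2 - 2*(E*(w1*w2))*E) - 6*al*((E*(w1+w2))^3 - 3*(E*(w1+w2))*(E*(w1*w2))*E)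
       + be^2*(E*(w1*w2))^2*E + be*ga*(E*(w1*w2))*(E*(w1+w2))*E - 6*be*E*((E*(w1+w2))^2 - 2*(E*(w1*w2))*E)
       + ga^2*(E*(w1*w2))*E^2 - 6*ga*(E*(w1+w2))*E^2 + 36*E^3"
      unfolding c_def al_def be_def ga_def by Groebner_Basis.algebra
    then have "625 * E^3 * (c w1 * c w2) = - 36 * e^4 * poly (P_poly d q) (- 25 * e)"
      unfolding S T unfolding al_def be_def ga_def E_def poly_P_poly by Groebner_Basis.algebra
    then show ?thesis using u ue by simp
  qed
  then have "c w1 = 0 \<or> c w2 = 0" using E0 n625 by simp
  then obtain w where w: "E * w^2 + 100 * e * w = 50 + 6 * d" and cw: "c w = 0"
    using w1 w2 by blast
  have w0: "w \<noteq> 0"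
  proof
    assume "w = 0"
    then have "2 * (25 + 3 * d) = 0" using w by simp
    then show False using two d' by (simp only: mult_eq_0_iff) blast
  qed
  define x where "x = 1 / w"
  have xw: "x * w = 1" and x0: "x \<noteq> 0" using w0 by (simp_all add: x_def)
  \<comment> \<open>The linear coefficient of the quartic, chosen such that
    \<open>quartic_inv 6 s r\<close> becomes \<open>36864 * x\<close>.\<close>
  obtain s where s: "s^2 = 4096 * x - 64 - 2560 * e" using nth_root_exists[of 2] by auto
  define r where "r = 96 * e - 3"
  define f where "f = [:r, s, 6, 0, 1:]"
  have f0: "f \<noteq> 0" "degree f = 4" "lead_coeff f = 1" by (simp_all add: f_def)
  then obtain B where "size B = 4" and fB: "f = (\<Prod>x\<in>#B. [:-x, 1:])"
    using alg_closed_imp_factorization[OF f0(1)] by auto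
  obtain zs where zs: "mset zs = B" using ex_mset by blast
  then have "length zs = 4" using \<open>size B = 4\<close> by (metis size_mset)
  then obtain z2 z3 z4 z5 where zs4: "zs = [z2, z3, z4, z5]"
    by (auto simp: numeral_eq_Suc length_Suc_conv)
  have "f = [:-z2,1:] * ([:-z3,1:] * ([:-z4,1:] * [:-z5,1:]))"
    using fB zs4 by (simp flip: zs)
  also have "\<dots> = [:z2*z3*z4*z5, - (z2*z3*z4 + z2*z3*z5 + z2*z4*z5 + z3*z4*z5),
      z2*z3+z2*z4+z2*z5+z3*z4+z3*z5+z4*z5, - (z2+z3+z4+z5), 1:]"
    by (simp add: algebra_simps)
  finally have co: "r = z2*z3*z4*z5" "s = - (z2*z3*z4 + z2*z3*z5 + z2*z4*z5 + z3*z4*z5)"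
    "6 = z2*z3+z2*z4+z2*z5+z3*z4+z3*z5+z4*z5" "0 = - (z2+z3+z4+z5)"
    unfolding f_def pCons_eq_iff by blast+
  \<comment> \<open>The roots are already centred, so the shift is free; it only has to keep the
    points \<open>1 / (z k + t)\<close> finite.\<close>
  obtain t where t: "t \<notin> {-z2,-z3,-z4,-z5}"
    using ex_new_if_finite[OF infinite_UNIV_alg_closed, of "{-z2,-z3,-z4,-z5}"]
    by (metis finite.emptyI finite.insertI)
  define z where "z k = (if k = 2 then z2 else if k = 3 then z3 else if k = 4 then z4 else z5)" for k :: nat
  have z: "z 2 = z2" "z 3 = z3" "z 4 = z4" "z 5 = z5" by (simp_all add: z_def)
  define y where "y k = (if k = 1 then 0 else 1 / (z k + t))" for k :: nat
  have y1: "\<forall>k\<in>{2,3,4,5}. y k = y 1 + y k" by (simp add: y_def)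
  have y2: "\<forall>k\<in>{2,3,4,5}. y k * (z k + t) = 1"
  proof -
    have "z2 + t \<noteq> 0" "z3 + t \<noteq> 0" "z4 + t \<noteq> 0" "z5 + t \<noteq> 0"
      using t by (auto simp: eq_neg_iff_add_eq_0 add.commute)
    then show ?thesis by (simp add: y_def z)
  qed
  have z5: "z 5 = - (z 2 + z 3 + z 4)" unfolding z using co(4) by Groebner_Basis.algebra
  have P: "z 2 * z 3 + z 2 * z 4 + z 3 * z 4 + (z 2 + z 3 + z 4) * z 5 = 6" unfolding z co(3)
      by Groebner_Basis.algebra
  have Q: "- (z 2 * z 3 * z 4 + (z 2 * z 3 + z 2 * z 4 + z 3 * z 4) * z 5) = s" unfolding z co(2)
      by Groebner_Basis.algebra
  have R: "z 2 * z 3 * z 4 * z 5 = r" unfolding z co(1) by simp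
  note nq = normal_form_quotients[OF two y1 y2 z5, unfolded P Q R]
  have a: "quartic_inv 6 s r = 36864 * x" unfolding s r_def by Groebner_Basis.algebra
  define D' where "D' = e^2*(e-2) + 4*e*x - 2*x^2"
  define N' where "N' = e^2*(25*e+4)^2 - 8*e*(295*e+4)*x + 16*(1+256*e)*x^2"
  have s4: "s^4 = (s^2)^2" by simp
  have D: "quartic_disc 6 s r = 226492416 * D'"
    unfolding s4 s r_def D'_def by Groebner_Basis.algebra
  have N: "quartic_res 6 s r
     = 21743271936 * N'"
    unfolding s4 s r_def N'_def by Groebner_Basis.algebra
  have D6: "25 * D' = 6 * d * x^2"
    unfolding D'_def using w xw unfolding E_def by Groebner_Basis.algebra
  have N6: "q * N' = 6 * x^3"
    unfolding N'_def using cw xw unfolding c_def by Groebner_Basis.algebra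
  \<comment> \<open>Prime factorizations of \<open>36864\<close>, \<open>226492416\<close>,
    \<open>21743271936\<close> and \<open>6\<close>: only 2 and 3 occur.\<close>
  have "2^12 * 3^2 \<noteq> (0::'a)" "2^23 * 3^3 \<noteq> (0::'a)" "2^28 * 3^4 \<noteq> (0::'a)" "2 * 3 \<noteq> (0::'a)"
    by (intro no_zero_divisors power_not_zero two three)+
  then have nz: "(36864::'a) \<noteq> 0" "(226492416::'a) \<noteq> 0" "(21743271936::'a) \<noteq> 0" "(6::'a) \<noteq> 0"
    by simp_all
  have N0: "N' \<noteq> 0" and D0: "D' \<noteq> 0" using N6 D6 x0 nz d n25 by auto
  note nq = nq[unfolded a, unfolded D N]
  have "delta5 y = 25 * (226492416 * D') / (36864 * x)^2" using nq(1) by simp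
  also have "25 * (226492416 * D') = d * (36864 * x)^2" using D6 by Groebner_Basis.algebra
  also have "d * (36864 * x)^2 / (36864 * x)^2 = d"
    by (intro nonzero_mult_div_cancel_right power_not_zero no_zero_divisors nz x0)
  finally have dd: "delta5 y = d" .
  have "q5 y = (36864 * x)^3 / (64 * 6 * (21743271936 * N'))" using nq(2) by simp
  also have "(36864 * x)^3 = q * (64 * 6 * (21743271936 * N'))" using N6 by Groebner_Basis.algebra
  also have "q * (64 * 6 * (21743271936 * N')) / (64 * 6 * (21743271936 * N')) = q"
    by (intro nonzero_mult_div_cancel_right no_zero_divisors nz N0 two_powers_nonzero[OF two])
  finally have qq: "q5 y = q" .
  show ?thesis
    by (rule that[OF _ _ _ dd qq]) (simp_all only: nq(4-6) mult_eq_0_iff nz x0 N0 D0 simp_thms)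
qed

text \<open>The last factor is a multiple of \<open>rootU y 1 - rootU y 2\<close> with denominators cleared.\<close>

definition good5 :: "(nat \<Rightarrow> 'a::comm_ring_1) \<Rightarrow> 'a" where
  "good5 y = disc5 y * inv4 y * inv12 y *
     (covT y * covS (at_point 2 y) ^ 2 - covT (at_point 2 y) * covS y ^ 2)"

lemma good5D:
  fixes y :: "nat \<Rightarrow> 'a::field"
  assumes "good5 y \<noteq> 0" "(5::'a) \<noteq> 0"
  shows "disc5 y \<noteq> 0" "inv4 y \<noteq> 0" "inv12 y \<noteq> 0" "rootU y 1 \<noteq> rootU y 2"
proof -
  show *: "disc5 y \<noteq> 0" "inv4 y \<noteq> 0" "inv12 y \<noteq> 0" using assms by (auto simp: good5_def)
  have at1: "at_point 1 y = y" by (simp add: at_point_def)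
  have n25: "(25::'a) \<noteq> 0" using power_not_zero[OF assms(2), of 2] by simp
  have S: "covS y \<noteq> 0" "covS (at_point 2 y) \<noteq> 0"
    using *(3) by (auto simp: inv12_expand at1)
  show "rootU y 1 \<noteq> rootU y 2"
    unfolding rootU_def at1 covU_def using assms S n25 by (auto simp: good5_def field_simps)
qed

text \<open>On the symmetric family \<open>0, 1, -1, a, -a\<close> the polynomial
  \<open>good5\<close> factors into explicit polynomials in \<open>a\<close>. None of them vanishes
  identically outside characteristics 2 and 3, so an infinite \<open>K\<close> contains a suitable
  \<open>a\<close>.\<close>

lemma exists_good5:
  fixes K :: "'a::field set"
  assumes inf: "infinite K" and two: "(2::'a) \<noteq> 0" and three: "(3::'a) \<noteq> 0"
  obtains a where "a \<in> K" "good5 (\<lambda>j. if j = 1 then 0 else if j = 2 then 1 else if j = 3 then - 1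
      else if j = 4 then a else - a) \<noteq> 0"
proof -
  define y where "y a = (\<lambda>j::nat. if j = 1 then 0 else if j = 2 then 1 else if j = 3 then - 1
      else if j = 4 then a else - (a::'a))" for a
  have sq: "sqd (y a) 1 2 = 1" "sqd (y a) 1 3 = 1" "sqd (y a) 1 4 = a^2" "sqd (y a) 1 5 = a^2"
     "sqd (y a) 2 3 = 4" "sqd (y a) 2 4 = (1-a)^2" "sqd (y a) 2 5 = (1+a)^2" "sqd (y a) 3 4 = (1+a)^2"
     "sqd (y a) 3 5 = (1-a)^2" "sqd (y a) 4 5 = 4 * a^2" for a
    by (simp_all add: sqd_def y_def power2_eq_square algebra_simps)
  note at = at_point_def sqd_comp_transpose transpose_def sqd_swap sq
  have "disc5 (y a) = 16 * a^6 * (1 - a^2)^4" for a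
    unfolding disc5_def sq by Groebner_Basis.algebra
  moreover have "inv4 (y a) = 4 * a^2 * (1 + a^2) * (3 + 26*a^2 + 3*a^4)" for a
    by (simp add: inv4_def sq) Groebner_Basis.algebra
  moreover have S1: "covS (y a) = 8*a^2 + 8*a^4" for a
    unfolding covS_def sq by Groebner_Basis.algebra
  moreover have S2: "covS (at_point 2 (y a)) = 3 + 34*a^2 + 11*a^4" for a
    by (simp add: covS_def at) Groebner_Basis.algebra
  moreover have S3: "covS (at_point 3 (y a)) = 3 + 34*a^2 + 11*a^4" for a
    by (simp add: covS_def at) Groebner_Basis.algebra
  moreover have S4: "covS (at_point 4 (y a)) = 11*a^2 + 34*a^4 + 3*a^6" for a
    by (simp add: covS_def at) Groebner_Basis.algebra
  moreover have S5: "covS (at_point 5 (y a)) = 11*a^2 + 34*a^4 + 3*a^6" for a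
    by (simp add: covS_def at) Groebner_Basis.algebra
  moreover have "covT (y a) * covS (at_point 2 (y a)) ^ 2 - covT (at_point 2 (y a)) * covS (y a) ^ 2
     = 18*a^4 - 876*a^6 + 7662*a^8 + 39192*a^10 + 24654*a^12 + 3348*a^14 - 270*a^16" for a
    unfolding S1 S2 by (simp add: covT_def at) Groebner_Basis.algebra
  moreover have "at_point 1 (y a) = y a" for a by (simp add: at_point_def)
  ultimately have g: "good5 (y a) = (16 * a^6 * (1 - a^2)^4) * (4 * a^2 * (1 + a^2) * (3 + 26*a^2 + 3*a^4)) *
     ((8*a^2 + 8*a^4) * (3 + 34*a^2 + 11*a^4) * (3 + 34*a^2 + 11*a^4) * (11*a^2 + 34*a^4 + 3*a^6) * (11*a^2 + 34*a^4
         + 3*a^6))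
     * (18*a^4 - 876*a^6 + 7662*a^8 + 39192*a^10 + 24654*a^12 + 3348*a^14 - 270*a^16)" for a
    by (simp add: good5_def inv12_expand)
  define H where "H = [:0,1:] * [:1,0,-1:] * [:1,0,1:] * [:3,0,26,0,3:] * [:3,0,34,0,11:] *
    [:0,0,11,0,34,0,3:] * [:0, 0, 0, 0, 18, 0, -876, 0, 7662, 0, 39192, 0, 24654, 0, 3348, 0, -270::'a:]"
  \<comment> \<open>The lowest coefficient of the last factor of \<open>H\<close>; every other
    factor has a coefficient 1 or 3.\<close>
  have "(18::'a) \<noteq> 0"
  proof -
    have "(18::'a) = 2 * 3^2" by simp
    then show ?thesis using two three by (simp only: mult_eq_0_iff power_eq_0_iff) simp
  qed
  then have "H \<noteq> 0" unfolding H_def using three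
    by (intro no_zero_divisors) simp_all
  then have "finite {a. poly H a = 0}" by (rule poly_roots_finite)
  then obtain a where a: "a \<in> K" "poly H a \<noteq> 0"
    using inf by (metis (mono_tags, lifting) finite_subset mem_Collect_eq subsetI)
  have ev0: "poly [:0,1:] a = a"
    by simp
  have ev1: "poly [:1,0,-1:] a = 1 - a^2"
    unfolding poly_pCons poly_0 by Groebner_Basis.algebra
  have ev2: "poly [:1,0,1:] a = 1 + a^2"
    unfolding poly_pCons poly_0 by Groebner_Basis.algebra
  have ev3: "poly [:3,0,26,0,3:] a = 3 + 26*a^2 + 3*a^4"
    unfolding poly_pCons poly_0 by Groebner_Basis.algebra
  have ev4: "poly [:3,0,34,0,11:] a = 3 + 34*a^2 + 11*a^4"
    unfolding poly_pCons poly_0 by Groebner_Basis.algebra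
  have ev5: "poly [:0,0,11,0,34,0,3:] a = 11*a^2 + 34*a^4 + 3*a^6"
    unfolding poly_pCons poly_0 by Groebner_Basis.algebra
  have ev6: "poly [:0, 0, 0, 0, 18, 0, -876, 0, 7662, 0, 39192, 0, 24654, 0, 3348, 0, -270::'a:] a = 18*a^4 - 876*a^6
      + 7662*a^8 + 39192*a^10 + 24654*a^12 + 3348*a^14 - 270*a^16"
    unfolding poly_pCons poly_0 by Groebner_Basis.algebra
  note ev = ev0 ev1 ev2 ev3 ev4 ev5 ev6
  note nz = a(2)[unfolded H_def poly_mult ev mult_eq_0_iff de_Morgan_disj]
  have e: "8*a^2 + 8*a^4 = 8 * a^2 * (1 + a^2)" by Groebner_Basis.algebra
  have "good5 (y a) \<noteq> 0"
    unfolding g e by (intro no_zero_divisors power_not_zero) (use nz two_powers_nonzero[OF two] in blast)+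
  then show ?thesis using that a(1) unfolding y_def by blast
qed

section \<open>From \<open>P\<close> to \<open>F\<close>\<close>

lemma poly_F_poly:
  fixes A M :: "'a::field"
  assumes "A \<noteq> 0" "M \<noteq> 0" "(2::'a) \<noteq> 0"
  shows "27 * poly (F_poly A D M) z = 32 * M^2 * poly (P_poly (25 * D / A^2) (A^3 / (8 * M))) (3 * z + 1)"
proof -
  have n8: "(8::'a) \<noteq> 0" using two_powers_nonzero[OF assms(3)] by simp
  define d where "d = D / A^2"
  define k where "k = 1 / (8 * M)"
  have D: "D = d * A^2" and k: "8 * M * k = 1" and e: "25 * D / A^2 = 25 * d" "A^3 / (8 * M) = A^3 * k"
    using assms n8 by (simp_all add: d_def k_def)
  have "4 * (27 * poly (F_poly A D M) z - 32 * M^2 * poly (P_poly (25 * d) (A^3 * k)) (3 * z + 1)) = 0"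
    unfolding poly_P_poly D F_poly_def Let_def poly_pCons poly_0
    using k by Groebner_Basis.algebra
  then show ?thesis using two_powers_nonzero(1)[OF assms(3)] unfolding e
    by (simp only: mult_eq_0_iff right_minus_eq) blast
qed

lemma degree_F_poly:
  fixes M :: "'a::field"
  assumes "M \<noteq> 0" "(2::'a) \<noteq> 0" "(3::'a) \<noteq> 0"
  shows "degree (F_poly A D M) = 5"
proof -
  have "(288::'a) = 2^5 * 3^2" by simp
  then have "288 * M^2 \<noteq> 0" using assms by (simp only: mult_eq_0_iff power_eq_0_iff) simp
  then show ?thesis unfolding F_poly_def Let_def by (simp add: numeral_eq_Suc)
qed

subsection \<open>Evaluation and specialization of rational functions\<close>

definition const_hom :: "('k::comm_ring_1 \<Rightarrow> 'a::comm_ring_1) \<Rightarrow> bool" where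
  "const_hom \<iota> \<longleftrightarrow> \<iota> 0 = 0 \<and> \<iota> 1 = 1 \<and> (\<forall>x y. \<iota> (x + y) = \<iota> x + \<iota> y \<and> \<iota> (x * y) = \<iota> x * \<iota> y)"

lemma sum_single: "(\<Sum>m\<in>Poly_Mapping.keys c. Poly_Mapping.single m (Poly_Mapping.lookup c m)) = c"
proof (rule poly_mapping_eqI)
  fix k
  show "Poly_Mapping.lookup (\<Sum>m\<in>Poly_Mapping.keys c. Poly_Mapping.single m (Poly_Mapping.lookup c m)) k
    = Poly_Mapping.lookup c k"
    unfolding lookup_sum lookup_single
    by (simp add: when_def in_keys_iff)
qed

context
  fixes \<iota> :: "'k::comm_ring_1 \<Rightarrow> 'a::comm_ring_1" and \<tau> :: "'v::finite \<Rightarrow> 'a"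
  assumes \<iota>: "const_hom \<iota>"
begin

lemma \<iota>_simps: "\<iota> 0 = 0" "\<iota> 1 = 1" "\<iota> (x + y) = \<iota> x + \<iota> y" "\<iota> (x * y) = \<iota> x * \<iota> y"
  using \<iota> by (auto simp: const_hom_def)

text \<open>Cancellation can shrink the support of a sum, so evaluations are compared over a common
  finite index set.\<close>

lemma eval_multipoly_superset:
  assumes "finite S" "Poly_Mapping.keys c \<subseteq> S"
  shows "eval_multipoly \<iota> \<tau> c = (\<Sum>m\<in>S. \<iota> (Poly_Mapping.lookup c m) * (\<Prod>v\<in>UNIV. \<tau> v ^ Poly_Mapping.lookup m v))"
  unfolding eval_multipoly_def using assms
  by (intro sum.mono_neutral_left) (auto simp: in_keys_iff \<iota>_simps)

lemma eval_multipoly_0 [simp]: "eval_multipoly \<iota> \<tau> 0 = 0"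
  by (simp add: eval_multipoly_def)

lemma eval_multipoly_single:
  "eval_multipoly \<iota> \<tau> (Poly_Mapping.single m a) = \<iota> a * (\<Prod>v\<in>UNIV. \<tau> v ^ Poly_Mapping.lookup m v)"
  by (subst eval_multipoly_superset[of "{m}"]) auto

lemma eval_multipoly_add: "eval_multipoly \<iota> \<tau> (c + d) = eval_multipoly \<iota> \<tau> c + eval_multipoly \<iota> \<tau> d"
proof -
  let ?S = "Poly_Mapping.keys c \<union> Poly_Mapping.keys d"
  have "Poly_Mapping.keys (c + d) \<subseteq> ?S" by (rule Poly_Mapping.keys_add)
  then show ?thesis
    by (simp add: eval_multipoly_superset[of ?S] lookup_add \<iota>_simps algebra_simps sum.distrib)
qed

lemma eval_multipoly_sum: "eval_multipoly \<iota> \<tau> (sum f S) = (\<Sum>i\<in>S. eval_multipoly \<iota> \<tau> (f i))"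
  by (induction S rule: infinite_finite_induct) (auto simp: eval_multipoly_add)

lemma eval_multipoly_mult: "eval_multipoly \<iota> \<tau> (c * d) = eval_multipoly \<iota> \<tau> c * eval_multipoly \<iota> \<tau> d"
proof -
  have 1: "eval_multipoly \<iota> \<tau> (Poly_Mapping.single m a * Poly_Mapping.single n b) =
      eval_multipoly \<iota> \<tau> (Poly_Mapping.single m a) * eval_multipoly \<iota> \<tau> (Poly_Mapping.single n b)" for m n a b
    by (simp add: mult_single eval_multipoly_single \<iota>_simps lookup_add power_add prod.distrib mult_ac)
  have "c * d = (\<Sum>m\<in>Poly_Mapping.keys c. \<Sum>n\<in>Poly_Mapping.keys d.
     Poly_Mapping.single m (Poly_Mapping.lookup c m) * Poly_Mapping.single n (Poly_Mapping.lookup d n))"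
    by (simp add: sum_single flip: sum_distrib_left sum_distrib_right)
  then have "eval_multipoly \<iota> \<tau> (c * d) = (\<Sum>m\<in>Poly_Mapping.keys c. \<Sum>n\<in>Poly_Mapping.keys d.
     eval_multipoly \<iota> \<tau> (Poly_Mapping.single m (Poly_Mapping.lookup c m)) * eval_multipoly \<iota> \<tau> (Poly_Mapping.single n
         (Poly_Mapping.lookup d n)))"
    by (simp only: eval_multipoly_sum 1)
  also have "\<dots> = eval_multipoly \<iota> \<tau> c * eval_multipoly \<iota> \<tau> d"
    by (simp add: sum_single flip: sum_distrib_left sum_distrib_right eval_multipoly_sum)
  finally show ?thesis .
qed

lemma eval_multipoly_1 [simp]: "eval_multipoly \<iota> \<tau> 1 = 1"
  using eval_multipoly_single[of 0 1] by (simp add: \<iota>_simps)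

lemma eval_multipoly_uminus: "eval_multipoly \<iota> \<tau> (- c) = - eval_multipoly \<iota> \<tau> c"
  using eval_multipoly_add[of c "- c"] by (simp add: eq_neg_iff_add_eq_0 add.commute)

lemma eval_multipoly_const: "eval_multipoly \<iota> \<tau> (Poly_Mapping.single 0 a) = \<iota> a"
  by (simp add: eval_multipoly_single)

lemma eval_multipoly_indet: "eval_multipoly \<iota> \<tau> (Poly_Mapping.single (Poly_Mapping.single v 1) 1) = \<tau> v"
proof -
  have "(\<Prod>u\<in>UNIV. \<tau> u ^ Poly_Mapping.lookup (Poly_Mapping.single v 1) u) = (\<Prod>u\<in>UNIV. if u = v then \<tau> v else 1)"
    by (intro prod.cong) (auto simp: lookup_single when_def)
  then show ?thesis by (simp add: eval_multipoly_single \<iota>_simps)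
qed

end

text \<open>A rational function is related to a value only if it has a denominator not vanishing at \<open>\<tau>\<close>.\<close>

definition specialization :: "('k::idom \<Rightarrow> 'a::field) \<Rightarrow> ('v::{finite,linorder} \<Rightarrow> 'a) \<Rightarrow> 
    (('k, 'v) ratfun \<times> 'a) set" where
  "specialization \<iota> \<tau> = {(r, x). ratfun_specializes \<iota> \<tau> r x}"

lemma specializes_to_iff: "specializes_to \<iota> \<tau> Q f \<longleftrightarrow> poly_rel (specialization \<iota> \<tau>) Q f"
  by (simp add: specializes_to_def poly_rel_def specialization_def)

lemma specializationI:
  "eval_multipoly \<iota> \<tau> d \<noteq> 0 \<Longrightarrow> (Fract c d, eval_multipoly \<iota> \<tau> c / eval_multipoly \<iota> \<tau> d) \<in> specialization \<iota> \<tau>"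
  by (auto simp: specialization_def ratfun_specializes_def)

definition const_ratfun :: "'k \<Rightarrow> ('k::idom, 'v::{finite,linorder}) ratfun" where
  "const_ratfun a = Fract (Poly_Mapping.single 0 a) 1"

context
  fixes \<iota> :: "'k::idom \<Rightarrow> 'a::field" and \<tau> :: "'v::{finite,linorder} \<Rightarrow> 'a"
  assumes \<iota>: "const_hom \<iota>"
begin

lemma eval_nonzero: "eval_multipoly \<iota> \<tau> d \<noteq> 0 \<Longrightarrow> d \<noteq> 0"
  using eval_multipoly_0[OF \<iota>] by auto

lemma specializationE:
  assumes "(r, x) \<in> specialization \<iota> \<tau>"
  obtains c d where "eval_multipoly \<iota> \<tau> d \<noteq> 0" "d \<noteq> 0" "r = Fract c d" "x = eval_multipoly \<iota> \<tau> c / eval_multipoly \<iota> \<tau>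
      d"
  using assms eval_nonzero by (auto simp: specialization_def ratfun_specializes_def)

lemma specialization_ring_rel: "ring_relation (specialization \<iota> \<tau>)"
  unfolding ring_relation_def
proof (intro conjI allI impI)
  note ev = eval_multipoly_0[OF \<iota>] eval_multipoly_1[OF \<iota>] eval_multipoly_add[OF \<iota>] eval_multipoly_mult[OF \<iota>]
      eval_multipoly_uminus[OF \<iota>]
  show "(0, 0) \<in> specialization \<iota> \<tau>"
    using specializationI[of \<iota> \<tau> 1 0] by (simp add: ev Zero_fract_def)
  show "(1, 1) \<in> specialization \<iota> \<tau>"
    using specializationI[of \<iota> \<tau> 1 1] by (simp add: ev One_fract_def)
  fix r x s y assume rx: "(r, x) \<in> specialization \<iota> \<tau>"
  from rx obtain c d where c: "eval_multipoly \<iota> \<tau> d \<noteq> 0" "d \<noteq> 0" "r = Fract c d" "x = eval_multipoly \<iota> \<tau> c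
      / eval_multipoly \<iota> \<tau> d"
    by (rule specializationE)
  show "(- r, - x) \<in> specialization \<iota> \<tau>"
    using specializationI[OF c(1), of "- c"] by (simp add: ev c)
  assume sy: "(s, y) \<in> specialization \<iota> \<tau>"
  from sy obtain c' d' where c': "eval_multipoly \<iota> \<tau> d' \<noteq> 0" "d' \<noteq> 0" "s = Fract c' d'" "y = eval_multipoly \<iota> \<tau> c'
      / eval_multipoly \<iota> \<tau> d'"
    by (rule specializationE)
  have dd: "eval_multipoly \<iota> \<tau> (d * d') \<noteq> 0" using c c' by (simp add: ev)
  show "(r + s, x + y) \<in> specialization \<iota> \<tau>"
    using specializationI[OF dd, of "c * d' + c' * d"] c c' by (simp add: ev add_frac_eq)
  show "(r * s, x * y) \<in> specialization \<iota> \<tau>"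
    using specializationI[OF dd, of "c * c'"] c c' by (simp add: ev)
qed

interpretation S: ring_relation "specialization \<iota> \<tau>"
  by (rule specialization_ring_rel)

lemma specialization_zero: "(0, x) \<in> specialization \<iota> \<tau> \<Longrightarrow> x = 0"
proof -
  assume "(0, x) \<in> specialization \<iota> \<tau>"
  then obtain c d where "d \<noteq> 0" "0 = Fract c d" "x = eval_multipoly \<iota> \<tau> c / eval_multipoly \<iota> \<tau> d"
    by (rule specializationE)
  moreover then have "c = 0" by (auto simp: Zero_fract_def eq_fract)
  ultimately show ?thesis by (simp add: eval_multipoly_0[OF \<iota>])
qed

lemma specialization_unique: "(r, x) \<in> specialization \<iota> \<tau> \<Longrightarrow> (r, y) \<in> specialization \<iota> \<tau> \<Longrightarrow> x = y"
  using S.diff[of r x r y] specialization_zero by fastforce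

lemma specialization_inverse:
  "(r, x) \<in> specialization \<iota> \<tau> \<Longrightarrow> x \<noteq> 0 \<Longrightarrow> (inverse r, inverse x) \<in> specialization \<iota> \<tau>"
proof -
  assume "(r, x) \<in> specialization \<iota> \<tau>" "x \<noteq> 0"
  then obtain c d where "eval_multipoly \<iota> \<tau> d \<noteq> 0" "r = Fract c d" "x = eval_multipoly \<iota> \<tau> c / eval_multipoly \<iota> \<tau> d"
    using specializationE by metis
  then show ?thesis using specializationI[of \<iota> \<tau> c d] \<open>x \<noteq> 0\<close> by auto
qed

lemma specialization_divide:
  "(r, x) \<in> specialization \<iota> \<tau> \<Longrightarrow> (s, y) \<in> specialization \<iota> \<tau> \<Longrightarrow> y \<noteq> 0 \<Longrightarrow> (r / s, x / y) \<in> specialization \<iota> \<tau>"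
  unfolding divide_inverse by (intro S.mult specialization_inverse)

lemma specialization_const: "(const_ratfun a, \<iota> a) \<in> specialization \<iota> \<tau>"
  using specializationI[of \<iota> \<tau> 1 "Poly_Mapping.single 0 a"]
  by (simp add: eval_multipoly_1[OF \<iota>] eval_multipoly_const[OF \<iota>] const_ratfun_def)

lemma specialization_indet: "(indet v, \<tau> v) \<in> specialization \<iota> \<tau>"
  using specializationI[of \<iota> \<tau> 1 "Poly_Mapping.single (Poly_Mapping.single v 1) 1"]
  by (simp add: eval_multipoly_1[OF \<iota>] eval_multipoly_indet[OF \<iota>] indet_def)

end

section \<open>Algebraic independence and homomorphisms of rational function fields\<close>

lemma (in ring_relation) eval_multipoly_rel:
  assumes "\<And>a. (\<kappa> a, \<iota> a) \<in> R" "\<And>v. (t v, \<eta> v) \<in> R"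
  shows "(eval_multipoly \<kappa> t c, eval_multipoly \<iota> \<eta> c) \<in> R"
  unfolding eval_multipoly_def by (intro sum mult prod power assms)

definition alg_indep :: "('k::comm_ring_1 \<Rightarrow> 'a::comm_ring_1) \<Rightarrow> ('v::finite \<Rightarrow> 'a) \<Rightarrow> bool" where
  "alg_indep \<iota> \<tau> \<longleftrightarrow> (\<forall>c. eval_multipoly \<iota> \<tau> c = 0 \<longrightarrow> c = 0)"

text \<open>A relation among the \<open>t v\<close> would specialize to the same relation among the
  \<open>\<eta> v\<close>. Thus independence can be checked at any specialization, which is how
  independence of invariants is proved below.\<close>

lemma alg_indep_specialize:
  fixes t :: "'v::finite \<Rightarrow> ('k::idom, 'w::{finite,linorder}) ratfun"
  assumes \<iota>: "const_hom \<iota>" and t: "\<And>v. (t v, \<eta> v) \<in> specialization \<iota> \<xi>" and \<eta>: "alg_indep \<iota> \<eta>"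
  shows "alg_indep const_ratfun t"
  unfolding alg_indep_def
proof (intro allI impI)
  fix c assume c: "eval_multipoly const_ratfun t c = 0"
  interpret S: ring_relation "specialization \<iota> \<xi>"
    by (rule specialization_ring_rel[OF \<iota>])
  have "(0, eval_multipoly \<iota> \<eta> c) \<in> specialization \<iota> \<xi>"
    unfolding c[symmetric] by (intro S.eval_multipoly_rel specialization_const \<iota> t)
  then show "c = 0" using specialization_zero[OF \<iota>] \<eta> by (auto simp: alg_indep_def)
qed

text \<open>At algebraically independent values no nonzero denominator vanishes, so specialization
  is defined everywhere and is a homomorphism.\<close>

lemma ratfun_hom:
  fixes \<tau> :: "'v::{finite,linorder} \<Rightarrow> 'a::field" and \<iota> :: "'k::idom \<Rightarrow> 'a"
  assumes \<iota>: "const_hom \<iota>" and ind: "alg_indep \<iota> \<tau>"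
  shows "\<exists>h. h 1 = 1 \<and> (\<forall>r s. h (r + s) = h r + h s \<and> h (r * s) = h r * h s) \<and>
    (\<forall>r. (r, h r) \<in> specialization \<iota> \<tau>)"
proof -
  interpret S: ring_relation "specialization \<iota> \<tau>"
    by (rule specialization_ring_rel[OF \<iota>])
  have "\<exists>x. (r, x) \<in> specialization \<iota> \<tau>" for r
  proof (cases r)
    case (Fract c d)
    then have "eval_multipoly \<iota> \<tau> d \<noteq> 0" using ind by (auto simp: alg_indep_def)
    then show ?thesis using specializationI Fract(1) by blast
  qed
  then obtain h where h: "\<And>r. (r, h r) \<in> specialization \<iota> \<tau>" by metis
  note u = specialization_unique[OF \<iota>]
  have "h 1 = 1" by (rule u[OF h S.one])
  moreover have "h (r + s) = h r + h s" "h (r * s) = h r * h s" for r s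
    by (rule u[OF h S.add[OF h h]], rule u[OF h S.mult[OF h h]])
  ultimately show ?thesis using h by blast
qed

lemma eval_monomials:
  fixes h :: "'k::comm_ring_1 \<Rightarrow> 'b::comm_ring_1" and c :: "('k, 'v::finite) multipoly"
  shows "eval_multipoly (\<lambda>a. Poly_Mapping.single 0 (h a)) (\<lambda>v. Poly_Mapping.single (Poly_Mapping.single v 1) 1) c
    = (\<Sum>m\<in>Poly_Mapping.keys c. Poly_Mapping.single m (h (Poly_Mapping.lookup c m)))"
  unfolding eval_multipoly_def
proof (rule sum.cong[OF refl])
  fix m :: "'v \<Rightarrow>\<^sub>0 nat"
  have pow: "Poly_Mapping.single (Poly_Mapping.single v 1) (1::'b) ^ n = Poly_Mapping.single (Poly_Mapping.single v n)
      1" for v :: 'v and n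
  proof (induction n)
    case (Suc n)
    then show ?case by (simp add: mult_single plus_1_eq_Suc flip: single_add)
  qed simp
  have prod: "(\<Prod>v\<in>S. Poly_Mapping.single (g v) (1::'b)) = Poly_Mapping.single (\<Sum>v\<in>S. g v) 1"
    for S :: "'v set" and g :: "'v \<Rightarrow> 'v \<Rightarrow>\<^sub>0 nat"
    by (induction S rule: infinite_finite_induct) (auto simp: mult_single)
  have "(\<Sum>v\<in>UNIV. Poly_Mapping.single v (Poly_Mapping.lookup m v)) = m"
    by (rule poly_mapping_eqI) (simp add: lookup_sum lookup_single when_def)
  then show "Poly_Mapping.single 0 (h (Poly_Mapping.lookup c m)) *
      (\<Prod>v\<in>UNIV. Poly_Mapping.single (Poly_Mapping.single v 1) 1 ^ Poly_Mapping.lookup m v)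
    = Poly_Mapping.single m (h (Poly_Mapping.lookup c m))"
    by (simp add: pow prod mult_single)
qed

lemma eval_indet:
  fixes c :: "('k::idom, 'v::{finite,linorder}) multipoly"
  shows "eval_multipoly const_ratfun indet c = Fract c 1"
proof -
  let ?R = "range (\<lambda>c :: ('k, 'v) multipoly. (c, Fract c 1))"
  have mem: "(a, b) \<in> ?R \<longleftrightarrow> b = Fract a 1" for a b by auto
  interpret R: ring_relation ?R
    by (unfold ring_relation_def mem, auto simp: Zero_fract_def One_fract_def)
  have "(eval_multipoly (\<lambda>a. Poly_Mapping.single 0 a) (\<lambda>v. Poly_Mapping.single (Poly_Mapping.single v 1) 1) c,
      eval_multipoly const_ratfun indet c) \<in> ?R"
    by (rule R.eval_multipoly_rel) (auto simp: const_ratfun_def indet_def)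
  then show ?thesis using eval_monomials[of "\<lambda>a. a" c] by (simp add: mem sum_single)
qed

lemma const_hom_const_ratfun: "const_hom const_ratfun"
  by (auto simp: const_hom_def const_ratfun_def Zero_fract_def One_fract_def single_add mult_single)

lemma const_ratfun_field_rel: "field_relation (range (\<lambda>x :: 'k::field. (x, const_ratfun x)))"
  by (rule hom_field_rel)
    (simp_all add: const_ratfun_def One_fract_def single_add mult_single)

lemma alg_indep_indet: "alg_indep const_ratfun indet"
  by (auto simp: alg_indep_def eval_indet Zero_fract_def eq_fract)

lemma alg_indep_hom:
  fixes h :: "'a::field \<Rightarrow> 'b::field"
  assumes h: "h 1 = 1" "\<And>x y. h (x + y) = h x + h y" "\<And>x y. h (x * y) = h x * h y"
    and ind: "alg_indep \<iota> \<tau>"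
  shows "alg_indep (h \<circ> \<iota>) (h \<circ> \<tau>)"
  unfolding alg_indep_def
proof (intro allI impI)
  fix c assume c: "eval_multipoly (h \<circ> \<iota>) (h \<circ> \<tau>) c = 0"
  interpret H: field_relation "fun_graph h"
    by (rule hom_field_rel[OF h])
  have "(eval_multipoly \<iota> \<tau> c, 0) \<in> fun_graph h"
    unfolding c[symmetric] by (rule H.eval_multipoly_rel) auto
  then have "eval_multipoly \<iota> \<tau> c = 0" by (rule H.zero_left)
  then show "c = 0" using ind by (simp add: alg_indep_def)
qed

lemma permute_hom:
  fixes p :: "'v::{finite,linorder} \<Rightarrow> 'v"
  assumes "bij p"
  shows "\<exists>s :: ('k::idom, 'v) ratfun \<Rightarrow> ('k, 'v) ratfun. s 1 = 1 \<and>
    (\<forall>x y. s (x + y) = s x + s y \<and> s (x * y) = s x * s y) \<and>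
    (\<forall>a. s (const_ratfun a) = const_ratfun a) \<and> (\<forall>v. s (indet v) = indet (p v))"
proof -
  note \<kappa> = const_hom_const_ratfun
  have "alg_indep const_ratfun (\<lambda>v. indet (p v) :: ('k, 'v) ratfun)"
  proof (rule alg_indep_specialize[OF \<kappa>])
    \<comment> \<open>Substituting along the inverse permutation sends the permuted indeterminates
      back to the original ones, whose independence is known.\<close>
    show "(indet (p v), indet v :: ('k, 'v) ratfun) \<in> specialization const_ratfun (\<lambda>v. indet (inv_into UNIV p v))"
        for v
      using specialization_indet[OF \<kappa>, of "p v" "\<lambda>v. indet (inv_into UNIV p v)"] assms
      by (simp add: bij_is_inj inv_f_f)
    show "alg_indep const_ratfun (indet :: 'v \<Rightarrow> ('k, 'v) ratfun)" by (rule alg_indep_indet)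
  qed
  from ratfun_hom[OF \<kappa> this] obtain s where s: "s 1 = 1" "\<forall>r t. s (r + t) = s r + s t \<and> s (r * t) = s r * s t"
    and sp: "\<And>r. (r, s r) \<in> specialization const_ratfun (\<lambda>v. indet (p v) :: ('k, 'v) ratfun)" by blast
  have "s (const_ratfun a) = const_ratfun a" for a
    by (rule specialization_unique[OF \<kappa> sp specialization_const[OF \<kappa>]])
  moreover have "s (indet v) = indet (p v)" for v
    by (rule specialization_unique[OF \<kappa> sp specialization_indet[OF \<kappa>]])
  ultimately show ?thesis using s by blast
qed

subsection \<open>Reduction modulo a prime\<close>

definition reduction :: "((rat, 'v::{finite,linorder}) ratfun \<times> ('p::prime_card mod_ring, 'v) ratfun) set" where
  "reduction = {(r, s). ratfun_reduces r s}"

lemma reduces_to_iff: "reduces_to Q R \<longleftrightarrow> poly_rel reduction Q R"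
  by (simp add: reduces_to_def poly_rel_def reduction_def)

text \<open>Writing the coefficientwise map as an evaluation at the indeterminates lets its ring
  laws be inherited from those of \<open>eval_multipoly\<close>.\<close>

lemma map_of_int_eval:
  fixes c :: "(int, 'v::finite) multipoly"
  shows "(Poly_Mapping.map of_int c :: ('k::comm_ring_1, 'v) multipoly) =
    eval_multipoly (\<lambda>a. Poly_Mapping.single 0 (of_int a)) (\<lambda>v. Poly_Mapping.single (Poly_Mapping.single v 1) 1) c"
  unfolding eval_monomials[of of_int c]
  by (rule poly_mapping_eqI) (auto simp: lookup_sum lookup_single Poly_Mapping.map.rep_eq when_def in_keys_iff)

lemma const_hom_of_int: "const_hom (\<lambda>a. Poly_Mapping.single (0 :: 'v \<Rightarrow>\<^sub>0 nat) (of_int a :: 'k::comm_ring_1))"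
  by (auto simp: const_hom_def single_add mult_single)

lemma map_of_int_simps:
  fixes c d :: "(int, 'v::finite) multipoly"
  shows "(Poly_Mapping.map of_int 0 :: ('k::comm_ring_1, 'v) multipoly) = 0"
    "(Poly_Mapping.map of_int (1 :: (int, 'v) multipoly) :: ('k, 'v) multipoly) = 1"
    "(Poly_Mapping.map of_int (c + d) :: ('k, 'v) multipoly) = Poly_Mapping.map of_int c + Poly_Mapping.map of_int d"
    "(Poly_Mapping.map of_int (c * d) :: ('k, 'v) multipoly) = Poly_Mapping.map of_int c * Poly_Mapping.map of_int d"
    "(Poly_Mapping.map of_int (- c) :: ('k, 'v) multipoly) = - Poly_Mapping.map of_int c"
  unfolding map_of_int_eval
  by (simp_all only: eval_multipoly_0[OF const_hom_of_int] eval_multipoly_1[OF const_hom_of_int]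
    eval_multipoly_add[OF const_hom_of_int] eval_multipoly_mult[OF const_hom_of_int]
    eval_multipoly_uminus[OF const_hom_of_int])

lemma reductionI:
  fixes a b :: "(int, 'v::{finite,linorder}) multipoly"
  assumes "(Poly_Mapping.map of_int b :: ('p::prime_card mod_ring, 'v) multipoly) \<noteq> 0"
    "r = Fract (Poly_Mapping.map of_int a) (Poly_Mapping.map of_int b)"
    "s = Fract (Poly_Mapping.map of_int a) (Poly_Mapping.map of_int b :: ('p mod_ring, 'v) multipoly)"
  shows "(r, s) \<in> reduction"
  using assms unfolding reduction_def ratfun_reduces_def by blast

lemma reductionE:
  fixes r :: "(rat, 'v::{finite,linorder}) ratfun" and s :: "('p::prime_card mod_ring, 'v) ratfun"
  assumes "(r, s) \<in> reduction"
  obtains a b :: "(int, 'v) multipoly" where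
    "(Poly_Mapping.map of_int b :: ('p mod_ring, 'v) multipoly) \<noteq> 0"
    "(Poly_Mapping.map of_int b :: (rat, 'v) multipoly) \<noteq> 0"
    "r = Fract (Poly_Mapping.map of_int a) (Poly_Mapping.map of_int b)"
    "s = Fract (Poly_Mapping.map of_int a) (Poly_Mapping.map of_int b)"
proof -
  from assms obtain a b :: "(int, 'v) multipoly" where ab:
    "(Poly_Mapping.map of_int b :: ('p mod_ring, 'v) multipoly) \<noteq> 0"
    "r = Fract (Poly_Mapping.map of_int a) (Poly_Mapping.map of_int b)"
    "s = Fract (Poly_Mapping.map of_int a) (Poly_Mapping.map of_int b)"
    unfolding reduction_def ratfun_reduces_def by blast
  have "b \<noteq> 0" using ab(1) map_of_int_simps(1) by auto
  then obtain k where "k \<in> Poly_Mapping.keys b" by (metis keys_eq_empty ex_in_conv)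
  then have "(Poly_Mapping.map of_int b :: (rat, 'v) multipoly) \<noteq> 0"
    by (auto simp: Poly_Mapping.map_eq_zero_iff in_keys_iff)
  then show ?thesis using that ab by blast
qed

lemma reduction_ring_rel: "ring_relation (reduction :: ((rat, 'v::{finite,linorder}) ratfun
    \<times> ('p::prime_card mod_ring, 'v) ratfun) set)"
  unfolding ring_relation_def
proof (intro conjI allI impI)
  let ?R = "reduction :: ((rat, 'v) ratfun \<times> ('p mod_ring, 'v) ratfun) set"
  show "(0, 0) \<in> ?R" by (rule reductionI[of 1 _ 0]) (simp_all add: map_of_int_simps Zero_fract_def)
  show "(1, 1) \<in> ?R" by (rule reductionI[of 1 _ 1]) (simp_all add: map_of_int_simps One_fract_def)
  fix r s x y assume rx: "(r, x) \<in> ?R"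
  from rx obtain a b :: "(int, 'v) multipoly" where ab: "(Poly_Mapping.map of_int b :: ('p mod_ring, 'v) multipoly)
      \<noteq> 0"
    "(Poly_Mapping.map of_int b :: (rat, 'v) multipoly) \<noteq> 0"
    "r = Fract (Poly_Mapping.map of_int a) (Poly_Mapping.map of_int b)"
    "x = Fract (Poly_Mapping.map of_int a) (Poly_Mapping.map of_int b)" by (rule reductionE)
  show "(- r, - x) \<in> ?R"
    by (rule reductionI[of b _ "- a"]) (simp_all add: ab map_of_int_simps)
  assume sy: "(s, y) \<in> ?R"
  from sy obtain c d :: "(int, 'v) multipoly" where cd: "(Poly_Mapping.map of_int d :: ('p mod_ring, 'v) multipoly)
      \<noteq> 0"
    "(Poly_Mapping.map of_int d :: (rat, 'v) multipoly) \<noteq> 0"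
    "s = Fract (Poly_Mapping.map of_int c) (Poly_Mapping.map of_int d)"
    "y = Fract (Poly_Mapping.map of_int c) (Poly_Mapping.map of_int d)" by (rule reductionE)
  show "(r + s, x + y) \<in> ?R"
    by (rule reductionI[of "b * d" _ "a * d + c * b"]) (simp_all add: ab cd map_of_int_simps)
  show "(r * s, x * y) \<in> ?R"
    by (rule reductionI[of "b * d" _ "a * c"]) (simp_all add: ab cd map_of_int_simps)
qed

lemma reduction_indet: "(indet v, indet v) \<in> reduction"
  by (rule reductionI[of 1 _ "Poly_Mapping.single (Poly_Mapping.single v 1) 1"])
    (simp_all add: map_of_int_simps indet_def)

lemma const_hom_of_rat: "const_hom (of_rat :: rat \<Rightarrow> 'a::field_char_0)"
  by (simp add: const_hom_def of_rat_add of_rat_mult)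

text \<open>Sums and products of representatives are reduced modulo \<open>CARD('p)\<close>, and
  multiples of that number vanish in \<open>'a\<close>.\<close>

lemma const_hom_of_mod_ring:
  assumes "CHAR('a::field) = CARD('p::prime_card)"
  shows "const_hom (of_mod_ring :: 'p mod_ring \<Rightarrow> 'a)"
proof -
  have z: "of_int (int CARD('p)) = (0 :: 'a)"
    using assms of_nat_CHAR[where 'a = 'a] by simp
  have m: "of_int (a mod int CARD('p)) = (of_int a :: 'a)" for a
  proof -
    have "(of_int a :: 'a) = of_int (int CARD('p) * (a div int CARD('p)) + a mod int CARD('p))" by simp
    also have "\<dots> = of_int (a mod int CARD('p))" unfolding of_int_add of_int_mult z by simp
    finally show ?thesis by simp
  qed
  show ?thesis unfolding const_hom_def of_mod_ring_def to_int_mod_ring_add to_int_mod_ring_mult m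
    by (simp add: to_int_mod_ring_hom.hom_one to_int_mod_ring_hom.hom_zero)
qed

subsection \<open>Equivariance of the invariants\<close>

context ring_relation begin

lemma sqd_rel: "\<forall>j\<in>{1..5}. (y j, y' j) \<in> R \<Longrightarrow> i \<in> {1..5} \<Longrightarrow> j \<in> {1..5} \<Longrightarrow> (sqd y i j, sqd y' i j) \<in> R"
  unfolding sqd_def by (intro power diff) auto

lemma inv4_rel: "\<forall>j\<in>{1..5}. (y j, y' j) \<in> R \<Longrightarrow> (inv4 y, inv4 y') \<in> R"
  unfolding inv4_def by (intro add mult power sqd_rel) auto

lemma disc5_rel: "\<forall>j\<in>{1..5}. (y j, y' j) \<in> R \<Longrightarrow> (disc5 y, disc5 y') \<in> R"
  unfolding disc5_def by (intro add mult power sqd_rel) auto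

lemma covS_rel: "\<forall>j\<in>{1..5}. (y j, y' j) \<in> R \<Longrightarrow> (covS y, covS y') \<in> R"
  unfolding covS_def by (intro add mult power sqd_rel) auto

lemma covT_rel: "\<forall>j\<in>{1..5}. (y j, y' j) \<in> R \<Longrightarrow> (covT y, covT y') \<in> R"
  unfolding covT_def by (intro add mult power sqd_rel) auto

lemma at_point_rel:
  assumes "\<forall>j\<in>{1..5}. (y j, y' j) \<in> R" "k \<in> {1..5}"
  shows "\<forall>j\<in>{1..5}. (at_point k y j, at_point k y' j) \<in> R"
  using assms unfolding at_point_def by (auto simp: transpose_def)

lemma inv12_rel: "\<forall>j\<in>{1..5}. (y j, y' j) \<in> R \<Longrightarrow> (inv12 y, inv12 y') \<in> R"
  unfolding inv12_def by (intro prod covS_rel at_point_rel)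

lemma good5_rel: "\<forall>j\<in>{1..5}. (y j, y' j) \<in> R \<Longrightarrow> (good5 y, good5 y') \<in> R"
  unfolding good5_def
  by (intro mult diff power disc5_rel inv4_rel inv12_rel covT_rel covS_rel at_point_rel) auto

end

context field_relation begin

lemma delta5_rel: "\<forall>j\<in>{1..5}. (y j, y' j) \<in> R \<Longrightarrow> (delta5 y, delta5 y') \<in> R"
  unfolding delta5_def by (intro divide mult power numeral disc5_rel inv4_rel)

lemma q5_rel: "\<forall>j\<in>{1..5}. (y j, y' j) \<in> R \<Longrightarrow> (q5 y, q5 y') \<in> R"
  unfolding q5_def by (intro divide mult power numeral inv12_rel inv4_rel)

lemma rootU_rel: "\<forall>j\<in>{1..5}. (y j, y' j) \<in> R \<Longrightarrow> k \<in> {1..5} \<Longrightarrow> (rootU y k, rootU y' k) \<in> R"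
  unfolding rootU_def covU_def
  by (intro divide mult power uminus numeral covS_rel covT_rel at_point_rel)

end

text \<open>Makes evaluation at \<open>t\<close> a ring relation. Applied to points depending
  polynomially on a parameter, it shows that \<open>good5\<close> of these points is the value of a
  polynomial in that parameter.\<close>

lemma poly_graph_ring_rel:
  fixes t :: "'a::comm_ring_1"
  shows "ring_relation (range (\<lambda>p. (p, poly p t)))"
proof -
  have mem: "(p, x) \<in> range (\<lambda>p. (p, poly p t)) \<longleftrightarrow> x = poly p t" for p x by auto
  show ?thesis unfolding ring_relation_def mem by simp
qed

lemma two_transitive:
  assumes "i \<in> {1..5}" "j \<in> {1..5::nat}" "i \<noteq> j"
  obtains \<pi> where "\<pi> permutes {1..5}" "\<pi> 1 = i" "\<pi> 2 = j"
proof -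
  define a where "a = transpose 1 i"
  have a: "a permutes {1..5}" unfolding a_def using assms by (intro permutes_swap_id) auto
  have aj: "a j \<in> {1..5}" using permutes_in_image[OF a] assms by blast
  have aj1: "a j \<noteq> 1" using assms by (auto simp: a_def transpose_def split: if_splits)
  define b where "b = transpose 2 (a j)"
  have b: "b permutes {1..5}" unfolding b_def using aj by (intro permutes_swap_id) auto
  have "(a \<circ> b) 1 = i" using aj1 by (simp add: b_def a_def transpose_def)
  moreover have "(a \<circ> b) 2 = j" by (simp add: b_def a_def)
  ultimately show ?thesis using that permutes_compose[OF b a] by blast
qed

text \<open>Double transitivity: any coincidence \<open>u i = u j\<close> can be moved to the
  indices 1 and 2. This is why \<open>good5\<close> separates only one pair of roots.\<close>

lemma inj_on_of_equivariant:
  assumes "u 1 \<noteq> u 2"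
    and "\<And>\<pi>. \<pi> permutes {1..5} \<Longrightarrow> \<exists>s. \<forall>j\<in>{1..5}. s (u j) = u (\<pi> j)"
  shows "inj_on u {1..5::nat}"
proof (rule inj_onI, rule ccontr)
  fix i j assume ij: "i \<in> {1..5}" "j \<in> {1..5::nat}" "u i = u j" "i \<noteq> j"
  from two_transitive[OF ij(1,2,4)] obtain \<pi> where p: "\<pi> permutes {1..5}" "\<pi> 1 = i" "\<pi> 2 = j" .
  have ip: "inv_into UNIV \<pi> permutes {1..5}" using p(1) by (rule permutes_inv)
  have "inv_into UNIV \<pi> i = 1" "inv_into UNIV \<pi> j = 2"
    using p permutes_inj[OF p(1)] by (auto simp: inv_f_eq)
  moreover obtain s where "\<forall>j\<in>{1..5}. s (u j) = u (inv_into UNIV \<pi> j)" using assms(2)[OF ip] by blast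
  ultimately have "u 1 = u 2" using ij by metis
  then show False using assms(1) by simp
qed

subsection \<open>Galois extensions with group \<open>S\<^sub>5\<close>\<close>

lemma finite_polys_over:
  assumes "finite K"
  shows "finite {f \<in> polys_over K. degree f < n}"
proof -
  let ?F = "{f \<in> polys_over K. degree f < n}"
  have "inj_on (\<lambda>f. map (coeff f) [0..<n]) ?F"
  proof (rule inj_onI)
    fix f g assume fg: "f \<in> ?F" "g \<in> ?F" "map (coeff f) [0..<n] = map (coeff g) [0..<n]"
    show "f = g"
    proof (rule poly_eqI)
      fix i show "coeff f i = coeff g i"
      proof (cases "i < n")
        case True
        then have "i \<in> set [0..<n]" by simp
        then show ?thesis using fg(3) unfolding map_eq_conv by blast
      next
        case False
        then show ?thesis using fg by (simp add: coeff_eq_0)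
      qed
    qed
  qed
  moreover have "(\<lambda>f. map (coeff f) [0..<n]) ` ?F \<subseteq> {xs. set xs \<subseteq> K \<and> length xs = n}"
    by (auto simp: polys_over_def)
  moreover have "finite {xs. set xs \<subseteq> K \<and> length xs = n}" using assms by (rule finite_lists_length_eq)
  ultimately show ?thesis using finite_imageD finite_subset by blast
qed

lemma power_diff_eq_1:
  fixes x :: "'a::field"
  assumes "x \<noteq> 0" "i < j" "x ^ i = x ^ j"
  shows "x ^ (j - i) = 1"
  using assms by (simp add: power_diff)

text \<open>Every power of \<open>x\<close> is the value at \<open>x\<close> of a remainder modulo
  \<open>f\<close>. Over a finite field there are finitely many remainders, so two powers
  coincide.\<close>

lemma root_of_unity_over_finite:
  assumes K: "is_subfield K" "finite K" and f: "f \<in> polys_over K" "f \<noteq> 0" "poly f x = 0" and x: "x \<noteq> 0"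
  shows "\<exists>n>0. x ^ n = 1"
proof -
  interpret I: field_relation "Id_on K" by (rule subfield_field_rel[OF K(1)])
  have rel: "poly_rel (Id_on K) f f" if "f \<in> polys_over K" for f
    using that by (auto simp: poly_rel_def polys_over_def)
  let ?V = "(\<lambda>h. poly h x) ` {h \<in> polys_over K. degree h < Suc (degree f)}"
  have fin: "finite ?V" using finite_polys_over[OF K(2)] by blast
  have "x ^ n \<in> ?V" for n
  proof -
    have "monom 1 n \<in> polys_over K" using I.zero I.one by (auto simp: polys_over_def)
    from I.poly_division[OF rel[OF this] rel[OF f(1)] f(2)] obtain q r r' where
      r: "poly_rel (Id_on K) r r'" "monom 1 n = q * f + r" "r = 0 \<or> degree r < degree f" by blast
    have "r \<in> polys_over K" using poly_rel_polys_over[OF r(1)] by simp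
    moreover have "poly (monom 1 n) x = poly r x" using r(2) f(3) by simp
    then have "x ^ n = poly r x" by (simp add: poly_monom)
    ultimately show ?thesis using r(3) by (intro image_eqI[of _ _ r]) auto
  qed
  then have "finite (range (\<lambda>n. x ^ n))" using fin by (meson finite_subset image_subsetI)
  then have "\<not> inj (\<lambda>n. x ^ n)" using finite_imageD infinite_UNIV_nat by blast
  then obtain i j where "i \<noteq> j" "x ^ i = x ^ j" by (auto simp: inj_def)
  then obtain i j where ij: "i < j" "x ^ i = x ^ j" by (metis nat_neq_iff)
  then have "x ^ (j - i) = 1" using x by (intro power_diff_eq_1)
  then show ?thesis using ij(1) by (intro exI[of _ "j - i"]) simp
qed

text \<open>By minimality the \<open>n\<close> powers of \<open>x\<close> are distinct, so they
  exhaust the roots of the polynomial \<open>z^n - 1\<close>.\<close>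

lemma power_of_root_of_unity:
  fixes x y :: "'a::field"
  assumes x: "n > 0" "x ^ n = 1" and min: "\<And>m. 0 < m \<Longrightarrow> m < n \<Longrightarrow> x ^ m \<noteq> 1" and y: "y ^ n = 1"
  shows "\<exists>i. y = x ^ i"
proof -
  have x0: "x \<noteq> 0" using x by (auto simp: power_0_left)
  have "inj_on (\<lambda>i. x ^ i) {..<n}"
  proof (rule inj_onI)
    have *: False if "i < j" "j < n" "x ^ i = x ^ j" for i j
    proof -
      have "x ^ (j - i) = 1" using x0 that by (intro power_diff_eq_1)
      then show False using min[of "j - i"] that by simp
    qed
    fix i j assume "i \<in> {..<n}" "j \<in> {..<n}" "x ^ i = x ^ j"
    then show "i = j" using *[of i j] *[of j i] by (metis lessThan_iff nat_neq_iff)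
  qed
  then have card: "card ((\<lambda>i. x ^ i) ` {..<n}) = n" by (simp add: card_image)
  define f where "f = monom 1 n - (1 :: 'a poly)"
  have f0: "f \<noteq> 0"
  proof
    assume "f = 0"
    then have "coeff f 0 = 0" by simp
    then show False using x(1) by (simp add: f_def)
  qed
  have df: "degree f \<le> n" unfolding f_def by (intro degree_diff_le) (auto simp: degree_monom_le)
  have "(x ^ i) ^ n = 1" for i
    using x(2) by (metis power_mult mult.commute power_one)
  then have "(\<lambda>i. x ^ i) ` {..<n} \<subseteq> {z. poly f z = 0}"
    by (auto simp: f_def poly_monom)
  moreover have "card {z. poly f z = 0} \<le> n" using card_poly_roots_bound[OF f0] df by simp
  ultimately have "(\<lambda>i. x ^ i) ` {..<n} = {z. poly f z = 0}"
    using card poly_roots_finite[OF f0] by (intro card_seteq) auto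
  moreover have "poly f y = 0" using y by (simp add: f_def poly_monom)
  ultimately show ?thesis by blast
qed

lemma galois_group_power:
  assumes "\<sigma> \<in> carrier (galois_group K L)" "is_subfield L" "x \<in> L"
  shows "x ^ n \<in> L" "\<sigma> (x ^ n) = \<sigma> x ^ n"
proof -
  interpret S: field_relation "graph_on L \<sigma>"
    by (rule galois_graph_field_rel[OF assms(1,2)])
  show "x ^ n \<in> L" "\<sigma> (x ^ n) = \<sigma> x ^ n" using S.power[of x "\<sigma> x" n] assms(3) by auto
qed

text \<open>A nonzero \<open>x\<close> is a root of unity, and each automorphism sends it to a root
  of unity of the same exponent, hence to a power of \<open>x\<close>. The exponents multiply
  commutatively.\<close>

lemma galois_group_commute:
  assumes K: "is_subfield K" "finite K" and L: "is_subfield L" and alg: "algebraic_ext K L"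
    and s: "\<sigma> \<in> carrier (galois_group K L)" "\<tau> \<in> carrier (galois_group K L)" and x: "x \<in> L"
  shows "\<sigma> (\<tau> x) = \<tau> (\<sigma> x)"
proof (cases "x = 0")
  case True
  have *: "\<rho> 0 = 0" if "\<rho> \<in> carrier (galois_group K L)" for \<rho>
    using that K(1) unfolding galois_group_carrier is_subfield_iff by blast
  show ?thesis using True *[OF s(1)] *[OF s(2)] by simp
next
  case False
  obtain f where "f \<in> polys_over K" "f \<noteq> 0" "poly f x = 0" using alg x by (auto simp: algebraic_ext_def)
  from root_of_unity_over_finite[OF K this False] have ex: "\<exists>n. n > 0 \<and> x ^ n = 1" by blast
  define n where "n = (LEAST n. n > 0 \<and> x ^ n = 1)"
  have n: "n > 0" "x ^ n = 1" using LeastI_ex[OF ex] by (simp_all add: n_def)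
  have min: "x ^ m \<noteq> 1" if "0 < m" "m < n" for m
    using not_less_Least[of m "\<lambda>n. n > 0 \<and> x ^ n = 1"] that by (auto simp: n_def)
  have pow: "\<exists>i. \<rho> x = x ^ i" if r: "\<rho> \<in> carrier (galois_group K L)" for \<rho>
  proof (rule power_of_root_of_unity[OF n min])
    have "\<rho> 1 = 1" using r K(1) unfolding galois_group_carrier is_subfield_iff by blast
    then show "\<rho> x ^ n = 1" using galois_group_power(2)[OF r L x, of n] n by simp
  qed
  obtain i j where "\<sigma> x = x ^ i" "\<tau> x = x ^ j" using pow s by blast
  then show ?thesis
    using galois_group_power(2)[OF s(1) L x, of j] galois_group_power(2)[OF s(2) L x, of i]
    by (simp add: mult.commute flip: power_mult)
qed

text \<open>The group isomorphism is used in the direction from permutations to automorphisms, so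
  that equivariance of a family reads \<open>\<Phi> \<pi> (b j) = b (\<pi> j)\<close>.\<close>

locale S5_extension =
  fixes K L :: "'a::field set" and \<Phi> :: "(nat \<Rightarrow> nat) \<Rightarrow> 'a \<Rightarrow> 'a"
  assumes galois: "galois_ext K L"
    and \<Phi>_bij: "bij_betw \<Phi> {\<pi>. \<pi> permutes {1..5}} (carrier (galois_group K L))"
    and \<Phi>_comp: "\<rho> permutes {1..5} \<Longrightarrow> \<pi> permutes {1..5} \<Longrightarrow> x \<in> L \<Longrightarrow> \<Phi> (\<rho> \<circ> \<pi>) x = \<Phi> \<rho> (\<Phi> \<pi> x)"
begin

lemma K: "is_subfield K" and L: "is_subfield L" and KL: "K \<subseteq> L" and alg: "algebraic_ext K L"
  using galois by (auto simp: galois_ext_def normal_ext_def)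

lemma \<Phi>_mem: "\<pi> permutes {1..5} \<Longrightarrow> \<Phi> \<pi> \<in> carrier (galois_group K L)"
  using \<Phi>_bij bij_betwE by blast

lemma \<Phi>_closed: "\<pi> permutes {1..5} \<Longrightarrow> x \<in> L \<Longrightarrow> \<Phi> \<pi> x \<in> L"
  using \<Phi>_mem galois_group_closed by blast

lemma \<Phi>_surj: "\<sigma> \<in> carrier (galois_group K L) \<Longrightarrow> \<exists>\<pi>. \<pi> permutes {1..5} \<and> \<sigma> = \<Phi> \<pi>"
  using \<Phi>_bij by (auto simp: bij_betw_def)

lemma \<Phi>_inj: "\<rho> permutes {1..5} \<Longrightarrow> \<pi> permutes {1..5} \<Longrightarrow> \<rho> \<noteq> \<pi> \<Longrightarrow> \<exists>x\<in>L. \<Phi> \<rho> x \<noteq> \<Phi> \<pi> x"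
proof (rule ccontr)
  assume p: "\<rho> permutes {1..5}" "\<pi> permutes {1..5}" "\<rho> \<noteq> \<pi>" "\<not> (\<exists>x\<in>L. \<Phi> \<rho> x \<noteq> \<Phi> \<pi> x)"
  then have "\<Phi> \<rho> = \<Phi> \<pi>" by (intro galois_group_ext[OF \<Phi>_mem \<Phi>_mem]) auto
  then show False using p \<Phi>_bij unfolding bij_betw_def inj_on_def by blast
qed

lemma \<Phi>_id: "x \<in> L \<Longrightarrow> \<Phi> id x = x"
proof -
  assume x: "x \<in> L"
  have p: "id permutes {1..5::nat}" by (rule permutes_id)
  have "\<Phi> id (\<Phi> id x) = \<Phi> id x" using \<Phi>_comp[OF p p x] by simp
  then show ?thesis
    using galois_group_bij[OF \<Phi>_mem[OF p]] \<Phi>_closed[OF p x] x by (auto simp: bij_betw_def dest: inj_onD)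
qed

lemma \<Phi>_field_rel: "\<pi> permutes {1..5} \<Longrightarrow> field_relation {(x, \<Phi> \<pi> x) |x. x \<in> L}"
  using galois_graph_field_rel[OF \<Phi>_mem L] .

lemma \<Phi>_K: "\<pi> permutes {1..5} \<Longrightarrow> x \<in> K \<Longrightarrow> \<Phi> \<pi> x = x"
  using \<Phi>_mem by (simp add: galois_group_carrier)

lemma fixed_in_K:
  assumes "x \<in> L" "\<And>\<pi>. \<pi> permutes {1..5} \<Longrightarrow> \<Phi> \<pi> x = x"
  shows "x \<in> K"
proof (rule ccontr)
  assume "x \<notin> K"
  from exists_moving_automorphism[OF K L KL galois_ext_split_sep[OF galois] assms(1) this]
  show False using \<Phi>_surj assms(2) by metis
qed

lemma infinite_K: "infinite K"
proof
  assume fin: "finite K"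
  define a where "a = transpose 1 (2::nat)"
  define b where "b = transpose 2 (3::nat)"
  have ab: "a permutes {1..5}" "b permutes {1..5}" unfolding a_def b_def by (intro permutes_swap_id; simp)+
  have "(a \<circ> b) 1 \<noteq> (b \<circ> a) 1" by (simp add: a_def b_def transpose_def)
  then have neq: "a \<circ> b \<noteq> b \<circ> a" by metis
  have p: "a \<circ> b permutes {1..5}" "b \<circ> a permutes {1..5}" using ab by (intro permutes_compose; simp)+
  obtain x where x: "x \<in> L" "\<Phi> (a \<circ> b) x \<noteq> \<Phi> (b \<circ> a) x" using \<Phi>_inj[OF p neq] by blast
  then show False using galois_group_commute[OF K fin L alg \<Phi>_mem[OF ab(1)] \<Phi>_mem[OF ab(2)] x(1)]
      \<Phi>_comp ab by simp
qed

text \<open>Any two automorphisms differ at some \<open>\<alpha>\<close>. Replacing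
  \<open>\<omega>\<close> by \<open>\<omega> + t * \<alpha>\<close> separates this pair and keeps
  the earlier ones apart for all but finitely many \<open>t\<close> in the infinite field
  \<open>K\<close>.\<close>

lemma exists_separating:
  obtains \<omega> where "\<omega> \<in> L" "\<And>\<rho> \<pi>. \<rho> permutes {1..5} \<Longrightarrow> \<pi> permutes {1..5} \<Longrightarrow> \<rho> \<noteq> \<pi> \<Longrightarrow> \<Phi> \<rho> \<omega> \<noteq> \<Phi> \<pi> \<omega>"
proof -
  define T where "T = {(\<rho>, \<pi>). \<rho> permutes {1..5::nat} \<and> \<pi> permutes {1..5} \<and> \<rho> \<noteq> \<pi>}"
  have "T \<subseteq> {\<pi>. \<pi> permutes {1..5}} \<times> {\<pi>. \<pi> permutes {1..5}}" by (auto simp: T_def)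
  then have "finite T" by (rule finite_subset) (simp add: finite_permutations)
  have "\<exists>\<omega>\<in>L. \<forall>(\<rho>, \<pi>)\<in>S. \<Phi> \<rho> \<omega> \<noteq> \<Phi> \<pi> \<omega>" if "finite S" "S \<subseteq> T" for S
    using that
  proof (induction S rule: finite_induct)
    case empty
    then show ?case using L unfolding is_subfield_iff by auto
  next
    case (insert p S)
    then obtain \<omega> where w: "\<omega> \<in> L" "\<And>\<rho> \<pi>. (\<rho>, \<pi>) \<in> S \<Longrightarrow> \<Phi> \<rho> \<omega> \<noteq> \<Phi> \<pi> \<omega>" by auto
    obtain \<rho>0 \<pi>0 where p: "p = (\<rho>0, \<pi>0)" by (cases p)
    then have "\<rho>0 permutes {1..5}" "\<pi>0 permutes {1..5}" "\<rho>0 \<noteq> \<pi>0" using insert.prems by (auto simp: T_def)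
    from \<Phi>_inj[OF this] obtain \<alpha> where a: "\<alpha> \<in> L" "\<Phi> \<rho>0 \<alpha> \<noteq> \<Phi> \<pi>0 \<alpha>" by blast
    \<comment> \<open>For pairs that agree at \<open>\<alpha>\<close> the quotient is
      \<open>0\<close> by convention; this at most adds \<open>0\<close> to the finite set to be
      avoided.\<close>
    define bad where "bad = (\<lambda>(\<rho>, \<pi>). (\<Phi> \<pi> \<omega> - \<Phi> \<rho> \<omega>) / (\<Phi> \<rho> \<alpha> - \<Phi> \<pi> \<alpha>)) ` insert p S"
    have "finite bad" using insert.hyps by (simp add: bad_def)
    then obtain t where t: "t \<in> K" "t \<notin> bad" using infinite_K by (meson finite_subset subsetI)
    have tL: "t \<in> L" "t * \<alpha> \<in> L" "\<omega> + t * \<alpha> \<in> L" using t(1) KL a(1) w(1) L unfolding is_subfield_iff by blast+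
    have ev: "\<Phi> \<rho> (\<omega> + t * \<alpha>) = \<Phi> \<rho> \<omega> + t * \<Phi> \<rho> \<alpha>" if "\<rho> permutes {1..5}" for \<rho>
      using \<Phi>_mem[OF that] w(1) a(1) tL \<Phi>_K[OF that t(1)] by (simp add: galois_group_carrier)
    have "\<Phi> \<rho> (\<omega> + t * \<alpha>) \<noteq> \<Phi> \<pi> (\<omega> + t * \<alpha>)" if rp: "(\<rho>, \<pi>) \<in> insert p S" for \<rho> \<pi>
    proof
      assume eq: "\<Phi> \<rho> (\<omega> + t * \<alpha>) = \<Phi> \<pi> (\<omega> + t * \<alpha>)"
      have perm: "\<rho> permutes {1..5}" "\<pi> permutes {1..5}" using rp insert.prems by (auto simp: T_def)
      have e: "t * (\<Phi> \<rho> \<alpha> - \<Phi> \<pi> \<alpha>) = \<Phi> \<pi> \<omega> - \<Phi> \<rho> \<omega>"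
        using eq unfolding ev[OF perm(1)] ev[OF perm(2)] by (simp add: algebra_simps)
      show False
      proof (cases "\<Phi> \<rho> \<alpha> = \<Phi> \<pi> \<alpha>")
        case True
        then have "\<Phi> \<rho> \<omega> = \<Phi> \<pi> \<omega>" using e by simp
        then show False using rp w(2) True a(2) p by auto
      next
        case False
        then have "t = (\<Phi> \<pi> \<omega> - \<Phi> \<rho> \<omega>) / (\<Phi> \<rho> \<alpha> - \<Phi> \<pi> \<alpha>)" using e by (simp add: field_simps)
        then show False using t(2) rp unfolding bad_def by force
      qed
    qed
    then show ?case using tL(3) by blast
  qed
  from this[OF \<open>finite T\<close> subset_refl] show ?thesis using that unfolding T_def by blast
qed

text \<open>\<open>C j\<close> is a left coset of the stabilizer of 1, and composition with
  \<open>\<rho>\<close> maps it onto \<open>C (\<rho> j)\<close>. So a product of conjugates over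
  \<open>C j\<close> is moved by the Galois group exactly like the index \<open>j\<close>.\<close>

lemma exists_quintic_generator:
  obtains b where "\<And>j. j \<in> {1..5} \<Longrightarrow> b j \<in> L" "inj_on b {1..5::nat}"
    "\<And>\<pi> j. \<pi> permutes {1..5} \<Longrightarrow> j \<in> {1..5} \<Longrightarrow> \<Phi> \<pi> (b j) = b (\<pi> j)"
proof -
  obtain \<omega> where w: "\<omega> \<in> L" and sep: "\<And>\<rho> \<pi>. \<rho> permutes {1..5} \<Longrightarrow> \<pi> permutes {1..5} \<Longrightarrow> \<rho> \<noteq> \<pi> \<Longrightarrow> \<Phi> \<rho> \<omega> \<noteq> \<Phi> \<pi> \<omega>"
    by (rule exists_separating) blast
  define C where "C i = {\<pi>. \<pi> permutes {1..5} \<and> \<pi> 1 = i}" for i :: nat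
  have finC: "finite (C i)" for i
    by (rule finite_subset[of _ "{\<pi>. \<pi> permutes {1..5}}"]) (auto simp: C_def finite_permutations)
  \<comment> \<open>Since \<open>\<omega>\<close> has distinct conjugates, different cosets give
    polynomials without common roots. They differ, so their values at almost every \<open>c\<close>
    in \<open>K\<close> are distinct.\<close>
  define B where "B i = (\<Prod>\<pi>\<in>C i. [:- \<Phi> \<pi> \<omega>, 1:])" for i
  have neq: "B i - B j \<noteq> 0" if ij: "i \<in> {1..5}" "j \<in> {1..5}" "i \<noteq> j" for i j
  proof
    assume eq: "B i - B j = 0"
    have "transpose 1 i \<in> C i" using ij by (auto simp: C_def intro!: permutes_swap_id)
    then obtain \<pi> where p: "\<pi> \<in> C i" by blast
    have "poly (B i) (\<Phi> \<pi> \<omega>) = 0" unfolding B_def poly_prod using finC p by (intro prod_zero) auto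
    then have "poly (B j) (\<Phi> \<pi> \<omega>) = 0" using eq by simp
    then obtain \<rho> where r: "\<rho> \<in> C j" "\<Phi> \<rho> \<omega> = \<Phi> \<pi> \<omega>" using finC by (auto simp: B_def poly_prod)
    then have "\<rho> = \<pi>" using sep p by (auto simp: C_def)
    then show False using r p ij by (auto simp: C_def)
  qed
  define bad where "bad = (\<Union>(i, j)\<in>{(i, j). i \<in> {1..5} \<and> j \<in> {1..5} \<and> i \<noteq> j}. {x. poly (B i - B j) x = 0})"
  have "finite {(i, j). i \<in> {1..5} \<and> j \<in> {1..5::nat} \<and> i \<noteq> j}"
    by (rule finite_subset[of _ "{1..5} \<times> {1..5}"]) auto
  then have "finite bad" unfolding bad_def using poly_roots_finite[OF neq] by (intro finite_UN_I) auto
  then obtain c where c: "c \<in> K" "c \<notin> bad" using infinite_K by (meson finite_subset subsetI)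
  define b where "b i = (\<Prod>\<pi>\<in>C i. (c - \<Phi> \<pi> \<omega>))" for i
  have bB: "b i = poly (B i) c" for i by (simp add: b_def B_def poly_prod)
  have cL: "c \<in> L" using c(1) KL by blast
  have "(b j, b (\<rho> j)) \<in> {(x, \<Phi> \<rho> x) |x. x \<in> L}" if r: "\<rho> permutes {1..5}" for \<rho> j
  proof -
    interpret S: field_relation "{(x, \<Phi> \<rho> x) |x. x \<in> L}" by (rule \<Phi>_field_rel[OF r])
    have ri: "inv_into UNIV \<rho> permutes {1..5}" using r by (rule permutes_inv)
    have bij: "bij_betw (\<lambda>\<pi>. \<rho> \<circ> \<pi>) (C j) (C (\<rho> j))"
    proof (rule bij_betw_byWitness[where f' = "\<lambda>\<pi>. inv_into UNIV \<rho> \<circ> \<pi>"])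
      show "\<forall>a\<in>C j. inv_into UNIV \<rho> \<circ> (\<rho> \<circ> a) = a"
        using permutes_inv_o(2)[OF r] by (simp add: o_assoc)
      show "\<forall>a\<in>C (\<rho> j). \<rho> \<circ> (inv_into UNIV \<rho> \<circ> a) = a"
        using permutes_inv_o(1)[OF r] by (simp add: o_assoc)
      show "(\<circ>) \<rho> ` C j \<subseteq> C (\<rho> j)" using r by (auto simp: C_def intro: permutes_compose)
      show "(\<circ>) (inv_into UNIV \<rho>) ` C (\<rho> j) \<subseteq> C j"
        using ri permutes_inverses(2)[OF r] by (auto simp: C_def intro: permutes_compose)
    qed
    have "b (\<rho> j) = (\<Prod>\<pi>\<in>C j. (c - \<Phi> (\<rho> \<circ> \<pi>) \<omega>))"
      unfolding b_def using prod.reindex_bij_betw[OF bij, of "\<lambda>\<pi>. c - \<Phi> \<pi> \<omega>"] by simp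
    moreover have "((\<Prod>\<pi>\<in>C j. (c - \<Phi> \<pi> \<omega>)), (\<Prod>\<pi>\<in>C j. (c - \<Phi> (\<rho> \<circ> \<pi>) \<omega>))) \<in> {(x, \<Phi> \<rho> x) |x. x \<in> L}"
    proof (rule S.prod)
      fix \<pi> assume "\<pi> \<in> C j"
      then have p: "\<pi> permutes {1..5}" by (simp add: C_def)
      have "(c, c) \<in> {(x, \<Phi> \<rho> x) |x. x \<in> L}" using cL \<Phi>_K[OF r c(1)] by auto
      moreover have "(\<Phi> \<pi> \<omega>, \<Phi> (\<rho> \<circ> \<pi>) \<omega>) \<in> {(x, \<Phi> \<rho> x) |x. x \<in> L}"
        using \<Phi>_comp[OF r p w] \<Phi>_closed[OF p w] by auto
      ultimately show "(c - \<Phi> \<pi> \<omega>, c - \<Phi> (\<rho> \<circ> \<pi>) \<omega>) \<in> {(x, \<Phi> \<rho> x) |x. x \<in> L}" by (rule S.diff)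
    qed
    ultimately show ?thesis by (simp add: b_def)
  qed
  then have *: "b j \<in> L \<and> \<Phi> \<rho> (b j) = b (\<rho> j)" if "\<rho> permutes {1..5}" for \<rho> j using that by auto
  show ?thesis
  proof (rule that)
    show "b j \<in> L" for j using *[OF permutes_id] by blast
    show "\<Phi> \<pi> (b j) = b (\<pi> j)" if "\<pi> permutes {1..5}" for \<pi> j using * that by blast
    show "inj_on b {1..5}"
    proof (rule inj_onI, rule ccontr)
      fix i j assume ij: "i \<in> {1..5}" "j \<in> {1..5}" "b i = b j" "i \<noteq> j"
      then have "poly (B i - B j) c = 0" using bB by simp
      then show False using c(2) ij unfolding bad_def by blast
    qed
  qed
qed

lemma polys_over_rel:
  assumes "\<pi> permutes {1..5}" "f \<in> polys_over K"
  shows "poly_rel {(x, \<Phi> \<pi> x) |x. x \<in> L} f f"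
  using assms \<Phi>_K KL unfolding poly_rel_def polys_over_def by force

text \<open>An automorphism over the field \<open>E\<close> generated by the roots fixes every
  \<open>w j\<close>, so its permutation is the identity. As no element outside \<open>E\<close> can
  then be moved, \<open>E\<close> is all of \<open>L\<close>.\<close>

lemma splitting_field_of_roots:
  assumes f: "f \<in> polys_over K" "degree f = 5" and w: "\<And>j. j \<in> {1..5} \<Longrightarrow> w j \<in> L" "inj_on w {1..5}"
    and root: "\<And>j. j \<in> {1..5} \<Longrightarrow> poly f (w j) = 0"
    and act: "\<And>\<pi> j. \<pi> permutes {1..5} \<Longrightarrow> j \<in> {1..5} \<Longrightarrow> \<Phi> \<pi> (w j) = w (\<pi> j)"
  shows "splitting_field_over K f L"
  unfolding splitting_field_over_def
proof (intro conjI K f)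
  have "f \<noteq> 0" using f(2) by auto
  moreover have "set (map w [1..<Suc 5]) \<subseteq> L" using w(1) by auto
  ultimately show "splits_over L f"
    unfolding splits_over_def using poly_eq_linear_factors[OF w(2) root f(2)] leading_coeff_0_iff by blast
  let ?S = "K \<union> {x \<in> L. poly f x = 0}"
  define E where "E = generate_field ring_of_type_algebra ?S"
  have E: "is_subfield E" unfolding E_def by (rule generate_field_subfield)
  have SE: "?S \<subseteq> E" unfolding E_def by (auto intro: generate_field.incl)
  have EL: "E \<subseteq> L" unfolding E_def using KL by (intro generate_field_least L) auto
  have "L \<subseteq> E"
  proof (rule subsetI, rule ccontr)
    fix x assume x: "x \<in> L" "x \<notin> E"
    have "split_sep E L" using split_sep_mono[OF galois_ext_split_sep[OF galois]] SE by blast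
    from exists_moving_automorphism[OF E L EL this x] obtain \<sigma> where
      s: "\<sigma> \<in> carrier (galois_group E L)" "\<sigma> x \<noteq> x" by blast
    then have "\<sigma> \<in> carrier (galois_group K L)" using SE unfolding galois_group_carrier by blast
    then obtain \<pi> where p: "\<pi> permutes {1..5}" "\<sigma> = \<Phi> \<pi>" using \<Phi>_surj by blast
    have "\<pi> j = j" if j: "j \<in> {1..5}" for j
    proof -
      have "w j \<in> E" using SE w(1)[OF j] root[OF j] by blast
      then have "\<sigma> (w j) = w j" using s(1) by (simp add: galois_group_carrier)
      then have "w (\<pi> j) = w j" using act[OF p(1) j] p(2) by simp
      then show ?thesis using w(2) j permutes_in_image[OF p(1), of j] by (auto dest: inj_onD)
    qed
    then have "\<pi> = id" using permutes_not_in[OF p(1)] by (metis eq_id_iff)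
    then show False using s(2) \<Phi>_id[OF x(1)] p(2) by simp
  qed
  then show "L = generate_field ring_of_type_algebra ?S" using EL unfolding E_def by blast
qed

lemma exists_interpolating_poly:
  fixes b v :: "nat \<Rightarrow> 'a"
  assumes "finite S" "inj_on b S"
  shows "\<exists>p. \<forall>j\<in>S. poly p (b j) = v j"
  using assms
proof (induction S rule: finite_induct)
  case (insert i S)
  then obtain p where p: "\<And>j. j \<in> S \<Longrightarrow> poly p (b j) = v j" by auto
  define g where "g = (\<Prod>j\<in>S. [:- b j, 1:])"
  have gi: "poly g (b i) \<noteq> 0" using insert by (auto simp: g_def poly_prod)
  have gj: "poly g (b j) = 0" if "j \<in> S" for j
    unfolding g_def poly_prod using that insert by (intro prod_zero) auto
  define p' where "p' = p + smult ((v i - poly p (b i)) / poly g (b i)) g"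
  have "poly p' (b j) = v j" if "j \<in> insert i S" for j
    using that p gj gi by (auto simp: p'_def)
  then show ?case by blast
qed simp

text \<open>
  A polynomial over the big field taking the good values \<open>v\<close> exists by interpolation; its coefficients are
  moved into the infinite field \<open>K\<close> one at a time, staying off the zeros of \<open>good5\<close>.
\<close>

lemma exists_good_poly:
  assumes b: "inj_on b {1..5::nat}" and v: "good5 v \<noteq> (0::'a)"
  shows "\<exists>p\<in>polys_over K. good5 (\<lambda>j. poly p (b j)) \<noteq> 0"
proof -
  have zero: "0 \<in> K" using K unfolding is_subfield_iff by blast
  obtain p0 where p0: "\<And>j. j \<in> {1..5} \<Longrightarrow> poly p0 (b j) = v j"
    using exists_interpolating_poly[OF finite_atLeastAtMost b, of v] by blast
  have good_cong: "good5 y = good5 y'" if "\<forall>j\<in>{1..5}. y j = y' j" for y y' :: "nat \<Rightarrow> 'a"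
  proof -
    interpret I: ring_relation "Id :: ('a \<times> 'a) set" by (simp add: ring_relation_def)
    show ?thesis using I.good5_rel[of y y'] that by simp
  qed
  define d where "d = degree p0"
  have "\<exists>p. degree p \<le> d \<and> (\<forall>k<n. coeff p k \<in> K) \<and> good5 (\<lambda>j. poly p (b j)) \<noteq> 0" if "n \<le> Suc d" for n
    using that
  proof (induction n)
    case 0
    have "good5 (\<lambda>j. poly p0 (b j)) = good5 v" using p0 by (intro good_cong) simp
    then show ?case using v d_def by auto
  next
    case (Suc n)
    then obtain p where p: "degree p \<le> d" "\<forall>k<n. coeff p k \<in> K" "good5 (\<lambda>j. poly p (b j)) \<noteq> 0" by auto
    \<comment> \<open>\<open>c j\<close> is a polynomial in \<open>t\<close>: the value of
      \<open>p\<close> at \<open>b j\<close> after its coefficient of index \<open>n\<close> has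
      been replaced by \<open>t\<close>. Hence \<open>g\<close> is a polynomial in \<open>t\<close>,
      and the old coefficient shows that it is nonzero.\<close>
    define c where "c j = [:poly p (b j) - coeff p n * b j ^ n, b j ^ n:]" for j
    define g where "g = good5 c"
    have c: "poly (c j) t = poly (p + monom (t - coeff p n) n) (b j)" for j t
      by (simp add: c_def poly_monom algebra_simps)
    have ev: "good5 (\<lambda>j. poly (p + monom (t - coeff p n) n) (b j)) = poly g t" for t
    proof -
      interpret P: ring_relation "range (\<lambda>p. (p, poly p t))" by (rule poly_graph_ring_rel)
      have "\<forall>j\<in>{1..5}. (c j, poly (p + monom (t - coeff p n) n) (b j)) \<in> range (\<lambda>p. (p, poly p t))"
        unfolding c[symmetric] by blast
      from P.good5_rel[OF this] show ?thesis unfolding g_def by auto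
    qed
    have "poly g (coeff p n) \<noteq> 0" using ev[of "coeff p n"] p(3) by simp
    then have "g \<noteq> 0" by auto
    then have "finite {t. poly g t = 0}" by (rule poly_roots_finite)
    then obtain t where t: "t \<in> K" "poly g t \<noteq> 0"
      using infinite_K by (metis (mono_tags, lifting) finite_subset mem_Collect_eq subsetI)
    define p' where "p' = p + monom (t - coeff p n) n"
    have "degree p' \<le> d" unfolding p'_def using p(1) Suc.prems
      by (intro degree_add_le) (auto intro: order_trans[OF degree_monom_le])
    moreover have "coeff p' k \<in> K" if "k < Suc n" for k
      using that p(2) t(1) by (cases "k = n") (auto simp: p'_def)
    moreover have "good5 (\<lambda>j. poly p' (b j)) \<noteq> 0" using ev[of t] t(2) by (simp add: p'_def)
    ultimately show ?case by blast
  qed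
  from this[OF order_refl] obtain p where p: "degree p \<le> d" "\<forall>k<Suc d. coeff p k \<in> K"
    "good5 (\<lambda>j. poly p (b j)) \<noteq> 0" by blast
  have "coeff p k \<in> K" for k using p(1,2) zero by (cases "k < Suc d") (auto simp: coeff_eq_0)
  then show ?thesis using p(3) by (auto simp: polys_over_def)
qed

text \<open>The family \<open>b\<close> may be a degenerate configuration. A Tschirnhaus
  transformation \<open>y j = p (b j)\<close> with \<open>p\<close> over \<open>K\<close> keeps the
  Galois action and makes \<open>good5\<close> nonzero.\<close>

theorem parametrized_splitting:
  assumes two: "(2::'a) \<noteq> 0" and three: "(3::'a) \<noteq> 0" and five: "(5::'a) \<noteq> 0"
  shows "\<exists>\<delta>\<in>K. \<exists>q\<in>K. splitting_field_over K (P_poly \<delta> q) L \<and>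
    splitting_field_over K (F_poly 1 (\<delta> / 25) (1 / (8 * q))) L"
proof -
  obtain b where bL: "\<And>j. j \<in> {1..5} \<Longrightarrow> b j \<in> L" and binj: "inj_on b {1..5::nat}"
    and bact: "\<And>\<pi> j. \<pi> permutes {1..5} \<Longrightarrow> j \<in> {1..5} \<Longrightarrow> \<Phi> \<pi> (b j) = b (\<pi> j)"
    by (rule exists_quintic_generator) blast
  obtain v :: "nat \<Rightarrow> 'a" where v: "good5 v \<noteq> 0" using exists_good5[OF infinite_K two three] by blast
  obtain p where p: "p \<in> polys_over K" "good5 (\<lambda>j. poly p (b j)) \<noteq> 0" using exists_good_poly[OF binj v] by blast
  define y where "y j = poly p (b j)" for j
  have good: "good5 y \<noteq> 0" using p(2) by (simp add: y_def[abs_def])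
  note g = good5D[OF good five]
  have y: "\<forall>j\<in>{1..5}. (y j, (y \<circ> \<pi>) j) \<in> {(x, \<Phi> \<pi> x) |x. x \<in> L}" if pi: "\<pi> permutes {1..5}" for \<pi>
  proof
    fix j :: nat assume j: "j \<in> {1..5}"
    interpret S: field_relation "{(x, \<Phi> \<pi> x) |x. x \<in> L}" by (rule \<Phi>_field_rel[OF pi])
    have "(b j, b (\<pi> j)) \<in> {(x, \<Phi> \<pi> x) |x. x \<in> L}" using bact[OF pi j] bL[OF j] by force
    from S.poly_eval[OF polys_over_rel[OF pi p(1)] this]
    show "(y j, (y \<circ> \<pi>) j) \<in> {(x, \<Phi> \<pi> x) |x. x \<in> L}" by (simp add: y_def)
  qed
  define \<delta> where "\<delta> = delta5 y"
  define q where "q = q5 y"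
  define u where "u = rootU y"
  have inv: "\<delta> \<in> L \<and> \<Phi> \<pi> \<delta> = \<delta>" "q \<in> L \<and> \<Phi> \<pi> q = q"
    and u: "\<And>j. j \<in> {1..5} \<Longrightarrow> u j \<in> L \<and> \<Phi> \<pi> (u j) = u (\<pi> j)" if pi: "\<pi> permutes {1..5}" for \<pi>
  proof -
    interpret S: field_relation "{(x, \<Phi> \<pi> x) |x. x \<in> L}" by (rule \<Phi>_field_rel[OF pi])
    show "\<delta> \<in> L \<and> \<Phi> \<pi> \<delta> = \<delta>" using S.delta5_rel[OF y[OF pi], unfolded delta5_permutes[OF pi]] by (auto simp: \<delta>_def)
    show "q \<in> L \<and> \<Phi> \<pi> q = q" using S.q5_rel[OF y[OF pi], unfolded q5_permutes[OF pi]] by (auto simp: q_def)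
    show "u j \<in> L \<and> \<Phi> \<pi> (u j) = u (\<pi> j)" if j: "j \<in> {1..5}" for j
      using S.rootU_rel[OF y[OF pi] j, unfolded rootU_permutes[OF pi j]] by (auto simp: u_def)
  qed
  have dK: "\<delta> \<in> K" by (rule fixed_in_K) (use inv(1) permutes_id in blast)+
  have qK: "q \<in> K" by (rule fixed_in_K) (use inv(2) permutes_id in blast)+
  have q0: "q \<noteq> 0" using g two_powers_nonzero[OF two] by (simp add: q_def q5_def)
  have uL: "u j \<in> L" if "j \<in> {1..5}" for j using u[OF permutes_id that] by blast
  have uact: "\<Phi> \<pi> (u j) = u (\<pi> j)" if "\<pi> permutes {1..5}" "j \<in> {1..5}" for \<pi> j using u[OF that] by blast
  have uinj: "inj_on u {1..5}"
  proof (rule inj_on_of_equivariant)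
    show "u 1 \<noteq> u 2" using g(4) by (simp add: u_def)
    show "\<exists>s. \<forall>j\<in>{1..5}. s (u j) = u (\<pi> j)" if "\<pi> permutes {1..5}" for \<pi> using uact[OF that] by blast
  qed
  have uroot: "poly (P_poly \<delta> q) (u j) = 0" if "j \<in> {1..5}" for j
    unfolding \<delta>_def q_def u_def by (rule rootU_root[OF two g(1-3) that])
  interpret I: field_relation "Id_on K" by (rule subfield_field_rel[OF K])
  have "P_poly \<delta> q \<in> polys_over K"
    using I.P_poly_rel[of \<delta> \<delta> q q] dK qK poly_rel_polys_over[of "Id_on K"] by auto
  then have P: "splitting_field_over K (P_poly \<delta> q) L"
    by (intro splitting_field_of_roots[OF _ _ uL uinj uroot uact]) auto
  \<comment> \<open>With \<open>A = 1\<close> the equations \<open>\<delta> = 25 D / A^2\<close> and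
    \<open>q = A^3 / (8 M)\<close> are solved by \<open>D = \<delta> / 25\<close> and this
    \<open>M\<close>.\<close>
  define M where "M = 1 / (8 * q)"
  define F where "F = F_poly 1 (\<delta> / 25) M"
  have n: "(8::'a) \<noteq> 0" "(25::'a) \<noteq> 0"
    using two_powers_nonzero[OF two] power_not_zero[OF five, of 2] by simp_all
  have M0: "M \<noteq> 0" using q0 n by (simp add: M_def)
  have dq: "(\<delta>, \<delta>) \<in> Id_on K" "(q, q) \<in> Id_on K" using dK qK by auto
  have "(\<delta> / 25, \<delta> / 25) \<in> Id_on K" by (intro I.divide I.numeral dq)
  moreover have "(M, M) \<in> Id_on K" unfolding M_def by (intro I.divide I.mult I.numeral I.one dq)
  ultimately have "poly_rel (Id_on K) F F" unfolding F_def by (intro I.F_poly_rel I.one)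
  then have FK: "F \<in> polys_over K" using poly_rel_polys_over by fastforce
  \<comment> \<open>Inverts the substitution \<open>u = 3 z + 1\<close> relating the roots of the
    two polynomials.\<close>
  define w where "w j = (u j - 1) / 3" for j
  have wrel: "w j \<in> L \<and> \<Phi> \<pi> (w j) = w (\<pi> j)" if pi: "\<pi> permutes {1..5}" and j: "j \<in> {1..5}" for \<pi> j
  proof -
    interpret S: field_relation "{(x, \<Phi> \<pi> x) |x. x \<in> L}" by (rule \<Phi>_field_rel[OF pi])
    have "(u j, u (\<pi> j)) \<in> {(x, \<Phi> \<pi> x) |x. x \<in> L}" using uL[OF j] uact[OF pi j] by auto
    then have "(w j, w (\<pi> j)) \<in> {(x, \<Phi> \<pi> x) |x. x \<in> L}"
      unfolding w_def by (intro S.divide S.diff S.one S.numeral)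
    then show ?thesis by auto
  qed
  have "splitting_field_over K F L"
  proof (rule splitting_field_of_roots[OF FK])
    show "degree F = 5" unfolding F_def by (rule degree_F_poly[OF M0 two three])
    show "w j \<in> L" if "j \<in> {1..5}" for j using wrel[OF permutes_id that] by blast
    show "\<Phi> \<pi> (w j) = w (\<pi> j)" if "\<pi> permutes {1..5}" "j \<in> {1..5}" for \<pi> j using wrel[OF that] by blast
    show "inj_on w {1..5}"
      using uinj three unfolding inj_on_def w_def by simp
    show "poly F (w j) = 0" if j: "j \<in> {1..5}" for j
    proof -
      have "25 * (\<delta> / 25) / 1^2 = \<delta>" "1^3 / (8 * M) = q" using n q0 by (simp_all add: M_def)
      moreover have "3 * w j = u j - 1"
        unfolding w_def using three
            by (simp only: times_divide_eq_right nonzero_mult_div_cancel_left not_False_eq_True)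
      then have "3 * w j + 1 = u j" by simp
      ultimately have "27 * poly F (w j) = 0"
        unfolding F_def poly_F_poly[OF one_neq_zero M0 two] using uroot[OF j] by simp
      moreover have "(27::'a) \<noteq> 0" using power_not_zero[OF three, of 3] by simp
      ultimately show ?thesis by simp
    qed
  qed
  then show ?thesis using P dK qK unfolding F_def M_def by blast
qed

end

theorem generic_splitting:
  fixes K L :: "'a::field set"
  assumes "galois_ext K L" "galois_group K L \<cong> sym_group 5"
    and "(2::'a) \<noteq> 0" "(3::'a) \<noteq> 0" "(5::'a) \<noteq> 0"
  shows "\<exists>\<delta>\<in>K. \<exists>q\<in>K. splitting_field_over K (P_poly \<delta> q) L \<and>
    splitting_field_over K (F_poly 1 (\<delta> / 25) (1 / (8 * q))) L"
proof -
  let ?G = "galois_group K L"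
  have KL: "K \<subseteq> L" "is_subfield L" using assms(1) by (auto simp: galois_ext_def)
  obtain \<theta> where t: "\<theta> \<in> hom ?G (sym_group 5)" "bij_betw \<theta> (carrier ?G) (carrier (sym_group 5))"
    using assms(2) by (auto simp: is_iso_def iso_def)
  have car: "carrier (sym_group 5) = {\<pi>. \<pi> permutes {1..5}}" by (auto simp: sym_group_carrier)
  define \<Phi> where "\<Phi> = inv_into (carrier ?G) \<theta>"
  have b: "bij_betw \<Phi> {\<pi>. \<pi> permutes {1..5}} (carrier ?G)"
    unfolding \<Phi>_def using bij_betw_inv_into[OF t(2)] by (simp add: car)
  have inv: "\<theta> (\<Phi> \<pi>) = \<pi>" "\<Phi> \<pi> \<in> carrier ?G" if "\<pi> permutes {1..5}" for \<pi>
    using bij_betw_inv_into_right[OF t(2), of \<pi>] bij_betwE[OF b] that by (auto simp: car \<Phi>_def)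
  interpret S5_extension K L \<Phi>
  proof
    show "galois_ext K L" by (rule assms(1))
    show "bij_betw \<Phi> {\<pi>. \<pi> permutes {1..5}} (carrier ?G)" by (rule b)
    fix \<rho> \<pi> x assume p: "\<rho> permutes {1..5::nat}" "\<pi> permutes {1..5::nat}" "x \<in> L"
    have c: "compose L (\<Phi> \<rho>) (\<Phi> \<pi>) \<in> carrier ?G"
      by (intro galois_group_compose KL inv p)
    have "\<theta> (compose L (\<Phi> \<rho>) (\<Phi> \<pi>)) = \<rho> \<circ> \<pi>"
      using hom_mult[OF t(1) inv(2)[OF p(1)] inv(2)[OF p(2)]]
        galois_group_mult[OF inv(2)[OF p(1)] inv(2)[OF p(2)]] inv(1) p by (simp add: sym_group_mult)
    then have "\<Phi> (\<rho> \<circ> \<pi>) = compose L (\<Phi> \<rho>) (\<Phi> \<pi>)"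
      unfolding \<Phi>_def using bij_betw_inv_into_left[OF t(2) c] unfolding \<Phi>_def by simp
    then show "\<Phi> (\<rho> \<circ> \<pi>) x = \<Phi> \<rho> (\<Phi> \<pi> x)" using p(3) by (simp add: compose_def)
  qed
  show ?thesis using parametrized_splitting assms by blast
qed

subsection \<open>The generic configuration of five points\<close>

lemma exists_index_bij: "\<exists>e. bij_betw e {1..5::nat} (UNIV :: 5 set)"
  by (rule finite_same_card_bij) auto

definition point5 :: "nat \<Rightarrow> 5" where
  "point5 = (SOME e. bij_betw e {1..5} UNIV)"

lemma point5: "bij_betw point5 {1..5} UNIV"
  unfolding point5_def by (rule someI_ex[OF exists_index_bij])

definition generic_point :: "nat \<Rightarrow> ('k::field, 5) ratfun" where
  "generic_point j = indet (point5 j)"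

lemma generic_point_specialization:
  fixes \<xi> :: "nat \<Rightarrow> 'a::field" and \<iota> :: "'k::field \<Rightarrow> 'a"
  assumes "const_hom \<iota>"
  shows "\<forall>j\<in>{1..5}. (generic_point j, \<xi> j) \<in> specialization \<iota> (\<lambda>v. \<xi> (inv_into {1..5} point5 v))"
proof
  fix j :: nat assume "j \<in> {1..5}"
  then have "inv_into {1..5} point5 (point5 j) = j" using point5 by (simp add: bij_betw_def)
  then show "(generic_point j, \<xi> j) \<in> specialization \<iota> (\<lambda>v. \<xi> (inv_into {1..5} point5 v))"
    unfolding generic_point_def
    using specialization_indet[OF assms, of "point5 j" "\<lambda>v. \<xi> (inv_into {1..5} point5 v)"] by simp
qed

lemma generic_point_permute:
  assumes "\<pi> permutes {1..5}"
  shows "\<exists>s :: ('k::field, 5) ratfun \<Rightarrow> ('k, 5) ratfun. s 1 = 1 \<and>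
    (\<forall>x y. s (x + y) = s x + s y \<and> s (x * y) = s x * s y) \<and>
    (\<forall>a. s (const_ratfun a) = const_ratfun a) \<and> (\<forall>j\<in>{1..5}. s (generic_point j) = generic_point (\<pi> j))"
proof -
  define p where "p = point5 \<circ> \<pi> \<circ> inv_into {1..5} point5"
  have "bij p" unfolding p_def
    by (intro bij_betw_trans[OF bij_betw_inv_into[OF point5]] bij_betw_trans[OF permutes_imp_bij[OF assms]] point5)
  moreover have "p (point5 j) = point5 (\<pi> j)" if "j \<in> {1..5}" for j
    using point5 that by (simp add: p_def bij_betw_def)
  ultimately show ?thesis using permute_hom[of p] unfolding generic_point_def by metis
qed

lemma const_hom_hom:
  assumes "const_hom \<iota>" "h 1 = 1" "\<And>x y. h (x + y) = h x + h y" "\<And>x y. h (x * y) = h x * (h y :: 'b::field)"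
  shows "const_hom (h \<circ> \<iota>)"
proof -
  have "h 0 = 0" using assms(3)[of 0 0] by (metis add.right_neutral add_left_cancel)
  then show ?thesis using assms by (simp add: const_hom_def)
qed

lemma const_hom_to_ac: "const_hom \<iota> \<Longrightarrow> const_hom (to_ac \<circ> \<iota>)"
  by (rule const_hom_hom) simp_all

text \<open>Indeterminate points specialize to every configuration, in particular to a good one.
  Such a configuration is taken in the algebraic closure, which is infinite even when
  \<open>'k\<close> is a prime field of positive characteristic.\<close>

lemma generic_point_good5:
  assumes "(2::'k::field) \<noteq> 0" "(3::'k) \<noteq> 0" "(5::'k) \<noteq> 0"
  shows "good5 (generic_point :: nat \<Rightarrow> ('k, 5) ratfun) \<noteq> 0"
proof
  assume zero: "good5 (generic_point :: nat \<Rightarrow> ('k, 5) ratfun) = 0"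
  have \<iota>: "const_hom (to_ac :: 'k \<Rightarrow> 'k alg_closure)" by (simp add: const_hom_def)
  have "to_ac (numeral n :: 'k) \<noteq> 0" if "numeral n \<noteq> (0 :: 'k)" for n using that by (simp del: to_ac_numeral)
  from this[OF assms(1)] this[OF assms(2)] this[OF assms(3)]
  have n: "(2::'k alg_closure) \<noteq> 0" "(3::'k alg_closure) \<noteq> 0" "(5::'k alg_closure) \<noteq> 0" by simp_all
  obtain v :: "nat \<Rightarrow> 'k alg_closure" where v: "good5 v \<noteq> 0"
    using exists_good5[OF infinite_UNIV_alg_closed n(1,2)] by blast
  interpret S: ring_relation "specialization to_ac (\<lambda>x. v (inv_into {1..5} point5 x))"
    by (rule specialization_ring_rel[OF \<iota>])
  from S.good5_rel[OF generic_point_specialization[OF \<iota>, of v]] zero v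
  show False using specialization_zero[OF \<iota>] by fastforce
qed

lemma specialization_delta5_q5:
  assumes \<iota>: "const_hom \<iota>" and rel: "\<forall>j\<in>{1..5}. (y j, y' j) \<in> specialization \<iota> \<xi>"
    and nz: "inv4 y' \<noteq> 0" "inv12 y' \<noteq> 0" "(2::'a::field) \<noteq> 0"
  shows "(delta5 y, delta5 (y' :: nat \<Rightarrow> 'a)) \<in> specialization \<iota> \<xi>" "(q5 y, q5 y') \<in> specialization \<iota> \<xi>"
proof -
  interpret S: ring_relation "specialization \<iota> \<xi>"
    by (rule specialization_ring_rel[OF \<iota>])
  have "64 * inv12 y' \<noteq> 0" using nz two_powers_nonzero by auto
  then show "(delta5 y, delta5 y') \<in> specialization \<iota> \<xi>" "(q5 y, q5 y') \<in> specialization \<iota> \<xi>"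
    unfolding delta5_def q5_def using nz(1)
    by (intro specialization_divide[OF \<iota>] S.mult S.power S.numeral S.disc5_rel[OF rel] S.inv4_rel[OF rel]
        S.inv12_rel[OF rel]; simp)+
qed

lemma numeral_ratfun_nonzero:
  assumes "(numeral n :: 'k::field) \<noteq> 0"
  shows "(numeral n :: ('k, 'v::{finite,linorder}) ratfun) \<noteq> 0"
proof -
  interpret C: field_relation "range (\<lambda>x. (x, const_ratfun x :: ('k, 'v) ratfun))"
    by (rule const_ratfun_field_rel)
  show ?thesis using C.numeral[of n] C.zero_left assms by fastforce
qed

text \<open>By independence, sending the indeterminates to the \<open>t v\<close> embeds the
  parameter field into the field of the five points. Elements of the image are quotients of
  polynomials in the invariant \<open>t v\<close>, so all permutations fix them, and the criterion
  for the symmetric group applies.\<close>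

theorem generic_symmetric:
  fixes Q :: "('k::field, 'v::{finite,linorder}) ratfun poly" and t :: "'v \<Rightarrow> ('k, 5) ratfun"
  assumes ind: "alg_indep const_ratfun t" and deg: "degree Q = 5"
    and t: "\<And>s \<pi> v. \<pi> permutes {1..5} \<Longrightarrow> field_relation (fun_graph s) \<Longrightarrow>
      \<forall>j\<in>{1..5}. s (generic_point j) = generic_point (\<pi> j) \<Longrightarrow> s (t v) = t v"
    and w: "\<And>s \<pi> j. \<pi> permutes {1..5} \<Longrightarrow> field_relation (fun_graph s) \<Longrightarrow>
      \<forall>j\<in>{1..5}. s (generic_point j) = generic_point (\<pi> j) \<Longrightarrow> j \<in> {1..5} \<Longrightarrow> s (w j) = w (\<pi> j)"
    and w12: "w 1 \<noteq> w 2"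
    and root: "\<And>\<phi> j. field_relation (fun_graph \<phi>) \<Longrightarrow> \<forall>v. \<phi> (indet v) = t v \<Longrightarrow> j \<in> {1..5} \<Longrightarrow> poly (map_poly \<phi> Q) (w j)
        = 0"
  shows "has_galois_group Q (sym_group 5) \<and> separable_poly Q \<and> irreducible Q"
proof -
  note \<kappa> = const_hom_const_ratfun
  obtain \<phi> where \<phi>: "\<phi> 1 = 1" "\<And>r s. \<phi> (r + s) = \<phi> r + \<phi> s" "\<And>r s. \<phi> (r * s) = \<phi> r * \<phi> s"
    and \<phi>s: "\<And>r. (r, \<phi> r) \<in> specialization const_ratfun t"
    using ratfun_hom[OF \<kappa> ind] by blast
  have \<phi>v: "\<phi> (indet v) = t v" for v
    by (rule specialization_unique[OF \<kappa> \<phi>s specialization_indet[OF \<kappa>]])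
  have ex: "\<exists>s. s 1 = 1 \<and> (\<forall>x y. s (x + y) = s x + s y \<and> s (x * y) = s x * s y) \<and>
        (\<forall>a. s (\<phi> a) = \<phi> a) \<and> (\<forall>j\<in>{1..5}. s (w j) = w (\<pi> j))" if pi: "\<pi> permutes {1..5}" for \<pi>
  proof -
    obtain s :: "('k, 5) ratfun \<Rightarrow> ('k, 5) ratfun" where s: "s 1 = 1" "\<And>x y. s (x + y) = s x + s y"
        "\<And>x y. s (x * y) = s x * s y"
      "\<And>a. s (const_ratfun a) = const_ratfun a" "\<forall>j\<in>{1..5}. s (generic_point j) = generic_point (\<pi> j)"
      using generic_point_permute[OF pi] by blast
    have rel: "field_relation (fun_graph s)" by (rule hom_field_rel[OF s(1-3)])
    interpret S: field_relation "fun_graph s" by (rule rel)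
    have mem: "(a, b) \<in> fun_graph s \<longleftrightarrow> b = s a" for a b by auto
    have ev: "(eval_multipoly const_ratfun t c, eval_multipoly const_ratfun t c) \<in> fun_graph s" for c
      by (rule S.eval_multipoly_rel) (simp_all add: mem s(4) t[OF pi rel s(5)])
    have "s (\<phi> a) = \<phi> a" for a
    proof -
      obtain c d where "\<phi> a = eval_multipoly const_ratfun t c / eval_multipoly const_ratfun t d"
        using specializationE[OF \<kappa> \<phi>s[of a]] by metis
      then have "(\<phi> a, \<phi> a) \<in> fun_graph s" using S.divide[OF ev ev] by simp
      then show ?thesis by (simp add: mem)
    qed
    then show ?thesis using s(1-3) w[OF pi rel s(5)] by blast
  qed
  have inj: "inj_on w {1..5}"
    by (rule inj_on_of_equivariant[OF w12]) (use ex in blast)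
  have r: "poly (map_poly \<phi> Q) (w j) = 0" if "j \<in> {1..5}" for j
    using root[OF hom_field_rel[OF \<phi>] _ that] \<phi>v by blast
  from symmetric_galois_group[OF \<phi> deg _ inj r ex]
  show ?thesis by simp
qed

text \<open>The hypotheses say that \<open>(d, q)\<close> avoids the exceptional parameters of \<open>exists_config\<close>.\<close>

lemma exists_config_ratfun:
  fixes d q :: "('k::field, 'v::{finite,linorder}) ratfun"
  assumes two: "(2::'k) \<noteq> 0" and three: "(3::'k) \<noteq> 0" and five: "(5::'k) \<noteq> 0"
    and r1: "(d, - 25 / 3) \<in> specialization (\<lambda>x. x) \<tau>" "(q, 1) \<in> specialization (\<lambda>x. x) \<tau>"
    and r2: "(d, 0) \<in> specialization (\<lambda>x. x) \<tau>'"
  obtains y where "disc5 y \<noteq> 0" "inv4 y \<noteq> 0" "inv12 y \<noteq> 0" "delta5 y = to_ac d" "q5 y = to_ac q"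
proof -
  have \<iota>: "const_hom (\<lambda>x::'k. x)" by (simp add: const_hom_def)
  interpret S: ring_relation "specialization (\<lambda>x::'k. x) \<tau>"
    by (rule specialization_ring_rel[OF \<iota>])
  interpret S': ring_relation "specialization (\<lambda>x::'k. x) \<tau>'"
    by (rule specialization_ring_rel[OF \<iota>])
  note z = specialization_zero[OF \<iota>]
  have n25: "(25::'k) \<noteq> 0" using power_not_zero[OF five, of 2] by simp
  \<comment> \<open>A rational function is nonzero once it specializes to a nonzero value: the point
    with \<open>d = -25/3\<close> and \<open>q = 1\<close> settles \<open>d\<close>,
    \<open>q\<close> and the value of \<open>P\<close> at \<open>-50\<close>, the point with
    \<open>d = 0\<close> settles \<open>25 + 3 * d\<close>.\<close>
  have d0: "d \<noteq> 0" using r1(1) z n25 three by fastforce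
  have q0: "q \<noteq> 0" using r1(2) z by fastforce
  have "(25 + 3 * d, 25 + 3 * 0) \<in> specialization (\<lambda>x. x) \<tau>'"
    by (intro S'.add S'.mult S'.numeral r2)
  then have d25: "25 + 3 * d \<noteq> 0" using z n25 by fastforce
  have "(poly (P_poly d q) (- 50), poly (P_poly (- 25 / 3) 1) (- 50)) \<in> specialization (\<lambda>x. x) \<tau>"
    by (intro S.poly_eval S.P_poly_rel S.uminus S.numeral r1)
  moreover have "poly (P_poly (- 25 / 3) 1) (- 50 :: 'k) \<noteq> 0"
  proof -
    define c where "c = - 25 / (3 :: 'k)"
    have c: "3 * c = - 25" using three by (simp add: c_def)
    \<comment> \<open>At \<open>u = -50\<close> the leading part of \<open>P\<close> vanishes, and
      \<open>25 + 3 * c = 0\<close> removes the quadratic part in \<open>z\<close>. Only the linear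
      term is left, with constant \<open>2^8 * 3^5 * 5^10\<close>.\<close>
    have "poly (P_poly c z) (- 50) = - 607500000000 * z" for z
    proof -
      have "25 + 3 * c = 0" using c by simp
      then show ?thesis unfolding poly_P_poly by simp
    qed
    then have "poly (P_poly c 1) (- 50) = - (2^8 * 3^5 * 5^10)" by simp
    moreover have "2^8 * 3^5 * 5^10 \<noteq> (0 :: 'k)" by (intro no_zero_divisors power_not_zero two three five)
    ultimately show ?thesis unfolding c_def by (simp only: neg_equal_0_iff_equal not_False_eq_True)
  qed
  ultimately have P50: "poly (P_poly d q) (- 50) \<noteq> 0" using z by fastforce
  let ?a = "to_ac :: ('k, 'v) ratfun \<Rightarrow> ('k, 'v) ratfun alg_closure"
  interpret A: field_relation "range (\<lambda>x. (x, ?a x))" by (rule hom_field_rel; simp)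
  have mem: "(a, b) \<in> range (\<lambda>x. (x, ?a x)) \<longleftrightarrow> b = ?a a" for a b by auto
  have ac: "?a (poly (P_poly d q) (- 50)) = poly (P_poly (?a d) (?a q)) (- 50)"
    using A.poly_eval[OF A.P_poly_rel[of d "?a d" q "?a q"] A.uminus[OF A.numeral]] by (simp add: mem)
  have num: "(numeral n :: ('k, 'v) ratfun alg_closure) \<noteq> 0" if "(numeral n :: 'k) \<noteq> 0" for n
    using numeral_ratfun_nonzero[OF that, where 'v = 'v] by (metis to_ac_numeral to_ac_eq_0_iff)
  have "?a (25 + 3 * d) \<noteq> 0" using d25 by (simp only: to_ac_eq_0_iff not_False_eq_True)
  then have d25': "25 + 3 * ?a d \<noteq> 0" by simp
  show ?thesis
    by (rule exists_config[OF num[OF two] num[OF three] num[OF five], of "?a d" "?a q"])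
      (use d0 q0 d25' P50 ac that in \<open>auto simp flip: ac\<close>)
qed

subsection \<open>Generic polynomials\<close>

context field_relation begin

lemma poly_rel_graph_eq:
  assumes "R = fun_graph h" "poly_rel R f g"
  shows "map_poly h f = g"
proof -
  have "h 0 = 0" using zero assms(1) by auto
  then have "poly_rel R f (map_poly h f)" unfolding assms(1) by (rule poly_rel_map_poly)
  then show ?thesis using assms(2) by (rule poly_rel_unique)
qed

end

definition spec3 :: "'a \<Rightarrow> 'a \<Rightarrow> 'a \<Rightarrow> 3 \<Rightarrow> 'a" where
  "spec3 a b c v = (if v = 0 then a else if v = 1 then b else c)"

lemma spec3 [simp]: "spec3 a b c 0 = a" "spec3 a b c 1 = b" "spec3 a b c 2 = c"
  by (simp_all add: spec3_def)

definition spec2 :: "'a \<Rightarrow> 'a \<Rightarrow> 2 \<Rightarrow> 'a" where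
  "spec2 a b v = (if v = 0 then a else b)"

lemma spec2 [simp]: "spec2 a b 0 = a" "spec2 a b 1 = b"
  by (simp_all add: spec2_def)

lemma all_2: "(\<forall>v::2. P v) \<longleftrightarrow> P 0 \<and> P 1"
proof -
  have "UNIV = {0, 1 :: 2}" by (intro card_seteq[symmetric]) auto
  then show ?thesis by (metis UNIV_I insertE singletonD)
qed

lemma all_3: "(\<forall>v::3. P v) \<longleftrightarrow> P 0 \<and> P 1 \<and> P 2"
proof -
  have "UNIV = {0, 1, 2 :: 3}" by (intro card_seteq[symmetric]) auto
  then show ?thesis by (metis UNIV_I insertE singletonD)
qed

lemma rootU_equivariant:
  assumes "\<pi> permutes {1..5}" "field_relation (fun_graph s)" "\<forall>j\<in>{1..5}. s (y j) = y (\<pi> j)"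
  shows "s (delta5 y) = delta5 y" "s (q5 y) = q5 y" "s (disc5 y) = disc5 y"
    "j \<in> {1..5} \<Longrightarrow> s (rootU y j) = rootU y (\<pi> j)"
proof -
  interpret S: field_relation "fun_graph s" by (rule assms(2))
  have mem: "(a, b) \<in> fun_graph s \<longleftrightarrow> b = s a" for a b by auto
  have y: "\<forall>j\<in>{1..5}. (y j, (y \<circ> \<pi>) j) \<in> fun_graph s" using assms(3) by (simp add: mem)
  show "s (delta5 y) = delta5 y" "s (q5 y) = q5 y" "s (disc5 y) = disc5 y"
    using S.delta5_rel[OF y] S.q5_rel[OF y] S.disc5_rel[OF y]
    unfolding mem delta5_permutes[OF assms(1)] q5_permutes[OF assms(1)] disc5_permutes[OF assms(1)] by simp_all
  show "s (rootU y j) = rootU y (\<pi> j)" if j: "j \<in> {1..5}"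
    using S.rootU_rel[OF y j] unfolding mem rootU_permutes[OF assms(1) j] by simp
qed

lemma alg_indep_to_ac_indet:
  "alg_indep (to_ac \<circ> const_ratfun) (to_ac \<circ> indet)"
  by (rule alg_indep_hom[OF _ _ _ alg_indep_indet]) simp_all

theorem P_symmetric:
  assumes two: "(2::'k::field) \<noteq> 0" and three: "(3::'k) \<noteq> 0" and five: "(5::'k) \<noteq> 0"
  shows "has_galois_group (P_poly (indet 0) (indet 1) :: ('k, 2) ratfun poly) (sym_group 5)"
    and "separable_poly (P_poly (indet 0) (indet 1) :: ('k, 2) ratfun poly)"
    and "irreducible (P_poly (indet 0) (indet 1) :: ('k, 2) ratfun poly)"
proof -
  let ?y = "generic_point :: nat \<Rightarrow> ('k, 5) ratfun"
  define t where "t = spec2 (delta5 ?y) (q5 ?y)"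
  note good = generic_point_good5[OF two three five]
  note g = good5D[OF good numeral_ratfun_nonzero[OF five]]
  have id: "const_hom (\<lambda>x::'k. x)" by (simp add: const_hom_def)
  \<comment> \<open>A configuration whose invariants are the two parameters themselves. The generic
    points specialize to it, so their invariants specialize to independent elements and are
    therefore independent.\<close>
  obtain \<xi> :: "nat \<Rightarrow> ('k, 2) ratfun alg_closure" where \<xi>: "disc5 \<xi> \<noteq> 0" "inv4 \<xi> \<noteq> 0" "inv12 \<xi> \<noteq> 0"
    "delta5 \<xi> = to_ac (indet 0)" "q5 \<xi> = to_ac (indet 1)"
  proof (rule exists_config_ratfun[OF two three five])
    show "(indet 0 :: ('k, 2) ratfun, - 25 / 3) \<in> specialization (\<lambda>x. x) (spec2 (- 25 / 3) 1)"
      using specialization_indet[OF id, of 0 "spec2 (- 25 / 3) 1"] by simp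
    show "(indet 1 :: ('k, 2) ratfun, 1) \<in> specialization (\<lambda>x. x) (spec2 (- 25 / 3) 1)"
      using specialization_indet[OF id, of 1 "spec2 (- 25 / 3) 1"] by simp
    show "(indet 0 :: ('k, 2) ratfun, 0) \<in> specialization (\<lambda>x. x) (spec2 0 1)"
      using specialization_indet[OF id, of 0 "spec2 0 1"] by simp
  qed blast
  let ?\<iota> = "to_ac \<circ> (const_ratfun :: 'k \<Rightarrow> ('k, 2) ratfun)"
  have \<iota>: "const_hom ?\<iota>" by (intro const_hom_to_ac const_hom_const_ratfun)
  have "(2 :: ('k, 2) ratfun) \<noteq> 0" by (rule numeral_ratfun_nonzero[OF two])
  then have two': "(2 :: ('k, 2) ratfun alg_closure) \<noteq> 0" by (metis to_ac_numeral to_ac_eq_0_iff)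
  note sp = specialization_delta5_q5[OF \<iota> generic_point_specialization[OF \<iota>] \<xi>(2,3) two', unfolded \<xi>(4,5)]
  have ind: "alg_indep const_ratfun t"
  proof (rule alg_indep_specialize[OF \<iota> _ alg_indep_to_ac_indet])
    show "(t v, (to_ac \<circ> indet) v) \<in> specialization ?\<iota> (\<lambda>v. \<xi> (inv_into {1..5} point5 v))" for v
      using sp all_2[of "\<lambda>v. (t v, (to_ac \<circ> indet) v) \<in> specialization ?\<iota> (\<lambda>v. \<xi> (inv_into {1..5} point5 v))"]
      by (simp add: t_def)
  qed
  have t: "s (t v) = t v" if "\<pi> permutes {1..5}" "field_relation (fun_graph s)"
    "\<forall>j\<in>{1..5}. s (?y j) = ?y (\<pi> j)" for s \<pi> v
    using rootU_equivariant(1,2)[OF that] by (simp add: t_def spec2_def)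
  have root: "poly (map_poly \<phi> (P_poly (indet 0) (indet 1))) (rootU ?y j) = 0"
    if "field_relation (fun_graph \<phi>)" "\<forall>v. \<phi> (indet v) = t v" "j \<in> {1..5}" for \<phi> :: "('k, 2) ratfun \<Rightarrow> _" and j
  proof -
    interpret F: field_relation "fun_graph \<phi>" by (rule that(1))
    have "(indet 0, delta5 ?y) \<in> fun_graph \<phi>" "(indet 1, q5 ?y) \<in> fun_graph \<phi>"
      using that(2) by (auto simp: t_def all_2 image_iff)
    from F.poly_rel_graph_eq[OF refl F.P_poly_rel[OF this]]
    show ?thesis using rootU_root[OF numeral_ratfun_nonzero[OF two] g(1-3) that(3)] by simp
  qed
  have w: "s (rootU ?y j) = rootU ?y (\<pi> j)" if "\<pi> permutes {1..5}" "field_relation (fun_graph s)"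
    "\<forall>j\<in>{1..5}. s (?y j) = ?y (\<pi> j)" "j \<in> {1..5}" for s \<pi> j
    by (rule rootU_equivariant(4)[OF that])
  have "has_galois_group (P_poly (indet 0) (indet 1) :: ('k, 2) ratfun poly) (sym_group 5) \<and>
    separable_poly (P_poly (indet 0) (indet 1) :: ('k, 2) ratfun poly) \<and>
    irreducible (P_poly (indet 0) (indet 1) :: ('k, 2) ratfun poly)"
    by (rule generic_symmetric[where t = t and w = "rootU ?y"]) (fact ind degree_P_poly t w g(4) root)+
  then show "has_galois_group (P_poly (indet 0) (indet 1) :: ('k, 2) ratfun poly) (sym_group 5)"
    "separable_poly (P_poly (indet 0) (indet 1) :: ('k, 2) ratfun poly)"
    "irreducible (P_poly (indet 0) (indet 1) :: ('k, 2) ratfun poly)"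
    by simp_all
qed

section \<open>Scaling of the points and the third parameter of \<open>F\<close>\<close>

lemma sqd_scale: "sqd (\<lambda>j. c * y j) i k = c^2 * sqd y i k"
  by (simp add: sqd_def flip: power_mult_distrib right_diff_distrib)

lemma scale_invariants:
  fixes y :: "nat \<Rightarrow> 'a::field"
  shows "disc5 (\<lambda>j. c * y j) = c^20 * disc5 y" "inv4 (\<lambda>j. c * y j) = c^10 * inv4 y"
    "inv12 (\<lambda>j. c * y j) = c^30 * inv12 y"
proof -
  show "disc5 (\<lambda>j. c * y j) = c^20 * disc5 y"
    unfolding disc5_def sqd_scale by Groebner_Basis.algebra
  show "inv4 (\<lambda>j. c * y j) = c^10 * inv4 y"
    unfolding inv4_def sqd_scale by Groebner_Basis.algebra
  have S: "covS (\<lambda>j. c * y j) = c^6 * covS y" for y :: "nat \<Rightarrow> 'a"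
    unfolding covS_def sqd_scale by Groebner_Basis.algebra
  have "at_point k (\<lambda>j. c * y j) = (\<lambda>j. c * at_point k y j)" for k
    by (simp add: at_point_def fun_eq_iff)
  then show "inv12 (\<lambda>j. c * y j) = c^30 * inv12 y"
    unfolding inv12_def by (simp add: S prod.distrib flip: power_mult)
qed

lemma scale_quotients:
  fixes y :: "nat \<Rightarrow> 'a::field"
  assumes "c \<noteq> 0"
  shows "delta5 (\<lambda>j. c * y j) = delta5 y" "q5 (\<lambda>j. c * y j) = q5 y"
proof -
  have "delta5 (\<lambda>j. c * y j) = (100 * disc5 y) * c^20 / (inv4 y ^ 2 * c^20)"
    unfolding delta5_def scale_invariants by (simp add: power_mult_distrib mult_ac flip: power_mult)
  then show "delta5 (\<lambda>j. c * y j) = delta5 y"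
    using assms unfolding delta5_def by (subst (asm) mult_divide_mult_cancel_right) auto
  have "q5 (\<lambda>j. c * y j) = inv4 y ^ 3 * c^30 / ((64 * inv12 y) * c^30)"
    unfolding q5_def scale_invariants by (simp add: power_mult_distrib mult_ac flip: power_mult)
  then show "q5 (\<lambda>j. c * y j) = q5 y"
    using assms unfolding q5_def by (subst (asm) mult_divide_mult_cancel_right) auto
qed

text \<open>\<open>D\<close> and \<open>M\<close> are solved from the two absolute invariants once
  \<open>A\<close> is given. For \<open>A\<close>, a symmetric function that is not scale invariant
  is taken, so that the scale of the points provides the third degree of freedom.\<close>

theorem F_symmetric:
  assumes two: "(2::'k::field) \<noteq> 0" and three: "(3::'k) \<noteq> 0" and five: "(5::'k) \<noteq> 0"
  shows "has_galois_group (F_poly (indet 0) (indet 1) (indet 2) :: ('k, 3) ratfun poly) (sym_group 5)"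
    and "separable_poly (F_poly (indet 0) (indet 1) (indet 2) :: ('k, 3) ratfun poly)"
    and "irreducible (F_poly (indet 0) (indet 1) (indet 2) :: ('k, 3) ratfun poly)"
proof -
  let ?y = "generic_point :: nat \<Rightarrow> ('k, 5) ratfun"
  let ?A = "indet 0 :: ('k, 3) ratfun"
  let ?D = "indet 1 :: ('k, 3) ratfun"
  let ?M = "indet 2 :: ('k, 3) ratfun"
  \<comment> \<open>Here \<open>A\<close> is \<open>disc5\<close>, not \<open>inv4\<close>: it is
    symmetric and nonzero, and scaling by \<open>c\<close> multiplies it by
    \<open>c^20\<close>.\<close>
  define A where "A = disc5 ?y"
  define D where "D = delta5 ?y * A^2 / 25"
  define M where "M = A^3 / (8 * q5 ?y)"
  define t where "t = spec3 A D M"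
  define w where "w j = (rootU ?y j - 1) / 3" for j
  note good = generic_point_good5[OF two three five]
  note n = numeral_ratfun_nonzero[OF two, where 'v = 5] numeral_ratfun_nonzero[OF three, where 'v = 5]
    numeral_ratfun_nonzero[OF five, where 'v = 5]
  note g = good5D[OF good n(3)]
  have n8: "(8 :: 'k) \<noteq> 0" "(25 :: 'k) \<noteq> 0"
    using two_powers_nonzero[OF two] power_not_zero[OF five, of 2] by simp_all
  note n8' = numeral_ratfun_nonzero[OF n8(1), where 'v = 3] numeral_ratfun_nonzero[OF n8(2), where 'v = 3]
    numeral_ratfun_nonzero[OF n8(1), where 'v = 5] numeral_ratfun_nonzero[OF n8(2), where 'v = 5]
  have id: "const_hom (\<lambda>x::'k. x)" by (simp add: const_hom_def)
  have nz: "?A \<noteq> 0" "?M \<noteq> 0"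
    using alg_indep_indet specialization_zero[OF id] specialization_indet[OF id, of _ "\<lambda>_. 1"] zero_neq_one by metis+
  define d where "d = 25 * ?D / ?A^2"
  define q where "q = ?A^3 / (8 * ?M)"
  have d_rel: "(d, 25 * b / 1^2) \<in> specialization (\<lambda>x. x) (spec3 1 b c)"
    and q_rel: "c \<noteq> 0 \<Longrightarrow> (q, 1^3 / (8 * c)) \<in> specialization (\<lambda>x. x) (spec3 1 b c)" for b c :: 'k
  proof -
    interpret S: ring_relation "specialization (\<lambda>x::'k. x) (spec3 1 b c)"
      by (rule specialization_ring_rel[OF id])
    have ind: "(?A, 1) \<in> specialization (\<lambda>x. x) (spec3 1 b c)" "(?D, b) \<in> specialization (\<lambda>x. x) (spec3 1 b c)"
      "(?M, c) \<in> specialization (\<lambda>x. x) (spec3 1 b c)"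
      using specialization_indet[OF id, of 0 "spec3 1 b c"] specialization_indet[OF id, of 1 "spec3 1 b c"]
        specialization_indet[OF id, of 2 "spec3 1 b c"] by simp_all
    show "(d, 25 * b / 1^2) \<in> specialization (\<lambda>x. x) (spec3 1 b c)"
      unfolding d_def by (intro specialization_divide[OF id] S.mult S.power S.numeral ind) simp
    show "(q, 1^3 / (8 * c)) \<in> specialization (\<lambda>x. x) (spec3 1 b c)" if "c \<noteq> 0"
      unfolding q_def by (intro specialization_divide[OF id] S.mult S.power S.numeral ind) (use n8 that in simp)
  qed
  obtain \<xi>0 :: "nat \<Rightarrow> ('k, 3) ratfun alg_closure" where \<xi>0: "disc5 \<xi>0 \<noteq> 0" "inv4 \<xi>0 \<noteq> 0" "inv12 \<xi>0 \<noteq> 0"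
    "delta5 \<xi>0 = to_ac d" "q5 \<xi>0 = to_ac q"
  proof (rule exists_config_ratfun[OF two three five])
    \<comment> \<open>Test point \<open>A = 1\<close>, \<open>D = -1/3\<close>,
      \<open>M = 1/8\<close>, at which \<open>d\<close> is \<open>-25/3\<close> and \<open>q\<close>
      is \<open>1\<close>.\<close>
    have "25 * (- 1 / 3) / 1^2 = - 25 / (3 :: 'k)" by simp
    then show "(d, - 25 / 3) \<in> specialization (\<lambda>x. x) (spec3 1 (- 1 / 3) (1 / 8))"
      using d_rel[of "- 1 / 3" "1 / 8"] by simp
    have "1^3 / (8 * (1 / 8)) = (1 :: 'k)" using n8 by simp
    then show "(q, 1) \<in> specialization (\<lambda>x. x) (spec3 1 (- 1 / 3) (1 / 8 :: 'k))"
      using q_rel[of "1 / 8" "- 1 / 3"] n8 by simp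
    show "(d, 0) \<in> specialization (\<lambda>x. x) (spec3 1 0 (1 :: 'k))" using d_rel[of 0 1] by simp
  qed blast
  \<comment> \<open>Scaling \<open>\<xi>0\<close> by a 20th root adjusts its discriminant to the
    indeterminate \<open>A\<close> without changing \<open>delta5\<close> and
    \<open>q5\<close>.\<close>
  obtain c where c: "c ^ 20 = to_ac ?A / disc5 \<xi>0" using nth_root_exists[of 20 "to_ac ?A / disc5 \<xi>0"] by auto
  have "c ^ 20 \<noteq> 0" using c nz \<xi>0(1) by simp
  then have c0: "c \<noteq> 0" by auto
  define \<xi> where "\<xi> j = c * \<xi>0 j" for j
  have \<xi>: "disc5 \<xi> = to_ac ?A" "inv4 \<xi> \<noteq> 0" "inv12 \<xi> \<noteq> 0" "delta5 \<xi> = to_ac d" "q5 \<xi> = to_ac q"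
    unfolding \<xi>_def scale_invariants scale_quotients[OF c0] using \<xi>0 c c0 by simp_all
  let ?\<iota> = "to_ac \<circ> (const_ratfun :: 'k \<Rightarrow> ('k, 3) ratfun)"
  let ?R = "specialization ?\<iota> (\<lambda>v. \<xi> (inv_into {1..5} point5 v))"
  have \<iota>: "const_hom ?\<iota>" by (intro const_hom_to_ac const_hom_const_ratfun)
  interpret S: ring_relation ?R by (rule specialization_ring_rel[OF \<iota>])
  have "(numeral m :: ('k, 3) ratfun alg_closure) \<noteq> 0" if "(numeral m :: 'k) \<noteq> 0" for m
    using numeral_ratfun_nonzero[OF that, where 'v = 3] by (metis to_ac_numeral to_ac_eq_0_iff)
  note na = this[OF two] this[OF n8(1)] this[OF n8(2)]
  note sp = specialization_delta5_q5[OF \<iota> generic_point_specialization[OF \<iota>] \<xi>(2,3) na(1), unfolded \<xi>(4,5)]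
  have spA: "(A, to_ac ?A) \<in> ?R"
    using S.disc5_rel[OF generic_point_specialization[OF \<iota>, of \<xi>]] unfolding \<xi>(1) A_def .
  have q0: "to_ac q \<noteq> 0" using nz na by (simp add: q_def)
  have "(D, to_ac d * to_ac ?A^2 / 25) \<in> ?R"
    unfolding D_def by (intro specialization_divide[OF \<iota>] S.mult S.power S.numeral sp spA na)
  also have "to_ac d * to_ac ?A^2 / 25 = to_ac ?D"
  proof -
    have "d * ?A^2 / 25 = ?D" using nz n8' by (simp add: d_def)
    then show ?thesis by (metis to_ac_divide to_ac_mult to_ac_power to_ac_numeral)
  qed
  finally have spD: "(D, to_ac ?D) \<in> ?R" .
  have "(M, to_ac ?A^3 / (8 * to_ac q)) \<in> ?R"
    unfolding M_def using q0 na by (intro specialization_divide[OF \<iota>] S.mult S.power S.numeral sp spA) simp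
  also have "to_ac ?A^3 / (8 * to_ac q) = to_ac ?M"
  proof -
    have "?A^3 / (8 * q) = ?M" using nz n8' by (simp add: q_def)
    then show ?thesis by (metis to_ac_divide to_ac_mult to_ac_power to_ac_numeral)
  qed
  finally have spM: "(M, to_ac ?M) \<in> ?R" .
  have ind: "alg_indep const_ratfun t"
  proof (rule alg_indep_specialize[OF \<iota> _ alg_indep_to_ac_indet])
    show "(t v, (to_ac \<circ> indet) v) \<in> ?R" for v
      using spA spD spM all_3[of "\<lambda>v. (t v, (to_ac \<circ> indet) v) \<in> ?R"] by (simp add: t_def)
  qed
  have A0: "A \<noteq> 0" using g by (simp add: A_def)
  have q50: "q5 ?y \<noteq> 0" using g two_powers_nonzero[OF n(1)] by (simp add: q5_def)
  have M0: "M \<noteq> 0" using A0 q50 n8' by (simp add: M_def)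
  have dq: "25 * D / A^2 = delta5 ?y" "A^3 / (8 * M) = q5 ?y"
    using A0 q50 n8' by (simp_all add: D_def M_def)
  have act: "s A = A \<and> s D = D \<and> s M = M \<and> (\<forall>j\<in>{1..5}. s (w j) = w (\<pi> j))"
    if s: "\<pi> permutes {1..5}" "field_relation (fun_graph s)" "\<forall>j\<in>{1..5}. s (?y j) = ?y (\<pi> j)" for s \<pi>
  proof -
    interpret F: field_relation "fun_graph s" by (rule s(2))
    have mem: "(a, b) \<in> fun_graph s \<longleftrightarrow> b = s a" for a b by auto
    note e = rootU_equivariant[OF s]
    have r: "(A, A) \<in> fun_graph s" "(delta5 ?y, delta5 ?y) \<in> fun_graph s"
      "(q5 ?y, q5 ?y) \<in> fun_graph s" unfolding mem A_def using e by simp_all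
    have "(D, D) \<in> fun_graph s" unfolding D_def by (intro F.divide F.mult F.power F.numeral r)
    moreover have "(M, M) \<in> fun_graph s" unfolding M_def by (intro F.divide F.mult F.power F.numeral r)
    moreover have "(w j, w (\<pi> j)) \<in> fun_graph s" if "j \<in> {1..5}" for j
      unfolding w_def using e(4)[OF that] by (intro F.divide F.diff F.one F.numeral) (simp add: mem)
    ultimately show ?thesis using r(1) by (simp add: mem)
  qed
  have t: "s (t v) = t v" if "\<pi> permutes {1..5}" "field_relation (fun_graph s)"
    "\<forall>j\<in>{1..5}. s (?y j) = ?y (\<pi> j)" for s \<pi> v
    using act[OF that] by (simp add: t_def spec3_def)
  have w: "s (w j) = w (\<pi> j)" if "\<pi> permutes {1..5}" "field_relation (fun_graph s)"
    "\<forall>j\<in>{1..5}. s (?y j) = ?y (\<pi> j)" "j \<in> {1..5}" for s \<pi> j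
    using act[OF that(1-3)] that(4) by blast
  have w12: "w 1 \<noteq> w 2" using g(4) n by (simp add: w_def)
  have root: "poly (map_poly \<phi> (F_poly ?A ?D ?M)) (w j) = 0"
    if "field_relation (fun_graph \<phi>)" "\<forall>v. \<phi> (indet v) = t v" "j \<in> {1..5}" for \<phi> :: "('k, 3) ratfun \<Rightarrow> _" and j
  proof -
    interpret F: field_relation "fun_graph \<phi>" by (rule that(1))
    have "(?A, A) \<in> fun_graph \<phi>" "(?D, D) \<in> fun_graph \<phi>" "(?M, M) \<in> fun_graph \<phi>"
      using that(2) by (auto simp: t_def all_3 image_iff)
    then have eq: "map_poly \<phi> (F_poly ?A ?D ?M) = F_poly A D M"
      by (intro F.poly_rel_graph_eq[OF refl] F.F_poly_rel)
    have "3 * w j = rootU ?y j - 1"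
      unfolding w_def using n(2) by (simp only: times_divide_eq_right nonzero_mult_div_cancel_left not_False_eq_True)
    then have "3 * w j + 1 = rootU ?y j" by simp
    then have "27 * poly (F_poly A D M) (w j) = 0"
      unfolding poly_F_poly[OF A0 M0 n(1)] dq using rootU_root[OF n(1) g(1-3) that(3)] by simp
    moreover have "(27 :: ('k, 5) ratfun) \<noteq> 0" using power_not_zero[OF n(2), of 3] by simp
    ultimately show ?thesis unfolding eq by simp
  qed
  have deg: "degree (F_poly ?A ?D ?M) = 5"
    by (rule degree_F_poly[OF nz(2) numeral_ratfun_nonzero[OF two] numeral_ratfun_nonzero[OF three]])
  have "has_galois_group (F_poly ?A ?D ?M) (sym_group 5) \<and> separable_poly (F_poly ?A ?D ?M) \<and>
    irreducible (F_poly ?A ?D ?M)"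
    by (rule generic_symmetric[where t = t and w = w]) (fact ind deg t w w12 root)+
  then show "has_galois_group (F_poly ?A ?D ?M) (sym_group 5)" "separable_poly (F_poly ?A ?D ?M)"
    "irreducible (F_poly ?A ?D ?M)"
    by simp_all
qed

lemma splitting_specialization:
  fixes K L :: "'l::field set" and \<iota> :: "'k::idom \<Rightarrow> 'l"
  assumes hom: "const_hom \<iota>" and KL: "galois_ext K L \<and> galois_group K L \<cong> sym_group 5"
    and n: "(2::'l) \<noteq> 0" "(3::'l) \<noteq> 0" "(5::'l) \<noteq> 0"
  shows "\<exists>\<tau> f. range \<tau> \<subseteq> K \<and> specializes_to \<iota> \<tau> (P_poly (indet 0) (indet 1) :: ('k, 2) ratfun poly) f \<and>
      splitting_field_over K f L" (is ?P)
    and "\<exists>\<tau> f. range \<tau> \<subseteq> K \<and> specializes_to \<iota> \<tau> (F_poly (indet 0) (indet 1) (indet 2) :: ('k, 3) ratfun poly) f \<and>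
      splitting_field_over K f L" (is ?F)
proof -
  obtain d q where dq: "d \<in> K" "q \<in> K" "splitting_field_over K (P_poly d q) L"
    "splitting_field_over K (F_poly 1 (d / 25) (1 / (8 * q))) L"
    using generic_splitting[OF conjunct1[OF KL] conjunct2[OF KL] n] by blast
  note sp = specialization_indet[OF hom]
  let ?\<tau>2 = "spec2 d q"
  let ?\<tau>3 = "spec3 1 (d / 25) (1 / (8 * q))"
  interpret S2: ring_relation "specialization \<iota> ?\<tau>2" by (rule specialization_ring_rel[OF hom])
  interpret S3: ring_relation "specialization \<iota> ?\<tau>3" by (rule specialization_ring_rel[OF hom])
  have "specializes_to \<iota> ?\<tau>2 (P_poly (indet 0) (indet 1)) (P_poly d q)"
    unfolding specializes_to_iff using sp[of 0 ?\<tau>2] sp[of 1 ?\<tau>2] by (intro S2.P_poly_rel) simp_all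
  moreover have "range ?\<tau>2 \<subseteq> K" using dq(1,2) by (auto simp: spec2_def)
  ultimately show ?P using dq(3) by blast
  have "is_subfield K" using KL by (simp add: galois_ext_def)
  then interpret I: field_relation "Id_on K" by (rule subfield_field_rel)
  have dq': "(d, d) \<in> Id_on K" "(q, q) \<in> Id_on K" using dq by auto
  have "(d / 25, d / 25) \<in> Id_on K" by (intro I.divide I.numeral dq')
  moreover have "(1 / (8 * q), 1 / (8 * q)) \<in> Id_on K" by (intro I.divide I.mult I.numeral I.one dq')
  ultimately have "range ?\<tau>3 \<subseteq> K" using I.one by (auto simp: spec3_def)
  moreover have "specializes_to \<iota> ?\<tau>3 (F_poly (indet 0) (indet 1) (indet 2)) (F_poly 1 (d / 25) (1 / (8 * q)))"
    unfolding specializes_to_iff using sp[of 0 ?\<tau>3] sp[of 1 ?\<tau>3] sp[of 2 ?\<tau>3] by (intro S3.F_poly_rel) simp_all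
  ultimately show ?F using dq(4) by blast
qed

lemma generic_char_zeroI:
  "generic_char_zero TYPE('l::field_char_0) (sym_group 5) P_generic"
  "generic_char_zero TYPE('l::field_char_0) (sym_group 5) F_generic"
proof -
  have "has_galois_group P_generic (sym_group 5)" unfolding P_generic_def by (rule P_symmetric) simp_all
  then show "generic_char_zero TYPE('l) (sym_group 5) P_generic"
    unfolding generic_char_zero_def P_generic_def
    using splitting_specialization(1)[OF const_hom_of_rat] by fastforce
  have "has_galois_group F_generic (sym_group 5)" unfolding F_generic_def by (rule F_symmetric) simp_all
  then show "generic_char_zero TYPE('l) (sym_group 5) F_generic"
    unfolding generic_char_zero_def F_generic_def
    using splitting_specialization(2)[OF const_hom_of_rat] by fastforce
qed

lemma generic_char_pI:
  assumes p: "CARD('p::prime_card) \<notin> {2, 3, 5}"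
  shows "generic_char_p TYPE('p) TYPE('l::field) (sym_group 5) P_generic"
    "generic_char_p TYPE('p) TYPE('l::field) (sym_group 5) F_generic"
proof -
  have prime: "prime CARD('p)" by (rule prime_card)
  have ndvd: "\<not> CARD('p) dvd r" if "prime r" "r \<in> {2, 3, 5}" for r
    using primes_dvd_imp_eq[OF prime that(1)] p that(2) by auto
  have nd: "\<not> CARD('p) dvd 2" "\<not> CARD('p) dvd 3" "\<not> CARD('p) dvd 5" by (intro ndvd; simp)+
  have n: "(2 :: 'a::field) \<noteq> 0" "(3 :: 'a) \<noteq> 0" "(5 :: 'a) \<noteq> 0" if "CHAR('a) = CARD('p)"
    using nd of_nat_eq_0_iff_char_dvd[where 'a = 'a, of 2] of_nat_eq_0_iff_char_dvd[where 'a = 'a, of 3]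
      of_nat_eq_0_iff_char_dvd[where 'a = 'a, of 5] unfolding that by simp_all
  note np = n[OF semiring_char_mod_ring]
  interpret R2: ring_relation "reduction :: ((rat, 2) ratfun \<times> ('p mod_ring, 2) ratfun) set"
    by (rule reduction_ring_rel)
  interpret R3: ring_relation "reduction :: ((rat, 3) ratfun \<times> ('p mod_ring, 3) ratfun) set"
    by (rule reduction_ring_rel)
  show "generic_char_p TYPE('p) TYPE('l) (sym_group 5) P_generic"
    unfolding generic_char_p_def
  \<comment> \<open>The reduction is the same expression in the indeterminates over the prime field,
    since all its coefficients are integral polynomials in them.\<close>
  proof (intro exI[of _ "P_poly (indet 0) (indet 1)"] conjI allI impI)
    show "reduces_to P_generic (P_poly (indet 0) (indet 1) :: ('p mod_ring, 2) ratfun poly)"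
      unfolding reduces_to_iff P_generic_def by (intro R2.P_poly_rel reduction_indet)
    fix K L :: "'l set" assume char: "CHAR('l) = CARD('p)" and KL: "galois_ext K L \<and> galois_group K L \<cong> sym_group 5"
    show "\<exists>\<tau> f. range \<tau> \<subseteq> K \<and> specializes_to (of_mod_ring :: 'p mod_ring \<Rightarrow> 'l) \<tau>
        (P_poly (indet 0) (indet 1) :: ('p mod_ring, 2) ratfun poly) f \<and> splitting_field_over K f L"
      by (rule splitting_specialization(1)[OF const_hom_of_mod_ring[OF char] KL n[OF char]])
  qed (rule P_symmetric[OF np])+
  show "generic_char_p TYPE('p) TYPE('l) (sym_group 5) F_generic"
    unfolding generic_char_p_def
  proof (intro exI[of _ "F_poly (indet 0) (indet 1) (indet 2)"] conjI allI impI)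
    show "reduces_to F_generic (F_poly (indet 0) (indet 1) (indet 2) :: ('p mod_ring, 3) ratfun poly)"
      unfolding reduces_to_iff F_generic_def by (intro R3.F_poly_rel reduction_indet)
    fix K L :: "'l set" assume char: "CHAR('l) = CARD('p)" and KL: "galois_ext K L \<and> galois_group K L \<cong> sym_group 5"
    show "\<exists>\<tau> f. range \<tau> \<subseteq> K \<and> specializes_to (of_mod_ring :: 'p mod_ring \<Rightarrow> 'l) \<tau>
        (F_poly (indet 0) (indet 1) (indet 2) :: ('p mod_ring, 3) ratfun poly) f \<and> splitting_field_over K f L"
      by (rule splitting_specialization(2)[OF const_hom_of_mod_ring[OF char] KL n[OF char]])
  qed (rule F_symmetric[OF np])+
qed

theorem theorem1:
  shows "generic_polynomial_outside
           TYPE('p::prime_card) TYPE('l0::field_char_0) TYPE('lp::field)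
           {2, 3, 5} (sym_group 5) F_generic \<and>
         generic_polynomial_outside
           TYPE('p::prime_card) TYPE('l0::field_char_0) TYPE('lp::field)
           {2, 3, 5} (sym_group 5) P_generic"
proof -
  have "finite (carrier (sym_group 5))"
    by (simp add: sym_group_def finite_permutations)
  then show ?thesis
    unfolding generic_polynomial_outside_def
    using generic_char_zeroI generic_char_pI sym_group_is_group by auto
qed

end
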